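(* Let $(X,\Sigma,\mu)$ be a locally standard measure space and for each $p\in X$ assign a locally Hilbert space $\mathcal{D}_p=\varinjlim_{\alpha\in\Lambda}\mathcal{H}_{\alpha,p}$. Let $\mathcal{M}_{\mathrm{DIAG}}$ be the set of all diagonalizable locally bounded operators on $\int_X^{\oplus_{\mathrm{loc}}}\mathcal{D}_p\,\mathrm{d}\mu(p)$ and $(\mathcal{M}_{\mathrm{DIAG}})'$ its commutant in the algebra of all locally bounded operators. Then $$(\mathcal{M}_{\mathrm{DIAG}})'=\varprojlim_{\alpha\in\Lambda}\int_{X_\alpha}^{\oplus}\mathcal{B}(\mathcal{H}_{\alpha,p})\,\mathrm{d}\mu_\alpha ,$$ the projective limit being taken with respect to the compression maps $\phi_{\alpha,\beta}$, $\alpha\le\beta$, and the equality being understood as follows: the maps $\gamma_\alpha(T)=V_\alpha TV_\alpha^*$ are well-defined continuous maps $(\mathcal{M}_{\mathrm{DIAG}})'\to\int_{X_\alpha}^{\oplus}\mathcal{B}(\mathcal{H}_{\alpha,p})\,\mathrm{d}\mu_\alpha$ satisfying $\phi_{\alpha,\beta}\circ\gamma_\beta=\gamma_\alpha$ for $\alpha\le\beta$, and there is a unique continuous linear map $\phi$ from $(\mathcal{M}_{\mathrm{DIAG}})'$ to the projective limit whose composition with the $\alpha$-th coordinate projection is $\gamma_\alpha$ for every $\alpha\in\Lambda$.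
   Context: **Locally Hilbert spaces.** Let $(\Lambda,\le)$ be a directed poset. A family $\mathcal{E}=\{\mathcal{H}_\alpha\}_{\alpha\in\Lambda}$ of Hilbert spaces is a strictly inductive system if $\mathcal{H}_\alpha\subseteq\mathcal{H}_\beta$ and the inclusion is isometric whenever $\alpha\le\beta$. A locally Hilbert space is the inductive limit $\mathcal{D}=\varinjlim_\alpha\mathcal{H}_\alpha=\bigcup_{\alpha}\mathcal{H}_\alpha$ of such a system, with the inner product induced from the $\mathcal{H}_\alpha$. A linear map $T:\mathcal{D}\to\mathcal{D}$ is locally bounded if for every $\alpha$: $T(\mathcal{H}_\alpha)\subseteq\mathcal{H}_\alpha$, $T(\mathcal{H}_\alpha^\perp\cap\mathcal{D})\subseteq\mathcal{H}_\alpha^\perp\cap\mathcal{D}$, and $T|_{\mathcal{H}_\alpha}\in\mathcal{B}(\mathcal{H}_\alpha)$. $C^*_{\mathcal{E}}(\mathcal{D})$ denotes the $*$-algebra of locally bounded operators on $\mathcal{D}$, with the locally convex topology of the seminorms $p_\alpha(T)=\|T|_{\mathcal{H}_\alpha}\|$. The commutant of $\mathcal{M}\subseteq C^*_{\mathcal{E}}(\mathcal{D})$ is $\mathcal{M}'=\{T\in C^*_{\mathcal{E}}(\mathcal{D}): TS=ST\ \forall S\in\mathcal{M}\}$. **Locally standard measure spaces.** A family $\{(X_\alpha,\Sigma_\alpha)\}_{\alpha\in\Lambda}$ of measurable spaces is a strictly inductive system if, for $\alpha\le\beta$, $X_\alpha\subseteq X_\beta$ and $\Sigma_\alpha=\{E\cap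 X_\alpha: E\in\Sigma_\beta\}$ (in particular $\Sigma_\alpha\subseteq\Sigma_\beta$). Its inductive limit is $(X,\Sigma)$ with $X=\bigcup_\alpha X_\alpha$, $\Sigma=\{E\subseteq X: E\cap X_\alpha\in\Sigma_\alpha\ \forall\alpha\in\Lambda\}$. A family of finite positive measures $\mu_\alpha$ on $\Sigma_\alpha$ is a projective system of measures if $\mu_\alpha(E)=\mu_\beta(E)$ for $E\in\Sigma_\alpha$, $\alpha\le\beta$. Its projective limit is the measure $\mu$ on $\Sigma$ with $\mu(E)=\lim_\alpha\mu_\alpha(E\cap X_\alpha)$ if this net converges and $\mu(E)=\infty$ otherwise. $(X,\Sigma,\mu)$ is a locally standard measure space if each $(X_\alpha,\Sigma_\alpha,\mu_\alpha)$ is a standard measure space, i.e. its Borel structure is given by a complete separable metric space and $\mu_\alpha$ is a finite positive measure. **Direct integral.** Let $(X,\Sigma,\mu)$ be a locally standard measure space (indexed by $\Lambda$) and for $p\in X$ let $\mathcal{D}_p=\varinjlim_{\alpha\in\Lambda}\mathcal{H}_{\alpha,p}$ be a locally Hilbert space with $\{\mathcal{H}_{\alpha,p}\}_{\alpha}$ a strictly inductive system of separable Hilbert spaces. The direct integral $\int_X^{\oplus_{\mathrm{loc}}}\mathcal{D}_p\,\mathrm{d}\mu(p)$ comprises functions $u:X\to\bigcup_p\mathcal{D}_p$ with $u(p)\in\mathcal{D}_p$ for all $p$ satisfying: (1) for each $u$ there is $\alpha_u\in\Lambda$ with $\mathrm{supp}(u)=\{p: u(p)\ne0\}\subseteq X_{\alpha_u}$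 and $u(p)\in\mathcal{H}_{\alpha_u,p}$ for almost every $p\in X_{\alpha_u}$; (2) for any $u,v$ satisfying (1), $\zeta_{u,v}(p):=\langle u(p),v(p)\rangle_{\mathcal{D}_p}$ is in $L^1(X,\mu)$; (3) if $\{v_q\}_{q\in X}$ is a family with $v_q\in\mathcal{D}_q$ for all $q$ and there is $\alpha$ with $v_q=0$ for $q\in X\setminus X_\alpha$, and if $p\mapsto\langle u(p),v_p\rangle_{\mathcal{D}_p}$ is in $L^1(X,\mu)$ for every $u$ satisfying (1) with $\zeta_{u,u}\in L^1(X,\mu)$, then there is a function $v$ satisfying (1) with $\zeta_{v,v}\in L^1(X,\mu)$ and $v(p)=v_p$ for almost every $p\in X$. Operations are pointwise, functions equal almost everywhere are identified, and $\langle u,v\rangle=\int_X\langle u(p),v(p)\rangle\,\mathrm{d}\mu(p)$. The direct integral is a locally Hilbert space with strictly inductive system $\mathcal{E}=\{\mathcal{H}_\alpha\}_{\alpha\in\Lambda}$, $\mathcal{H}_\alpha=\{u:\mathrm{supp}(u)\subseteq X_\alpha,\ u(p)\in\mathcal{H}_{\alpha,p}\text{ for a.e. }p\in X_\alpha\}$; locally bounded operators on it are understood with respect to this $\mathcal{E}$. Let $\int_{X_\alpha}^{\oplus}\mathcal{H}_{\alpha,p}\,\mathrm{d}\mu_\alpha(p)$ be the (classical) direct integral of Hilbert spaces; $V_\alpha:\mathcal{H}_\alpha\to\int_{X_\alpha}^{\oplus}\mathcal{H}_{\alpha,p}\,\mathrm{d}\mu_\alpha(p)$, $V_\alpha(u)(p)=u(p)$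 for $p\in X_\alpha$, is a unitary. In $V_\alpha TV_\alpha^*$, $T$ stands for $T|_{\mathcal{H}_\alpha}$. **Diagonalizable operators.** A locally bounded operator $T$ on $\int_X^{\oplus_{\mathrm{loc}}}\mathcal{D}_p\,\mathrm{d}\mu(p)$ is decomposable if there is a family of locally bounded operators $T_p:\mathcal{D}_p\to\mathcal{D}_p$, $p\in X$, such that for any $u$, $(Tu)(p)=T_pu(p)$ for almost every $p\in X$. It is diagonalizable if it is decomposable and there is a measurable $f:X\to\mathbb{C}$ such that for any $u$, $(Tu)(p)=f(p)u(p)$ for almost every $p\in X$. **The projective system.** $\int_{X_\alpha}^{\oplus}\mathcal{B}(\mathcal{H}_{\alpha,p})\,\mathrm{d}\mu_\alpha$ denotes the von Neumann algebra of all decomposable bounded operators on $\int_{X_\alpha}^{\oplus}\mathcal{H}_{\alpha,p}\,\mathrm{d}\mu_\alpha$, i.e. operators $S=\int_{X_\alpha}^{\oplus}S_p\,\mathrm{d}\mu_\alpha$ with $S_p\in\mathcal{B}(\mathcal{H}_{\alpha,p})$ and $(Sx)(p)=S_px(p)$ for a.e. $p$. With $J_{\beta,\alpha,p}:\mathcal{H}_{\alpha,p}\to\mathcal{H}_{\beta,p}$ the inclusion, for $\alpha\le\beta$ put $\phi_{\alpha,\beta}\big(\int_{X_\beta}^{\oplus}T_{\beta,p}\,\mathrm{d}\mu_\beta\big)=\int_{X_\alpha}^{\oplus}J_{\beta,\alpha,p}^*T_{\beta,p}J_{\beta,\alpha,p}\,\mathrm{d}\mu_\alpha$. The projective limit is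 the set of families $\{x_\alpha\}_\alpha$ in the product with $\phi_{\alpha,\beta}(x_\beta)=x_\alpha$ for $\alpha\le\beta$, with the weakest locally convex topology making all coordinate projections continuous (each algebra with its norm). *)

theory Defs
  imports "HOL-Analysis.Analysis"
begin

section \<open>Complex inner product spaces with explicit carrier\<close>

text \<open>The fibres vary with the point of the base space and the direct integral is a quotient,
  so spaces are records rather than types. The inner product is linear in its first argument.\<close>

record 'v ipspace =
  carr :: "'v set"
  vzero :: 'v
  vadd :: "'v \<Rightarrow> 'v \<Rightarrow> 'v"
  vscale :: "complex \<Rightarrow> 'v \<Rightarrow> 'v"
  vinner :: "'v \<Rightarrow> 'v \<Rightarrow> complex"

locale complex_inner_space =
  fixes V :: "'v ipspace"
  assumes zero_closed: "vzero V \<in> carr V"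
    and add_closed: "\<lbrakk>x \<in> carr V; y \<in> carr V\<rbrakk> \<Longrightarrow> vadd V x y \<in> carr V"
    and scale_closed: "x \<in> carr V \<Longrightarrow> vscale V c x \<in> carr V"
    and add_assoc: "\<lbrakk>x \<in> carr V; y \<in> carr V; z \<in> carr V\<rbrakk>
      \<Longrightarrow> vadd V (vadd V x y) z = vadd V x (vadd V y z)"
    and add_commute: "\<lbrakk>x \<in> carr V; y \<in> carr V\<rbrakk> \<Longrightarrow> vadd V x y = vadd V y x"
    and add_zero: "x \<in> carr V \<Longrightarrow> vadd V x (vzero V) = x"
    and add_neg: "x \<in> carr V \<Longrightarrow> vadd V x (vscale V (-1) x) = vzero V"
    and scale_add_right: "\<lbrakk>x \<in> carr V; y \<in> carr V\<rbrakk>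
      \<Longrightarrow> vscale V c (vadd V x y) = vadd V (vscale V c x) (vscale V c y)"
    and scale_add_left: "x \<in> carr V
      \<Longrightarrow> vscale V (c + d) x = vadd V (vscale V c x) (vscale V d x)"
    and scale_scale: "x \<in> carr V \<Longrightarrow> vscale V c (vscale V d x) = vscale V (c * d) x"
    and scale_one: "x \<in> carr V \<Longrightarrow> vscale V 1 x = x"
    and inner_add_left: "\<lbrakk>x \<in> carr V; y \<in> carr V; z \<in> carr V\<rbrakk>
      \<Longrightarrow> vinner V (vadd V x y) z = vinner V x z + vinner V y z"
    and inner_scale_left: "\<lbrakk>x \<in> carr V; y \<in> carr V\<rbrakk>
      \<Longrightarrow> vinner V (vscale V c x) y = c * vinner V x y"
    and inner_commute: "\<lbrakk>x \<in> carr V; y \<in> carr V\<rbrakk> \<Longrightarrow> vinner V x y = cnj (vinner V y x)"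
    and inner_nonneg: "x \<in> carr V \<Longrightarrow> 0 \<le> Re (vinner V x x)"
    and inner_definite: "\<lbrakk>x \<in> carr V; vinner V x x = 0\<rbrakk> \<Longrightarrow> x = vzero V"

definition vdiff :: "'v ipspace \<Rightarrow> 'v \<Rightarrow> 'v \<Rightarrow> 'v" where
  "vdiff V x y = vadd V x (vscale V (-1) y)"

definition vnorm :: "'v ipspace \<Rightarrow> 'v \<Rightarrow> real" where
  "vnorm V x = sqrt (Re (vinner V x x))"

text \<open>The library's metric spaces require nonnegativity and symmetry on the whole type, hence the
  value 0 outside the carrier; only the values on the carrier matter.\<close>

definition vdist :: "'v ipspace \<Rightarrow> 'v \<Rightarrow> 'v \<Rightarrow> real" where
  "vdist V x y = (if x \<in> carr V \<and> y \<in> carr V then vnorm V (vdiff V x y) else 0)"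

definition hilbert_space :: "'v ipspace \<Rightarrow> bool" where
  "hilbert_space V \<longleftrightarrow> complex_inner_space V \<and> Metric_space.mcomplete (carr V) (vdist V)"

definition separable :: "'v ipspace \<Rightarrow> bool" where
  "separable V \<longleftrightarrow> separable_space (Metric_space.mtopology (carr V) (vdist V))"

definition linear_map :: "'v ipspace \<Rightarrow> 'w ipspace \<Rightarrow> ('v \<Rightarrow> 'w) \<Rightarrow> bool" where
  "linear_map V W T \<longleftrightarrow> T \<in> carr V \<rightarrow> carr W
     \<and> (\<forall>x\<in>carr V. \<forall>y\<in>carr V. T (vadd V x y) = vadd W (T x) (T y))
     \<and> (\<forall>c. \<forall>x\<in>carr V. T (vscale V c x) = vscale W c (T x))"

definition unitary_map :: "'v ipspace \<Rightarrow> 'w ipspace \<Rightarrow> ('v \<Rightarrow> 'w) \<Rightarrow> bool" where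
  "unitary_map V W T \<longleftrightarrow> linear_map V W T \<and> T ` carr V = carr W
     \<and> (\<forall>x\<in>carr V. \<forall>y\<in>carr V. vinner W (T x) (T y) = vinner V x y)"

definition adjoint_map :: "'v ipspace \<Rightarrow> 'w ipspace \<Rightarrow> ('v \<Rightarrow> 'w) \<Rightarrow> 'w \<Rightarrow> 'v" where
  "adjoint_map V W J =
     (\<lambda>y\<in>carr W. THE x. x \<in> carr V \<and> (\<forall>z\<in>carr V. vinner V z x = vinner W (J z) y))"

section \<open>Operators\<close>

text \<open>An operator on \<^term>\<open>V\<close> is a function that is \<^term>\<open>undefined\<close> outside \<^term>\<open>carr V\<close>, so that
  equality of operators is equality of functions.\<close>

definition op_add :: "'v ipspace \<Rightarrow> ('v \<Rightarrow> 'v) \<Rightarrow> ('v \<Rightarrow> 'v) \<Rightarrow> 'v \<Rightarrow> 'v" where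
  "op_add V T S = (\<lambda>x\<in>carr V. vadd V (T x) (S x))"

definition op_scale :: "'v ipspace \<Rightarrow> complex \<Rightarrow> ('v \<Rightarrow> 'v) \<Rightarrow> 'v \<Rightarrow> 'v" where
  "op_scale V c T = (\<lambda>x\<in>carr V. vscale V c (T x))"

definition op_diff :: "'v ipspace \<Rightarrow> ('v \<Rightarrow> 'v) \<Rightarrow> ('v \<Rightarrow> 'v) \<Rightarrow> 'v \<Rightarrow> 'v" where
  "op_diff V T S = (\<lambda>x\<in>carr V. vdiff V (T x) (S x))"

definition bounded_on :: "'v ipspace \<Rightarrow> 'v set \<Rightarrow> ('v \<Rightarrow> 'v) \<Rightarrow> bool" where
  "bounded_on V S T \<longleftrightarrow> (\<exists>C. \<forall>x\<in>S. vnorm V (T x) \<le> C * vnorm V x)"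

definition op_norm_on :: "'v ipspace \<Rightarrow> 'v set \<Rightarrow> ('v \<Rightarrow> 'v) \<Rightarrow> real" where
  "op_norm_on V S T = (SUP x\<in>{x \<in> S. vnorm V x \<le> 1}. vnorm V (T x))"

definition bounded_ops :: "'v ipspace \<Rightarrow> ('v \<Rightarrow> 'v) set" where
  "bounded_ops V = {T \<in> carr V \<rightarrow>\<^sub>E carr V. linear_map V V T \<and> bounded_on V (carr V) T}"

definition norm_topology :: "'v ipspace \<Rightarrow> ('v \<Rightarrow> 'v) set \<Rightarrow> ('v \<Rightarrow> 'v) topology" where
  "norm_topology V A = Metric_space.mtopology A
     (\<lambda>T S. if T \<in> A \<and> S \<in> A then op_norm_on V (carr V) (op_diff V T S) else 0)"

section \<open>Locally Hilbert spaces\<close>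

text \<open>\<^term>\<open>V\<close> is the union of the spaces \<^term>\<open>H \<alpha>\<close>, which carry the operations and the inner
  product of \<^term>\<open>V\<close>; so the inclusions between them are isometric.\<close>

definition locally_hilbert :: "'v ipspace \<Rightarrow> ('i::order \<Rightarrow> 'v set) \<Rightarrow> bool" where
  "locally_hilbert V H \<longleftrightarrow> complex_inner_space V
     \<and> (\<forall>\<alpha>. hilbert_space (V\<lparr>carr := H \<alpha>\<rparr>))
     \<and> (\<forall>\<alpha> \<beta>. \<alpha> \<le> \<beta> \<longrightarrow> H \<alpha> \<subseteq> H \<beta>)
     \<and> carr V = (\<Union>\<alpha>. H \<alpha>)"

definition ortho :: "'v ipspace \<Rightarrow> 'v set \<Rightarrow> 'v set" where
  "ortho V S = {x \<in> carr V. \<forall>y\<in>S. vinner V x y = 0}"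

definition locally_bounded_ops :: "'v ipspace \<Rightarrow> ('i::order \<Rightarrow> 'v set) \<Rightarrow> ('v \<Rightarrow> 'v) set" where
  "locally_bounded_ops V H = {T \<in> carr V \<rightarrow>\<^sub>E carr V. linear_map V V T \<and>
     (\<forall>\<alpha>. T ` H \<alpha> \<subseteq> H \<alpha> \<and> T ` ortho V (H \<alpha>) \<subseteq> ortho V (H \<alpha>) \<and> bounded_on V (H \<alpha>) T)}"

definition locally_bounded_topology ::
    "'v ipspace \<Rightarrow> ('i::order \<Rightarrow> 'v set) \<Rightarrow> ('v \<Rightarrow> 'v) topology" where
  "locally_bounded_topology V H = topology_generated_by
     {{T \<in> locally_bounded_ops V H. op_norm_on V (H \<alpha>) (op_diff V T S) < e} | \<alpha> S e.
        S \<in> locally_bounded_ops V H \<and> e > 0}"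

definition commutant ::
    "'v ipspace \<Rightarrow> ('i::order \<Rightarrow> 'v set) \<Rightarrow> ('v \<Rightarrow> 'v) set \<Rightarrow> ('v \<Rightarrow> 'v) set" where
  "commutant V H A = {T \<in> locally_bounded_ops V H. \<forall>S\<in>A. \<forall>x\<in>carr V. T (S x) = S (T x)}"

section \<open>Locally standard measure spaces\<close>

definition standard_measure_space :: "'x measure \<Rightarrow> bool" where
  "standard_measure_space M \<longleftrightarrow> finite_measure M \<and>
     (\<exists>d. Metric_space (space M) d \<and> Metric_space.mcomplete (space M) d
        \<and> separable_space (Metric_space.mtopology (space M) d)
        \<and> sets M = sigma_sets (space M) {W. openin (Metric_space.mtopology (space M) d) W})"

text \<open>\<^term>\<open>M \<alpha>\<close> stands for the triple of the set, the sigma-algebra and the measure with index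
  \<^term>\<open>\<alpha>\<close>, and \<^term>\<open>\<mu>\<close> for the limit triple.\<close>

definition inductive_measurable_system :: "('i::order \<Rightarrow> 'x measure) \<Rightarrow> bool" where
  "inductive_measurable_system M \<longleftrightarrow> (\<forall>\<alpha> \<beta>. \<alpha> \<le> \<beta> \<longrightarrow>
     space (M \<alpha>) \<subseteq> space (M \<beta>) \<and> sets (M \<alpha>) = {E \<inter> space (M \<alpha>) | E. E \<in> sets (M \<beta>)}
     \<and> sets (M \<alpha>) \<subseteq> sets (M \<beta>))"

definition projective_measure_system :: "('i::order \<Rightarrow> 'x measure) \<Rightarrow> bool" where
  "projective_measure_system M \<longleftrightarrow>
     (\<forall>\<alpha> \<beta>. \<alpha> \<le> \<beta> \<longrightarrow> (\<forall>E\<in>sets (M \<alpha>). emeasure (M \<alpha>) E = emeasure (M \<beta>) E))"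

definition limit_measure :: "('i::order \<Rightarrow> 'x measure) \<Rightarrow> 'x measure \<Rightarrow> bool" where
  "limit_measure M \<mu> \<longleftrightarrow>
     space \<mu> = (\<Union>\<alpha>. space (M \<alpha>)) \<and>
     sets \<mu> = {E. E \<subseteq> (\<Union>\<alpha>. space (M \<alpha>)) \<and> (\<forall>\<alpha>. E \<inter> space (M \<alpha>) \<in> sets (M \<alpha>))} \<and>
     (\<forall>E\<in>sets \<mu>. let m = (\<lambda>\<alpha>. measure (M \<alpha>) (E \<inter> space (M \<alpha>))) in
        (\<forall>l. (m \<longlongrightarrow> l) at_top \<longrightarrow> emeasure \<mu> E = ennreal l) \<and>
        ((\<nexists>l. (m \<longlongrightarrow> l) at_top) \<longrightarrow> emeasure \<mu> E = \<infinity>))"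

definition locally_standard_measure_space ::
    "('i::order \<Rightarrow> 'x measure) \<Rightarrow> 'x measure \<Rightarrow> bool" where
  "locally_standard_measure_space M \<mu> \<longleftrightarrow> (\<forall>\<alpha>. standard_measure_space (M \<alpha>))
     \<and> inductive_measurable_system M \<and> projective_measure_system M \<and> limit_measure M \<mu>"

section \<open>Spaces of sections modulo almost everywhere equality\<close>

definition ae_class :: "'x measure \<Rightarrow> ('x \<Rightarrow> 'h) set \<Rightarrow> ('x \<Rightarrow> 'h) \<Rightarrow> ('x \<Rightarrow> 'h) set" where
  "ae_class N K u = {w \<in> K. AE p in N. w p = u p}"

text \<open>A set \<^term>\<open>K\<close> of sections of the field \<^term>\<open>F\<close> need only be closed under the pointwise
  operations up to null sets: a sum is the class of all members of \<^term>\<open>K\<close> that agree almost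
  everywhere with the pointwise sum. The inner product does not depend on the choice of
  representatives. Here and below, being in L1 means being integrable for the completed measure,
  which is invariant under almost everywhere equality.\<close>

definition section_space ::
    "'x measure \<Rightarrow> ('x \<Rightarrow> 'h ipspace) \<Rightarrow> ('x \<Rightarrow> 'h) set \<Rightarrow> ('x \<Rightarrow> 'h) set ipspace" where
  "section_space N F K = \<lparr>
     carr = ae_class N K ` K,
     vzero = ae_class N K (\<lambda>p. vzero (F p)),
     vadd = (\<lambda>A B. {w \<in> K. \<exists>u\<in>A. \<exists>v\<in>B. AE p in N. w p = vadd (F p) (u p) (v p)}),
     vscale = (\<lambda>c A. {w \<in> K. \<exists>u\<in>A. AE p in N. w p = vscale (F p) c (u p)}),
     vinner = (\<lambda>A B. LINT p|completion N.
       vinner (F p) ((SOME u. u \<in> A) p) ((SOME v. v \<in> B) p)) \<rparr>"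

text \<open>The classical direct integral in the sense of Kadison and Ringrose: a separable Hilbert
  space of sections that contains, up to null sets, every section with integrable inner products
  against all its members.\<close>

definition classical_direct_integral ::
    "'x measure \<Rightarrow> ('x \<Rightarrow> 'h ipspace) \<Rightarrow> ('x \<Rightarrow> 'h) set \<Rightarrow> bool" where
  "classical_direct_integral N F K \<longleftrightarrow>
     K \<subseteq> (\<Pi>\<^sub>E p\<in>space N. carr (F p)) \<and>
     (\<forall>u\<in>K. \<forall>v\<in>K. integrable (completion N) (\<lambda>p. vinner (F p) (u p) (v p))) \<and>
     (\<forall>v\<in>(\<Pi>\<^sub>E p\<in>space N. carr (F p)).
        (\<forall>u\<in>K. integrable (completion N) (\<lambda>p. vinner (F p) (u p) (v p)))
        \<longrightarrow> (\<exists>w\<in>K. AE p in N. w p = v p)) \<and>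
     hilbert_space (section_space N F K) \<and> separable (section_space N F K)"

definition acts_fibrewise ::
    "'x measure \<Rightarrow> ('x \<Rightarrow> 'h) set set \<Rightarrow> (('x \<Rightarrow> 'h) set \<Rightarrow> ('x \<Rightarrow> 'h) set)
      \<Rightarrow> ('x \<Rightarrow> 'h \<Rightarrow> 'h) \<Rightarrow> bool" where
  "acts_fibrewise N C T t \<longleftrightarrow> (\<forall>A\<in>C. \<forall>u\<in>A. \<forall>w\<in>T A. AE p in N. w p = t p (u p))"

definition decomposed_by ::
    "'x measure \<Rightarrow> ('x \<Rightarrow> 'h ipspace) \<Rightarrow> ('x \<Rightarrow> 'h) set
      \<Rightarrow> (('x \<Rightarrow> 'h) set \<Rightarrow> ('x \<Rightarrow> 'h) set) \<Rightarrow> ('x \<Rightarrow> 'h \<Rightarrow> 'h) \<Rightarrow> bool" where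
  "decomposed_by N F K S s \<longleftrightarrow> S \<in> bounded_ops (section_space N F K)
     \<and> (\<forall>p\<in>space N. s p \<in> bounded_ops (F p))
     \<and> acts_fibrewise N (carr (section_space N F K)) S s"

definition decomposable_ops ::
    "'x measure \<Rightarrow> ('x \<Rightarrow> 'h ipspace) \<Rightarrow> ('x \<Rightarrow> 'h) set
      \<Rightarrow> (('x \<Rightarrow> 'h) set \<Rightarrow> ('x \<Rightarrow> 'h) set) set" where
  "decomposable_ops N F K = {S. \<exists>s. decomposed_by N F K S s}"

section \<open>Direct integrals of locally Hilbert spaces\<close>

text \<open>Throughout, \<^term>\<open>D p\<close> is the fibre at \<^term>\<open>p\<close>, the union of its Hilbert spaces
  \<^term>\<open>H \<alpha> p\<close>; \<^term>\<open>U\<close> is the set of functions that make up the direct integral, and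
  \<^term>\<open>K \<alpha>\<close> the set of functions that make up the classical direct integral with index
  \<^term>\<open>\<alpha>\<close>.\<close>

definition fibre :: "('x \<Rightarrow> 'h ipspace) \<Rightarrow> ('i \<Rightarrow> 'x \<Rightarrow> 'h set) \<Rightarrow> 'i \<Rightarrow> 'x \<Rightarrow> 'h ipspace" where
  "fibre D H \<alpha> p = (D p)\<lparr>carr := H \<alpha> p\<rparr>"

definition supported_at ::
    "('i \<Rightarrow> 'x measure) \<Rightarrow> 'x measure \<Rightarrow> ('x \<Rightarrow> 'h ipspace) \<Rightarrow> ('i \<Rightarrow> 'x \<Rightarrow> 'h set)
      \<Rightarrow> 'i \<Rightarrow> ('x \<Rightarrow> 'h) \<Rightarrow> bool" where
  "supported_at M \<mu> D H \<alpha> u \<longleftrightarrow> {p \<in> space \<mu>. u p \<noteq> vzero (D p)} \<subseteq> space (M \<alpha>)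
     \<and> (AE p in \<mu>. p \<in> space (M \<alpha>) \<longrightarrow> u p \<in> H \<alpha> p)"

definition loc_direct_integral ::
    "('i::order \<Rightarrow> 'x measure) \<Rightarrow> 'x measure \<Rightarrow> ('x \<Rightarrow> 'h ipspace) \<Rightarrow> ('i \<Rightarrow> 'x \<Rightarrow> 'h set)
      \<Rightarrow> ('x \<Rightarrow> 'h) set \<Rightarrow> bool" where
  "loc_direct_integral M \<mu> D H U \<longleftrightarrow>
     U \<subseteq> (\<Pi>\<^sub>E p\<in>space \<mu>. carr (D p)) \<and>
     (\<forall>u\<in>U. \<exists>\<alpha>. supported_at M \<mu> D H \<alpha> u) \<and>
     (\<forall>u\<in>U. \<forall>v\<in>U. integrable (completion \<mu>) (\<lambda>p. vinner (D p) (u p) (v p))) \<and>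
     (\<forall>v\<in>(\<Pi>\<^sub>E p\<in>space \<mu>. carr (D p)).
        (\<exists>\<alpha>. \<forall>q\<in>space \<mu> - space (M \<alpha>). v q = vzero (D q)) \<longrightarrow>
        (\<forall>u\<in>U. integrable (completion \<mu>) (\<lambda>p. vinner (D p) (u p) (v p))) \<longrightarrow>
        (\<exists>w\<in>U. AE p in \<mu>. w p = v p))"

definition integral_level ::
    "('i::order \<Rightarrow> 'x measure) \<Rightarrow> 'x measure \<Rightarrow> ('x \<Rightarrow> 'h ipspace) \<Rightarrow> ('i \<Rightarrow> 'x \<Rightarrow> 'h set)
      \<Rightarrow> ('x \<Rightarrow> 'h) set \<Rightarrow> 'i \<Rightarrow> ('x \<Rightarrow> 'h) set set" where
  "integral_level M \<mu> D H U \<alpha> = ae_class \<mu> U ` {u \<in> U. supported_at M \<mu> D H \<alpha> u}"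

definition level_space ::
    "('i::order \<Rightarrow> 'x measure) \<Rightarrow> 'x measure \<Rightarrow> ('x \<Rightarrow> 'h ipspace) \<Rightarrow> ('i \<Rightarrow> 'x \<Rightarrow> 'h set)
      \<Rightarrow> ('x \<Rightarrow> 'h) set \<Rightarrow> 'i \<Rightarrow> ('x \<Rightarrow> 'h) set ipspace" where
  "level_space M \<mu> D H U \<alpha> = (section_space \<mu> D U)\<lparr>carr := integral_level M \<mu> D H U \<alpha>\<rparr>"

definition level_classical ::
    "('i::order \<Rightarrow> 'x measure) \<Rightarrow> ('x \<Rightarrow> 'h ipspace) \<Rightarrow> ('i \<Rightarrow> 'x \<Rightarrow> 'h set)
      \<Rightarrow> ('i \<Rightarrow> ('x \<Rightarrow> 'h) set) \<Rightarrow> 'i \<Rightarrow> ('x \<Rightarrow> 'h) set ipspace" where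
  "level_classical M D H K \<alpha> = section_space (M \<alpha>) (fibre D H \<alpha>) (K \<alpha>)"

text \<open>Restriction of functions to the space with index \<^term>\<open>\<alpha>\<close>, on classes.\<close>

definition V_map ::
    "('i \<Rightarrow> 'x measure) \<Rightarrow> ('i \<Rightarrow> ('x \<Rightarrow> 'h) set) \<Rightarrow> 'i \<Rightarrow> ('x \<Rightarrow> 'h) set \<Rightarrow> ('x \<Rightarrow> 'h) set" where
  "V_map M K \<alpha> A = {w \<in> K \<alpha>. \<exists>u\<in>A. AE p in M \<alpha>. w p = u p}"

definition loc_decomposable ::
    "('i::order \<Rightarrow> 'x measure) \<Rightarrow> 'x measure \<Rightarrow> ('x \<Rightarrow> 'h ipspace) \<Rightarrow> ('i \<Rightarrow> 'x \<Rightarrow> 'h set)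
      \<Rightarrow> ('x \<Rightarrow> 'h) set \<Rightarrow> (('x \<Rightarrow> 'h) set \<Rightarrow> ('x \<Rightarrow> 'h) set) \<Rightarrow> bool" where
  "loc_decomposable M \<mu> D H U T \<longleftrightarrow>
     T \<in> locally_bounded_ops (section_space \<mu> D U) (integral_level M \<mu> D H U) \<and>
     (\<exists>t. (\<forall>p\<in>space \<mu>. t p \<in> locally_bounded_ops (D p) (\<lambda>\<alpha>. H \<alpha> p))
        \<and> acts_fibrewise \<mu> (carr (section_space \<mu> D U)) T t)"

definition diagonalizable_ops ::
    "('i::order \<Rightarrow> 'x measure) \<Rightarrow> 'x measure \<Rightarrow> ('x \<Rightarrow> 'h ipspace) \<Rightarrow> ('i \<Rightarrow> 'x \<Rightarrow> 'h set)
      \<Rightarrow> ('x \<Rightarrow> 'h) set \<Rightarrow> (('x \<Rightarrow> 'h) set \<Rightarrow> ('x \<Rightarrow> 'h) set) set" where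
  "diagonalizable_ops M \<mu> D H U = {T. loc_decomposable M \<mu> D H U T \<and>
     (\<exists>f \<in> borel_measurable \<mu>.
        acts_fibrewise \<mu> (carr (section_space \<mu> D U)) T (\<lambda>p. vscale (D p) (f p)))}"

definition diag_commutant ::
    "('i::order \<Rightarrow> 'x measure) \<Rightarrow> 'x measure \<Rightarrow> ('x \<Rightarrow> 'h ipspace) \<Rightarrow> ('i \<Rightarrow> 'x \<Rightarrow> 'h set)
      \<Rightarrow> ('x \<Rightarrow> 'h) set \<Rightarrow> (('x \<Rightarrow> 'h) set \<Rightarrow> ('x \<Rightarrow> 'h) set) set" where
  "diag_commutant M \<mu> D H U =
     commutant (section_space \<mu> D U) (integral_level M \<mu> D H U) (diagonalizable_ops M \<mu> D H U)"

definition diag_commutant_topology ::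
    "('i::order \<Rightarrow> 'x measure) \<Rightarrow> 'x measure \<Rightarrow> ('x \<Rightarrow> 'h ipspace) \<Rightarrow> ('i \<Rightarrow> 'x \<Rightarrow> 'h set)
      \<Rightarrow> ('x \<Rightarrow> 'h) set \<Rightarrow> (('x \<Rightarrow> 'h) set \<Rightarrow> ('x \<Rightarrow> 'h) set) topology" where
  "diag_commutant_topology M \<mu> D H U =
     subtopology (locally_bounded_topology (section_space \<mu> D U) (integral_level M \<mu> D H U))
       (diag_commutant M \<mu> D H U)"

definition gamma_map ::
    "('i::order \<Rightarrow> 'x measure) \<Rightarrow> 'x measure \<Rightarrow> ('x \<Rightarrow> 'h ipspace) \<Rightarrow> ('i \<Rightarrow> 'x \<Rightarrow> 'h set)
      \<Rightarrow> ('x \<Rightarrow> 'h) set \<Rightarrow> ('i \<Rightarrow> ('x \<Rightarrow> 'h) set) \<Rightarrow> 'i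
      \<Rightarrow> (('x \<Rightarrow> 'h) set \<Rightarrow> ('x \<Rightarrow> 'h) set) \<Rightarrow> ('x \<Rightarrow> 'h) set \<Rightarrow> ('x \<Rightarrow> 'h) set" where
  "gamma_map M \<mu> D H U K \<alpha> T = (\<lambda>B\<in>carr (level_classical M D H K \<alpha>).
     V_map M K \<alpha>
       (T (adjoint_map (level_space M \<mu> D H U \<alpha>) (level_classical M D H K \<alpha>) (V_map M K \<alpha>) B)))"

section \<open>The projective system of decomposable operators\<close>

definition level_decomposable ::
    "('i::order \<Rightarrow> 'x measure) \<Rightarrow> ('x \<Rightarrow> 'h ipspace) \<Rightarrow> ('i \<Rightarrow> 'x \<Rightarrow> 'h set)
      \<Rightarrow> ('i \<Rightarrow> ('x \<Rightarrow> 'h) set) \<Rightarrow> 'i \<Rightarrow> (('x \<Rightarrow> 'h) set \<Rightarrow> ('x \<Rightarrow> 'h) set) set" where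
  "level_decomposable M D H K \<alpha> = decomposable_ops (M \<alpha>) (fibre D H \<alpha>) (K \<alpha>)"

definition level_topology ::
    "('i::order \<Rightarrow> 'x measure) \<Rightarrow> ('x \<Rightarrow> 'h ipspace) \<Rightarrow> ('i \<Rightarrow> 'x \<Rightarrow> 'h set)
      \<Rightarrow> ('i \<Rightarrow> ('x \<Rightarrow> 'h) set) \<Rightarrow> 'i \<Rightarrow> (('x \<Rightarrow> 'h) set \<Rightarrow> ('x \<Rightarrow> 'h) set) topology" where
  "level_topology M D H K \<alpha> =
     norm_topology (level_classical M D H K \<alpha>) (level_decomposable M D H K \<alpha>)"

definition fibre_compression ::
    "('x \<Rightarrow> 'h ipspace) \<Rightarrow> ('i \<Rightarrow> 'x \<Rightarrow> 'h set) \<Rightarrow> 'i \<Rightarrow> 'i \<Rightarrow> 'x \<Rightarrow> ('h \<Rightarrow> 'h) \<Rightarrow> 'h \<Rightarrow> 'h" where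
  "fibre_compression D H \<alpha> \<beta> p t = (let J = (\<lambda>x\<in>H \<alpha> p. x) in
     (\<lambda>x\<in>H \<alpha> p. adjoint_map (fibre D H \<alpha> p) (fibre D H \<beta> p) J (t (J x))))"

text \<open>The operator does not depend on the decomposition \<^term>\<open>t\<close> of \<^term>\<open>S\<close>.\<close>

definition phi_map ::
    "('i::order \<Rightarrow> 'x measure) \<Rightarrow> ('x \<Rightarrow> 'h ipspace) \<Rightarrow> ('i \<Rightarrow> 'x \<Rightarrow> 'h set)
      \<Rightarrow> ('i \<Rightarrow> ('x \<Rightarrow> 'h) set) \<Rightarrow> 'i \<Rightarrow> 'i
      \<Rightarrow> (('x \<Rightarrow> 'h) set \<Rightarrow> ('x \<Rightarrow> 'h) set) \<Rightarrow> ('x \<Rightarrow> 'h) set \<Rightarrow> ('x \<Rightarrow> 'h) set" where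
  "phi_map M D H K \<alpha> \<beta> S = (THE R. \<exists>t. decomposed_by (M \<beta>) (fibre D H \<beta>) (K \<beta>) S t
     \<and> decomposed_by (M \<alpha>) (fibre D H \<alpha>) (K \<alpha>) R (\<lambda>p. fibre_compression D H \<alpha> \<beta> p (t p)))"

definition proj_limit ::
    "('i::order \<Rightarrow> 'x measure) \<Rightarrow> ('x \<Rightarrow> 'h ipspace) \<Rightarrow> ('i \<Rightarrow> 'x \<Rightarrow> 'h set)
      \<Rightarrow> ('i \<Rightarrow> ('x \<Rightarrow> 'h) set) \<Rightarrow> ('i \<Rightarrow> ('x \<Rightarrow> 'h) set \<Rightarrow> ('x \<Rightarrow> 'h) set) set" where
  "proj_limit M D H K = {S \<in> (\<Pi>\<^sub>E \<alpha>\<in>UNIV. level_decomposable M D H K \<alpha>).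
     \<forall>\<alpha> \<beta>. \<alpha> \<le> \<beta> \<longrightarrow> phi_map M D H K \<alpha> \<beta> (S \<beta>) = S \<alpha>}"

definition proj_limit_topology ::
    "('i::order \<Rightarrow> 'x measure) \<Rightarrow> ('x \<Rightarrow> 'h ipspace) \<Rightarrow> ('i \<Rightarrow> 'x \<Rightarrow> 'h set)
      \<Rightarrow> ('i \<Rightarrow> ('x \<Rightarrow> 'h) set) \<Rightarrow> ('i \<Rightarrow> ('x \<Rightarrow> 'h) set \<Rightarrow> ('x \<Rightarrow> 'h) set) topology" where
  "proj_limit_topology M D H K =
     subtopology (product_topology (level_topology M D H K) UNIV) (proj_limit M D H K)"

definition linear_into_limit ::
    "('i::order \<Rightarrow> 'x measure) \<Rightarrow> 'x measure \<Rightarrow> ('x \<Rightarrow> 'h ipspace) \<Rightarrow> ('i \<Rightarrow> 'x \<Rightarrow> 'h set)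
      \<Rightarrow> ('x \<Rightarrow> 'h) set \<Rightarrow> ('i \<Rightarrow> ('x \<Rightarrow> 'h) set)
      \<Rightarrow> ((('x \<Rightarrow> 'h) set \<Rightarrow> ('x \<Rightarrow> 'h) set) \<Rightarrow> 'i \<Rightarrow> ('x \<Rightarrow> 'h) set \<Rightarrow> ('x \<Rightarrow> 'h) set) \<Rightarrow> bool" where
  "linear_into_limit M \<mu> D H U K \<phi> \<longleftrightarrow>
     (\<forall>T\<in>diag_commutant M \<mu> D H U. \<forall>S\<in>diag_commutant M \<mu> D H U. \<forall>\<alpha>.
        \<phi> (op_add (section_space \<mu> D U) T S) \<alpha>
          = op_add (level_classical M D H K \<alpha>) (\<phi> T \<alpha>) (\<phi> S \<alpha>)) \<and>
     (\<forall>c. \<forall>T\<in>diag_commutant M \<mu> D H U. \<forall>\<alpha>.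
        \<phi> (op_scale (section_space \<mu> D U) c T) \<alpha>
          = op_scale (level_classical M D H K \<alpha>) c (\<phi> T \<alpha>))"

end

(* An operator T commuting with the diagonalizable operators commutes in particular with
   multiplication by indicator functions, hence so does its compression S to each level. Cutting down
   to the set where the inequality fails shows |(S u)(p)| <= |S| |u(p)| for almost every p. Let (c_k) be
   dense in the separable classical direct integral. Almost everywhere the vectors c_k(p) are dense in
   the fibre: otherwise choose, without any measurability, nonzero vectors orthogonal to all c_k(p);
   the maximality of the direct integral makes this choice a section, and it is orthogonal to itself.
   The pointwise bound, applied to the countably many combinations of the c_k with coefficients in a
   countable dense set, then extends c_k(p) |-> (S c_k)(p) to a bounded operator on the fibre at almost
   every p, and these operators decompose S.

   Elements of the local direct integral are transported to and from the classical ones through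
   surjectivity of the restriction maps; a set is null for the limit measure iff its traces are null.
   T leaves the levels invariant, so the compressions to the fibres act as restrictions. *)

theory Submission
  imports Defs
begin

section \<open>Inner product spaces\<close>

text \<open>Equality almost everywhere is the main obstacle. Sections matter, and \<open>K\<close>
  and \<open>U\<close> are closed under the operations, only up to null sets, so a pointwise
  statement about fibres has to be reduced to countably many sections. In particular the values
  c_k(p) need not be closed under combinations with coefficients from a countable dense set. The
  fibre operator t is therefore not described by t c_k = s_k and linearity, but by the inequalities
  |t x - s_k| <= C |x - c_k| for all k. Where the c_k are dense these determine t x, and the
  analogous inequalities for combinations q_n c_j + c_k make t linear. The second obstacle is that
  the limit space is only a quotient: neither its inner product space laws nor the closure of
  \<open>U\<close> under sums is assumed. Both are pulled back through the unitaries
  \<open>V\<close>, one level at a time. Directedness makes this possible, since each law involves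
  finitely many elements, which lie in a common level. Working with the completed measure lets a
  choice made without any measurability enter an integral, as soon as the integrand is zero almost
  everywhere.\<close>

definition vlim :: "'v ipspace \<Rightarrow> (nat \<Rightarrow> 'v) \<Rightarrow> 'v \<Rightarrow> bool" where
  "vlim V f x \<longleftrightarrow> (\<lambda>n. vnorm V (vdiff V (f n) x)) \<longlonglongrightarrow> 0"

definition vCauchy :: "'v ipspace \<Rightarrow> (nat \<Rightarrow> 'v) \<Rightarrow> bool" where
  "vCauchy V f \<longleftrightarrow> (\<forall>e>0. \<exists>N. \<forall>m\<ge>N. \<forall>n\<ge>N. vnorm V (vdiff V (f m) (f n)) < e)"

text \<open>These notions use the operations but never the carrier, so limits in a subspace and in
  the ambient space coincide by rewriting. This is how completeness of a Hilbert subspace is used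
  inside a larger space.\<close>

lemma vnorm_carr_update [simp]: "vnorm (V\<lparr>carr := Y\<rparr>) = vnorm V"
  by (simp add: vnorm_def fun_eq_iff)

lemma vdiff_carr_update [simp]: "vdiff (V\<lparr>carr := Y\<rparr>) = vdiff V"
  by (simp add: vdiff_def fun_eq_iff)

lemma vlim_carr_update [simp]: "vlim (V\<lparr>carr := Y\<rparr>) = vlim V"
  by (simp add: vlim_def fun_eq_iff)

lemma vCauchy_carr_update [simp]: "vCauchy (V\<lparr>carr := Y\<rparr>) = vCauchy V"
  by (simp add: vCauchy_def fun_eq_iff)

context complex_inner_space
begin

lemma diff_closed: "\<lbrakk>x \<in> carr V; y \<in> carr V\<rbrakk> \<Longrightarrow> vdiff V x y \<in> carr V"
  by (simp add: vdiff_def add_closed scale_closed)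

lemmas closed [simp] = zero_closed add_closed scale_closed diff_closed

lemma inner_add_right:
  "\<lbrakk>x \<in> carr V; y \<in> carr V; z \<in> carr V\<rbrakk> \<Longrightarrow> vinner V x (vadd V y z) = vinner V x y + vinner V x z"
  by (metis add_closed complex_cnj_add inner_add_left inner_commute)

lemma inner_scale_right:
  "\<lbrakk>x \<in> carr V; y \<in> carr V\<rbrakk> \<Longrightarrow> vinner V x (vscale V c y) = cnj c * vinner V x y"
  by (metis complex_cnj_mult inner_commute inner_scale_left scale_closed)

lemma inner_diff_left:
  "\<lbrakk>x \<in> carr V; y \<in> carr V; z \<in> carr V\<rbrakk> \<Longrightarrow> vinner V (vdiff V x y) z = vinner V x z - vinner V y z"
  by (simp add: vdiff_def inner_add_left inner_scale_left)

lemma inner_diff_right: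
  "\<lbrakk>x \<in> carr V; y \<in> carr V; z \<in> carr V\<rbrakk> \<Longrightarrow> vinner V x (vdiff V y z) = vinner V x y - vinner V x z"
  by (simp add: vdiff_def inner_add_right inner_scale_right)

lemma scale_zero: "x \<in> carr V \<Longrightarrow> vscale V 0 x = vzero V"
  using scale_add_left[of x 1 "-1"] by (simp add: add_neg scale_one)

lemma inner_zero_left: "x \<in> carr V \<Longrightarrow> vinner V (vzero V) x = 0"
  using inner_scale_left[of x x 0] by (simp add: scale_zero)

lemma inner_zero_right: "x \<in> carr V \<Longrightarrow> vinner V x (vzero V) = 0"
  using inner_scale_right[of x x 0] by (simp add: scale_zero)

lemmas inner_simps [simp] = inner_add_left inner_add_right inner_scale_left inner_scale_right
  inner_diff_left inner_diff_right inner_zero_left inner_zero_right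

lemma diff_eq_zero_iff:
  assumes "x \<in> carr V" "y \<in> carr V"
  shows "vdiff V x y = vzero V \<longleftrightarrow> x = y"
proof
  assume *: "vdiff V x y = vzero V"
  have "vadd V (vdiff V x y) y = vadd V x (vadd V (vscale V (-1) y) y)"
    using assms by (simp add: vdiff_def add_assoc)
  also have "vadd V (vscale V (-1) y) y = vzero V"
    using assms add_commute add_neg by simp
  finally show "x = y"
    using assms * by (metis add_commute add_zero zero_closed)
qed (use assms add_neg vdiff_def in metis)

text \<open>By definiteness, vectors can be compared through their inner products with test vectors.
  Vector identities below are proved this way: \<open>inner_simps\<close> reduces them to identities
  of complex numbers, without any rewriting by the vector space laws.\<close>

lemma vec_eqI:
  assumes "x \<in> carr V" "y \<in> carr V" "\<And>z. z \<in> carr V \<Longrightarrow> vinner V x z = vinner V y z"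
  shows "x = y"
proof -
  have "vinner V (vdiff V x y) (vdiff V x y) = 0"
    using assms by simp
  then show ?thesis
    using assms diff_eq_zero_iff inner_definite diff_closed by blast
qed

lemma vec_eqI_right:
  assumes "x \<in> carr V" "y \<in> carr V" "\<And>z. z \<in> carr V \<Longrightarrow> vinner V z x = vinner V z y"
  shows "x = y"
  using assms by (metis inner_commute vec_eqI)

lemma scale_vzero: "vscale V c (vzero V) = vzero V"
  by (rule vec_eqI) auto

lemma inner_self_Im: "x \<in> carr V \<Longrightarrow> Im (vinner V x x) = 0"
  using inner_commute[of x x] by (metis cnj.simps(2) equal_neg_zero)

lemma vnorm_nonneg [simp]: "x \<in> carr V \<Longrightarrow> 0 \<le> vnorm V x"
  by (simp add: vnorm_def inner_nonneg)

lemma vnorm_power2: "x \<in> carr V \<Longrightarrow> (vnorm V x)\<^sup>2 = Re (vinner V x x)"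
  by (simp add: vnorm_def inner_nonneg)

lemma inner_self: "x \<in> carr V \<Longrightarrow> vinner V x x = complex_of_real ((vnorm V x)\<^sup>2)"
  by (simp add: complex_eq_iff vnorm_power2 inner_self_Im)

lemma vnorm_eq_0_iff: "x \<in> carr V \<Longrightarrow> vnorm V x = 0 \<longleftrightarrow> x = vzero V"
  using inner_self[of x] inner_definite[of x] inner_self[of "vzero V"] by auto

lemma vnorm_zero [simp]: "vnorm V (vzero V) = 0"
  by (simp add: vnorm_eq_0_iff)

lemma vnorm_diff_eq_0_iff: "\<lbrakk>x \<in> carr V; y \<in> carr V\<rbrakk> \<Longrightarrow> vnorm V (vdiff V x y) = 0 \<longleftrightarrow> x = y"
  by (simp add: vnorm_eq_0_iff diff_eq_zero_iff)

lemma vnorm_scale: "x \<in> carr V \<Longrightarrow> vnorm V (vscale V c x) = cmod c * vnorm V x"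
proof -
  assume x: "x \<in> carr V"
  have "(vnorm V (vscale V c x))\<^sup>2 = Re (c * cnj c * vinner V x x)"
    using x by (simp add: vnorm_power2 inner_self_Im algebra_simps)
  also have "\<dots> = (cmod c * vnorm V x)\<^sup>2"
    using x by (simp add: vnorm_power2 power_mult_distrib flip: complex_norm_square)
  finally show ?thesis
    using x by (simp add: power2_eq_iff_nonneg)
qed

text \<open>Pythagoras for the removal from x of its component along y. Nonnegativity of the left
  side is the Cauchy-Schwarz inequality; the same identity supplies the variational step for nearest
  points.\<close>

lemma vnorm_diff_projection:
  assumes x: "x \<in> carr V" and y: "y \<in> carr V" "y \<noteq> vzero V"
  shows "(vnorm V (vdiff V x (vscale V (vinner V x y / (vnorm V y)\<^sup>2) y)))\<^sup>2
    = (vnorm V x)\<^sup>2 - (cmod (vinner V x y))\<^sup>2 / (vnorm V y)\<^sup>2"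
proof -
  define n where "n = (vnorm V y)\<^sup>2"
  have n: "n > 0"
    using y vnorm_eq_0_iff n_def by simp
  define c where "c = vinner V x y"
  have yx: "vinner V y x = cnj c"
    unfolding c_def using x y by (intro inner_commute)
  have yy: "vinner V y y = complex_of_real n"
    using y inner_self n_def by blast
  have "(vnorm V (vdiff V x (vscale V (c / n) y)))\<^sup>2
      = Re (vinner V (vdiff V x (vscale V (c / n) y)) (vdiff V x (vscale V (c / n) y)))"
    using x y by (intro vnorm_power2) simp
  also have "vinner V (vdiff V x (vscale V (c / n) y)) (vdiff V x (vscale V (c / n) y))
      = vinner V x x - c * cnj c / n"
    using x y n yx yy by (simp add: c_def[symmetric] field_simps)
  also have "Re \<dots> = (vnorm V x)\<^sup>2 - (cmod c)\<^sup>2 / n"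
    using x by (simp add: vnorm_power2 flip: complex_norm_square)
  finally show ?thesis
    by (simp add: c_def n_def)
qed

lemma Cauchy_Schwarz:
  assumes x: "x \<in> carr V" and y: "y \<in> carr V"
  shows "cmod (vinner V x y) \<le> vnorm V x * vnorm V y"
proof (cases "y = vzero V")
  case False
  then have n: "(vnorm V y)\<^sup>2 > 0"
    using y vnorm_eq_0_iff by simp
  have "(cmod (vinner V x y))\<^sup>2 / (vnorm V y)\<^sup>2 \<le> (vnorm V x)\<^sup>2"
    using vnorm_diff_projection[OF x y False]
      zero_le_power2[of "vnorm V (vdiff V x (vscale V (vinner V x y / (vnorm V y)\<^sup>2) y))"]
    by linarith
  then have "(cmod (vinner V x y))\<^sup>2 \<le> (vnorm V x * vnorm V y)\<^sup>2"
    using n by (simp add: pos_divide_le_eq power_mult_distrib)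
  then show ?thesis
    using x y by (simp add: power2_le_iff_abs_le)
qed (use x in simp)

lemma vnorm_triangle:
  assumes x: "x \<in> carr V" and y: "y \<in> carr V"
  shows "vnorm V (vadd V x y) \<le> vnorm V x + vnorm V y"
proof -
  have "vinner V y x = cnj (vinner V x y)"
    using x y by (intro inner_commute)
  then have "(vnorm V (vadd V x y))\<^sup>2 = (vnorm V x)\<^sup>2 + 2 * Re (vinner V x y) + (vnorm V y)\<^sup>2"
    using x y by (simp add: vnorm_power2)
  also have "Re (vinner V x y) \<le> vnorm V x * vnorm V y"
    using Cauchy_Schwarz[OF x y] complex_Re_le_cmod order_trans by blast
  finally have "(vnorm V (vadd V x y))\<^sup>2 \<le> (vnorm V x + vnorm V y)\<^sup>2"
    by (simp add: power2_sum)
  then show ?thesis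
    using x y by (simp add: power2_le_iff_abs_le)
qed

lemma diff_commute_scale: "\<lbrakk>x \<in> carr V; y \<in> carr V\<rbrakk> \<Longrightarrow> vdiff V x y = vscale V (-1) (vdiff V y x)"
  by (rule vec_eqI) auto

lemma vnorm_diff_commute: "\<lbrakk>x \<in> carr V; y \<in> carr V\<rbrakk> \<Longrightarrow> vnorm V (vdiff V x y) = vnorm V (vdiff V y x)"
  by (subst diff_commute_scale) (auto simp: vnorm_scale)

lemma vnorm_diff_triangle:
  assumes "x \<in> carr V" "y \<in> carr V" "z \<in> carr V"
  shows "vnorm V (vdiff V x z) \<le> vnorm V (vdiff V x y) + vnorm V (vdiff V y z)"
proof -
  have "vdiff V x z = vadd V (vdiff V x y) (vdiff V y z)"
    by (rule vec_eqI) (use assms in auto)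
  then show ?thesis
    using assms by (simp add: vnorm_triangle)
qed

lemma vnorm_le_diff: "\<lbrakk>x \<in> carr V; y \<in> carr V\<rbrakk> \<Longrightarrow> vnorm V x \<le> vnorm V (vdiff V x y) + vnorm V y"
proof -
  assume *: "x \<in> carr V" "y \<in> carr V"
  have "x = vadd V (vdiff V x y) y"
    by (rule vec_eqI) (use * in auto)
  then show ?thesis
    using * vnorm_triangle[of "vdiff V x y" y] by simp
qed

lemma Metric_space_vdist: "Metric_space (carr V) (vdist V)"
proof
  show "0 \<le> vdist V x y" for x y
    by (simp add: vdist_def)
  show "vdist V x y = vdist V y x" for x y
    using vnorm_diff_commute[of x y] by (simp add: vdist_def)
  show "vdist V x y = 0 \<longleftrightarrow> x = y" if "x \<in> carr V" "y \<in> carr V" for x y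
    using that by (simp add: vdist_def vnorm_diff_eq_0_iff)
  show "vdist V x z \<le> vdist V x y + vdist V y z"
    if "x \<in> carr V" "y \<in> carr V" "z \<in> carr V" for x y z
    using vnorm_diff_triangle[OF that] that by (simp add: vdist_def)
qed

section \<open>Convergence of sequences in norm\<close>

lemma vlim_norm:
  assumes "\<And>n. f n \<in> carr V" "x \<in> carr V" "vlim V f x"
  shows "(\<lambda>n. vnorm V (f n)) \<longlonglongrightarrow> vnorm V x"
proof -
  have "\<bar>vnorm V (f n) - vnorm V x\<bar> \<le> vnorm V (vdiff V (f n) x)" for n
    using assms(1,2) vnorm_le_diff[of "f n" x] vnorm_le_diff[of x "f n"] vnorm_diff_commute[of x "f n"]
    by simp
  then have "(\<lambda>n. vnorm V (f n) - vnorm V x) \<longlonglongrightarrow> 0"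
    by (intro Lim_null_comparison[OF _ assms(3)[unfolded vlim_def]]) simp
  then show ?thesis
    by (rule LIM_zero_cancel)
qed

lemma vlim_const: "x \<in> carr V \<Longrightarrow> vlim V (\<lambda>n. x) x"
  by (simp add: vlim_def vnorm_diff_eq_0_iff[THEN iffD2])

lemma vlim_add:
  assumes "\<And>n. f n \<in> carr V" "x \<in> carr V" "vlim V f x" "\<And>n. g n \<in> carr V" "y \<in> carr V" "vlim V g y"
  shows "vlim V (\<lambda>n. vadd V (f n) (g n)) (vadd V x y)"
proof -
  have eq: "vdiff V (vadd V (f n) (g n)) (vadd V x y) = vadd V (vdiff V (f n) x) (vdiff V (g n) y)" for n
    by (rule vec_eqI) (use assms in auto)
  have "(\<lambda>n. vnorm V (vdiff V (f n) x) + vnorm V (vdiff V (g n) y)) \<longlonglongrightarrow> 0 + 0"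
    using assms(3,6) unfolding vlim_def by (rule tendsto_add)
  then have *: "(\<lambda>n. vnorm V (vdiff V (f n) x) + vnorm V (vdiff V (g n) y)) \<longlonglongrightarrow> 0"
    by simp
  show ?thesis
    unfolding vlim_def eq
    by (rule Lim_null_comparison[OF always_eventually *]) (use assms in \<open>simp add: vnorm_triangle\<close>)
qed

lemma vlim_scale:
  assumes "\<And>n. f n \<in> carr V" "x \<in> carr V" "vlim V f x" "a \<longlonglongrightarrow> b"
  shows "vlim V (\<lambda>n. vscale V (a n) (f n)) (vscale V b x)"
proof -
  have eq: "vdiff V (vscale V (a n) (f n)) (vscale V b x)
      = vadd V (vscale V (a n) (vdiff V (f n) x)) (vscale V (a n - b) x)" for n
    by (rule vec_eqI) (use assms in \<open>auto simp: algebra_simps\<close>)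
  have "(\<lambda>n. cmod (a n) * vnorm V (vdiff V (f n) x) + cmod (a n - b) * vnorm V x)
      \<longlonglongrightarrow> cmod b * 0 + 0 * vnorm V x"
    using assms(3,4) unfolding vlim_def
    by (intro tendsto_intros) (auto simp: LIM_zero tendsto_norm_zero)
  then have *: "(\<lambda>n. cmod (a n) * vnorm V (vdiff V (f n) x) + cmod (a n - b) * vnorm V x) \<longlonglongrightarrow> 0"
    by simp
  have "vnorm V (vdiff V (vscale V (a n) (f n)) (vscale V b x))
      \<le> cmod (a n) * vnorm V (vdiff V (f n) x) + cmod (a n - b) * vnorm V x" for n
    unfolding eq
    using vnorm_triangle[of "vscale V (a n) (vdiff V (f n) x)" "vscale V (a n - b) x"] assms(1,2)
    by (simp add: vnorm_scale)
  then show ?thesis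
    unfolding vlim_def using assms(1,2)
    by (intro Lim_null_comparison[OF always_eventually *]) simp
qed

lemma vlim_diff:
  assumes "\<And>n. f n \<in> carr V" "x \<in> carr V" "vlim V f x" "\<And>n. g n \<in> carr V" "y \<in> carr V" "vlim V g y"
  shows "vlim V (\<lambda>n. vdiff V (f n) (g n)) (vdiff V x y)"
  unfolding vdiff_def using assms by (intro vlim_add vlim_scale) auto

lemma vlim_unique:
  assumes "\<And>n. f n \<in> carr V" "x \<in> carr V" "vlim V f x" "y \<in> carr V" "vlim V f y"
  shows "x = y"
proof -
  have "vlim V (\<lambda>n. vdiff V (f n) (f n)) (vdiff V x y)"
    using assms by (intro vlim_diff) auto
  then have "(\<lambda>n. vnorm V (vdiff V (f n) (f n))) \<longlonglongrightarrow> vnorm V (vdiff V x y)"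
    using assms by (intro vlim_norm) auto
  then have "vnorm V (vdiff V x y) = 0"
    using assms(1) by (simp add: vnorm_diff_eq_0_iff[THEN iffD2] LIMSEQ_const_iff)
  then show ?thesis
    using assms vnorm_diff_eq_0_iff by blast
qed

lemma hilbert_vCauchy:
  assumes "hilbert_space V" "\<And>n. f n \<in> carr V" "vCauchy V f"
  shows "\<exists>x\<in>carr V. vlim V f x"
proof -
  interpret Metric_space "carr V" "vdist V"
    by (rule Metric_space_vdist)
  have "MCauchy f"
    using assms(2,3) by (auto simp: MCauchy_def vCauchy_def vdist_def)
  then obtain x where "limitin mtopology f x sequentially"
    using assms(1) unfolding hilbert_space_def mcomplete_def by blast
  then have "x \<in> carr V" "(\<lambda>n. vdist V (f n) x) \<longlonglongrightarrow> 0"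
    by (auto simp: limitin_metric_dist_null)
  then show ?thesis
    using assms(2) by (auto simp: vlim_def vdist_def)
qed

section \<open>Nearest points and orthogonal projection\<close>

lemma parallelogram:
  assumes "x \<in> carr V" "y \<in> carr V"
  shows "(vnorm V (vadd V x y))\<^sup>2 + (vnorm V (vdiff V x y))\<^sup>2 = 2 * (vnorm V x)\<^sup>2 + 2 * (vnorm V y)\<^sup>2"
  using assms by (simp add: vnorm_power2)

text \<open>Completeness is required of \<^term>\<open>Y\<close> only, and only sequentially, so that this covers both a
  Hilbert space inside an incomplete space and a closed subspace of a Hilbert space.\<close>

lemma projection_exists:
  assumes Y: "Y \<subseteq> carr V" "Y \<noteq> {}"
    and Yadd: "\<And>x y. \<lbrakk>x \<in> Y; y \<in> Y\<rbrakk> \<Longrightarrow> vadd V x y \<in> Y"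
    and Yscale: "\<And>c x. x \<in> Y \<Longrightarrow> vscale V c x \<in> Y"
    and Ycomplete: "\<And>f. \<lbrakk>\<And>n. f n \<in> Y; vCauchy V f\<rbrakk> \<Longrightarrow> \<exists>y\<in>Y. vlim V f y"
    and x: "x \<in> carr V"
  shows "\<exists>y\<in>Y. \<forall>z\<in>Y. vinner V z y = vinner V z x"
proof -
  define d where "d = (INF y\<in>Y. (vnorm V (vdiff V x y))\<^sup>2)"
  have Yc [simp]: "y \<in> carr V" if "y \<in> Y" for y
    using that Y by auto
  have d_le: "d \<le> (vnorm V (vdiff V x y))\<^sup>2" if "y \<in> Y" for y
    unfolding d_def using that by (intro cINF_lower bdd_belowI[where m=0]) auto
  have "\<exists>y\<in>Y. (vnorm V (vdiff V x y))\<^sup>2 < d + 1 / Suc n" for n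
    using cInf_lessD[of "(\<lambda>y. (vnorm V (vdiff V x y))\<^sup>2) ` Y" "d + 1 / Suc n"] Y
    by (auto simp: d_def)
  then obtain f where f: "\<And>n. f n \<in> Y" "\<And>n. (vnorm V (vdiff V x (f n)))\<^sup>2 < d + 1 / Suc n"
    by metis
  have Cauchy_bound: "(vnorm V (vdiff V (f m) (f n)))\<^sup>2 \<le> 2 / Suc m + 2 / Suc n" for m n
  proof -
    \<comment> \<open>The midpoint of \<open>f m\<close> and \<open>f n\<close> lies in Y, so its
      squared distance from x is at least d. The parallelogram law for x - f m and x - f n then
      bounds the distance between \<open>f m\<close> and \<open>f n\<close>.\<close>
    have "vscale V (1/2) (vadd V (f m) (f n)) \<in> Y"
      using f by (intro Yadd Yscale)
    then have "4 * d \<le> (2 * vnorm V (vdiff V x (vscale V (1/2) (vadd V (f m) (f n)))))\<^sup>2"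
      using d_le by (simp add: power_mult_distrib)
    also have "\<dots> = (vnorm V (vadd V (vdiff V x (f m)) (vdiff V x (f n))))\<^sup>2"
    proof -
      have "vadd V (vdiff V x (f m)) (vdiff V x (f n))
          = vscale V 2 (vdiff V x (vscale V (1/2) (vadd V (f m) (f n))))"
        by (rule vec_eqI) (use f x in \<open>auto simp: algebra_simps\<close>)
      then show ?thesis
        using f x by (simp add: vnorm_scale)
    qed
    finally have "4 * d \<le> (vnorm V (vadd V (vdiff V x (f m)) (vdiff V x (f n))))\<^sup>2" .
    moreover have "vnorm V (vdiff V (vdiff V x (f m)) (vdiff V x (f n))) = vnorm V (vdiff V (f m) (f n))"
    proof -
      have "vdiff V (vdiff V x (f m)) (vdiff V x (f n)) = vdiff V (f n) (f m)"
        by (rule vec_eqI) (use f x in auto)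
      then show ?thesis
        using f vnorm_diff_commute by simp
    qed
    ultimately show ?thesis
      using parallelogram[of "vdiff V x (f m)" "vdiff V x (f n)"] f(2)[of m] f(2)[of n] f(1) x
      by simp
  qed
  have "vCauchy V f"
    unfolding vCauchy_def
  proof (intro allI impI)
    fix e :: real assume e: "e > 0"
    obtain N where N: "1 / Suc N < e\<^sup>2 / 4"
      using nat_approx_posE[of "e\<^sup>2 / 4"] e by auto
    have "vnorm V (vdiff V (f m) (f n)) < e" if "m \<ge> N" "n \<ge> N" for m n
    proof -
      have "1 / Suc m \<le> 1 / Suc N" "1 / Suc n \<le> 1 / Suc N"
        using that by (auto simp: field_simps)
      then have "(vnorm V (vdiff V (f m) (f n)))\<^sup>2 < e\<^sup>2"
        using Cauchy_bound[of m n] N by simp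
      then show ?thesis
        using e power_less_imp_less_base by fastforce
    qed
    then show "\<exists>N. \<forall>m\<ge>N. \<forall>n\<ge>N. vnorm V (vdiff V (f m) (f n)) < e"
      by blast
  qed
  then obtain y where y: "y \<in> Y" "vlim V f y"
    using Ycomplete f by blast
  have "vlim V (\<lambda>n. vdiff V x (f n)) (vdiff V x y)"
    using f y x by (intro vlim_diff vlim_const) auto
  then have "(\<lambda>n. (vnorm V (vdiff V x (f n)))\<^sup>2) \<longlonglongrightarrow> (vnorm V (vdiff V x y))\<^sup>2"
    using f y x by (intro tendsto_power vlim_norm) auto
  moreover have "(\<lambda>n. d + 1 / Suc n) \<longlonglongrightarrow> d"
    using tendsto_add[OF tendsto_const LIMSEQ_inverse_real_of_nat]
    by (simp add: inverse_eq_divide)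
  ultimately have min: "(vnorm V (vdiff V x y))\<^sup>2 \<le> d"
    using f(2) by (intro LIMSEQ_le) (auto intro: less_imp_le)
  have "vinner V z y = vinner V z x" if z: "z \<in> Y" for z
  proof (cases "z = vzero V")
    case False
    then have n: "(vnorm V z)\<^sup>2 > 0"
      using z vnorm_eq_0_iff by simp
    define w where "w = vdiff V x y"
    have w: "w \<in> carr V"
      using x y w_def by simp
    \<comment> \<open>The coefficient that makes w - c z orthogonal to z. As y + c z is again in Y,
      it cannot be closer to x than y, and by \<open>vnorm_diff_projection\<close> this forces w to
      be orthogonal to z.\<close>
    define c where "c = vinner V w z / (vnorm V z)\<^sup>2"
    have "vdiff V x (vadd V y (vscale V c z)) = vdiff V w (vscale V c z)"
      unfolding w_def by (rule vec_eqI) (use x y z in auto)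
    then have "(vnorm V w)\<^sup>2 \<le> (vnorm V (vdiff V w (vscale V c z)))\<^sup>2"
      using d_le[of "vadd V y (vscale V c z)"] Yadd Yscale y z min w_def by simp
    then have "(cmod (vinner V w z))\<^sup>2 / (vnorm V z)\<^sup>2 \<le> 0"
      using vnorm_diff_projection[OF w Yc[OF z] False] unfolding c_def by linarith
    then have "vinner V w z = 0"
      using n by (simp add: pos_divide_le_eq)
    then have "vinner V z w = 0"
      using inner_commute[OF Yc[OF z] w] by simp
    then show ?thesis
      using x y z w_def by simp
  qed (use x y in simp)
  then show ?thesis
    using y by blast
qed

end

section \<open>Maps determined on a dense sequence\<close>

lemma bounded_opsI:
  assumes "T \<in> carr V \<rightarrow>\<^sub>E carr V"
    and "\<And>x y. \<lbrakk>x \<in> carr V; y \<in> carr V\<rbrakk> \<Longrightarrow> T (vadd V x y) = vadd V (T x) (T y)"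
    and "\<And>c x. x \<in> carr V \<Longrightarrow> T (vscale V c x) = vscale V c (T x)"
    and "\<And>x. x \<in> carr V \<Longrightarrow> vnorm V (T x) \<le> C * vnorm V x"
  shows "T \<in> bounded_ops V"
  using assms unfolding bounded_ops_def linear_map_def bounded_on_def
  by (auto simp: PiE_iff intro!: exI[of _ C])

lemma bounded_ops_closed: "\<lbrakk>T \<in> bounded_ops V; x \<in> carr V\<rbrakk> \<Longrightarrow> T x \<in> carr V"
  by (auto simp: bounded_ops_def)

text \<open>The closure of the range itself, not of its linear span.\<close>

definition vclosure :: "'v ipspace \<Rightarrow> (nat \<Rightarrow> 'v) \<Rightarrow> 'v set" where
  "vclosure V c = {y \<in> carr V. \<forall>e>0. \<exists>k. vnorm V (vdiff V y (c k)) < e}"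

text \<open>Stands in for an enumeration of the rational complex numbers: coefficients are only ever
  approximated.\<close>

definition dense_seq :: "(nat \<Rightarrow> complex) \<Rightarrow> bool" where
  "dense_seq q \<longleftrightarrow> (\<forall>z. \<forall>e>0. \<exists>n. cmod (q n - z) < e)"

lemma dense_seq_exists: "\<exists>q. dense_seq q"
proof -
  obtain Q :: "complex set" where Q: "countable Q" "\<And>X. open X \<Longrightarrow> X \<noteq> {} \<Longrightarrow> \<exists>d\<in>Q. d \<in> X"
    using countable_dense_setE by metis
  have "Q \<noteq> {}"
    using Q(2)[of UNIV] by auto
  have "\<exists>n. cmod (from_nat_into Q n - z) < e" if e: "e > 0" for z e
  proof -
    obtain d where "d \<in> Q" "d \<in> ball z e"
      using Q(2)[of "ball z e"] e by auto
    then show ?thesis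
      using from_nat_into_surj[OF Q(1)] by (metis dist_commute dist_norm mem_ball)
  qed
  then show ?thesis
    unfolding dense_seq_def by blast
qed

lemma dense_seq_limit:
  assumes "dense_seq q"
  shows "\<exists>h. (\<lambda>n. q (h n)) \<longlonglongrightarrow> z"
proof -
  have "\<exists>k. cmod (q k - z) < 1 / Suc n" for n
    using assms unfolding dense_seq_def by (auto dest!: spec[where x=z] spec[where x="1 / Suc n"])
  then obtain h where h: "\<And>n. cmod (q (h n) - z) < 1 / Suc n"
    by metis
  have "(\<lambda>n. q (h n) - z) \<longlonglongrightarrow> 0"
    by (rule Lim_null_comparison[OF always_eventually LIMSEQ_inverse_real_of_nat])
       (use h in \<open>simp add: inverse_eq_divide less_imp_le\<close>)
  then have "(\<lambda>n. q (h n)) \<longlonglongrightarrow> z"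
    by (rule LIM_zero_cancel)
  then show ?thesis
    by (rule exI[of _ h])
qed

context complex_inner_space
begin

lemma vclosure_closed: "y \<in> vclosure V c \<Longrightarrow> y \<in> carr V"
  by (simp add: vclosure_def)

lemma vclosure_limit:
  assumes "\<And>k. c k \<in> carr V" "y \<in> vclosure V c"
  shows "\<exists>f. vlim V (\<lambda>n. c (f n)) y"
proof -
  have "\<exists>k. vnorm V (vdiff V y (c k)) < 1 / Suc n" for n
    using assms(2) unfolding vclosure_def by (auto dest: spec[where x="1 / Suc n"])
  then obtain f where f: "\<And>n. vnorm V (vdiff V y (c (f n))) < 1 / Suc n"
    by metis
  have y: "y \<in> carr V"
    using assms(2) vclosure_closed by blast
  have "vlim V (\<lambda>n. c (f n)) y"
    unfolding vlim_def
  proof (rule Lim_null_comparison[OF always_eventually LIMSEQ_inverse_real_of_nat], intro allI)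
    show "norm (vnorm V (vdiff V (c (f n)) y)) \<le> inverse (real (Suc n))" for n
      using f[of n] y assms(1) vnorm_diff_commute[OF y assms(1)] by (simp add: inverse_eq_divide)
  qed
  then show ?thesis
    by (rule exI[of _ f])
qed

lemma vclosure_vlim:
  assumes "\<And>k. c k \<in> carr V" "\<And>n. f n \<in> vclosure V c" "y \<in> carr V" "vlim V f y"
  shows "y \<in> vclosure V c"
proof -
  have "\<exists>k. vnorm V (vdiff V y (c k)) < e" if e: "e > 0" for e
  proof -
    have fc: "f n \<in> carr V" for n
      using assms(2) vclosure_closed by blast
    obtain n where "vnorm V (vdiff V (f n) y) < e / 2"
      using order_tendstoD(2)[OF assms(4)[unfolded vlim_def], of "e/2"] e
      by (auto simp: eventually_sequentially)
    moreover obtain k where "vnorm V (vdiff V (f n) (c k)) < e / 2"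
      using assms(2)[of n] e unfolding vclosure_def by (auto dest: spec[where x="e/2"])
    ultimately show ?thesis
      using vnorm_diff_triangle[OF assms(3) fc[of n] assms(1)[of k]] vnorm_diff_commute[OF assms(3) fc[of n]]
      by (intro exI[of _ k]) linarith
  qed
  then show ?thesis
    using assms(3) by (simp add: vclosure_def)
qed

lemma vclosure_range: "(\<And>k. c k \<in> carr V) \<Longrightarrow> c k \<in> vclosure V c"
  unfolding vclosure_def by (auto simp: vnorm_diff_eq_0_iff[THEN iffD2] intro!: exI[of _ k])

text \<open>The combinations q_n c_j + c_k lie in the closure, and limits of them supply all other
  coefficients and vectors, so the closure is a complete subspace. If it misses some x, then x minus
  its projection is the required vector.\<close>

lemma orthogonal_vector_exists:
  assumes hilbert: "hilbert_space V" and c: "\<And>k. c k \<in> carr V" and q: "dense_seq q"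
    and comb: "\<And>n j k. vadd V (vscale V (q n) (c j)) (c k) \<in> vclosure V c"
    and nondense: "vclosure V c \<noteq> carr V"
  shows "\<exists>v\<in>carr V. v \<noteq> vzero V \<and> (\<forall>k. vinner V (c k) v = 0)"
proof -
  let ?Y = "vclosure V c"
  \<comment> \<open>a, x and y are approximated simultaneously: q_{h n} c_{f n} + c_{g n} lies in
    the closure by \<open>comb\<close> and converges to a x + y.\<close>
  have lin: "vadd V (vscale V a x) y \<in> ?Y" if xy: "x \<in> ?Y" "y \<in> ?Y" for a x y
  proof -
    obtain f where f: "vlim V (\<lambda>n. c (f n)) x"
      using vclosure_limit[where c=c, OF c xy(1)] by blast
    obtain g where g: "vlim V (\<lambda>n. c (g n)) y"
      using vclosure_limit[where c=c, OF c xy(2)] by blast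
    obtain h where h: "(\<lambda>n. q (h n)) \<longlonglongrightarrow> a"
      using dense_seq_limit[OF q] by blast
    have xy: "x \<in> carr V" "y \<in> carr V"
      using xy vclosure_closed by auto
    show ?thesis
    proof (rule vclosure_vlim[where c=c])
      show "vlim V (\<lambda>n. vadd V (vscale V (q (h n)) (c (f n))) (c (g n))) (vadd V (vscale V a x) y)"
        using c f g h xy by (intro vlim_add vlim_scale) simp_all
    qed (use c comb xy in simp_all)
  qed
  have zero: "vzero V \<in> ?Y"
  proof -
    have "vzero V = vadd V (vscale V (-1) (c 0)) (c 0)"
      by (rule vec_eqI) (use c in auto)
    then show ?thesis
      using lin[OF vclosure_range[where c=c, OF c] vclosure_range[where c=c, OF c]] by metis
  qed
  have add: "vadd V x y \<in> ?Y" if "x \<in> ?Y" "y \<in> ?Y" for x y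
    using lin[OF that, of 1] that vclosure_closed scale_one by metis
  have scale: "vscale V a x \<in> ?Y" if "x \<in> ?Y" for a x
    using lin[OF that zero, of a] that vclosure_closed add_zero scale_closed by metis
  obtain x where x: "x \<in> carr V" "x \<notin> ?Y"
    using nondense vclosure_closed by blast
  have "\<exists>y\<in>?Y. \<forall>z\<in>?Y. vinner V z y = vinner V z x"
  proof (rule projection_exists)
    show "\<exists>y\<in>?Y. vlim V f y" if f: "\<And>n. f n \<in> ?Y" "vCauchy V f" for f
    proof -
      have "f n \<in> carr V" for n
        using f(1) vclosure_closed by blast
      then obtain y where y: "y \<in> carr V" "vlim V f y"
        using hilbert_vCauchy[OF hilbert _ f(2)] by blast
      then have "y \<in> ?Y"
        using c f(1) by (intro vclosure_vlim[where c=c and f=f and y=y])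
      then show ?thesis
        using y by blast
    qed
  qed (use vclosure_closed zero add scale x in auto)
  then obtain y where y: "y \<in> ?Y" "\<And>z. z \<in> ?Y \<Longrightarrow> vinner V z y = vinner V z x"
    by blast
  have yc: "y \<in> carr V"
    using y vclosure_closed by blast
  have "vdiff V x y \<noteq> vzero V"
    using x y yc diff_eq_zero_iff by metis
  moreover have "vinner V (c k) (vdiff V x y) = 0" for k
    using y(2)[OF vclosure_range[where c=c, OF c]] c x yc by simp
  ultimately show ?thesis
    using x yc diff_closed by blast
qed

text \<open>Choose c_{f n} converging to x: the inequalities at k = f n force s_{f n} to converge
  both to y and to y'.\<close>

lemma extension_unique:
  assumes c: "\<And>k. c k \<in> carr V" and s: "\<And>k. s k \<in> carr V" and "x \<in> vclosure V c"
    and "y \<in> carr V" "\<And>k. vnorm V (vdiff V y (s k)) \<le> C * vnorm V (vdiff V x (c k))"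
    and "y' \<in> carr V" "\<And>k. vnorm V (vdiff V y' (s k)) \<le> C * vnorm V (vdiff V x (c k))"
  shows "y = y'"
proof -
  obtain f where f: "vlim V (\<lambda>n. c (f n)) x"
    using vclosure_limit[where c=c, OF c] assms(3) by blast
  have x: "x \<in> carr V"
    using assms(3) vclosure_closed by blast
  have lim: "vlim V (\<lambda>n. s (f n)) y"
    if y: "y \<in> carr V" "\<And>k. vnorm V (vdiff V y (s k)) \<le> C * vnorm V (vdiff V x (c k))" for y
  proof -
    have "(\<lambda>n. C * vnorm V (vdiff V (c (f n)) x)) \<longlonglongrightarrow> C * 0"
      using f unfolding vlim_def by (intro tendsto_intros)
    then have *: "(\<lambda>n. C * vnorm V (vdiff V (c (f n)) x)) \<longlonglongrightarrow> 0"
      by simp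
    show ?thesis
      unfolding vlim_def
    proof (rule Lim_null_comparison[OF always_eventually *], intro allI)
      fix n
      show "norm (vnorm V (vdiff V (s (f n)) y)) \<le> C * vnorm V (vdiff V (c (f n)) x)"
        using y(2)[of "f n"] vnorm_diff_commute[OF y(1) s] vnorm_diff_commute[OF x c] y(1) s
        by simp
    qed
  qed
  show ?thesis
    by (rule vlim_unique[OF _ assms(4) lim assms(6) lim]) (use assms in auto)
qed

text \<open>The hypothesis \<open>le\<close> replaces linearity of c_k |-> s_k, which cannot be
  stated directly because the c_k need not be closed under combinations. By density it controls both
  the existence of limits of the s_k and the linearity of the extension. The conclusion contains t
  c_k = s_k as the case x = c_k, and is the form to which \<open>extension_unique\<close>
  applies.\<close>

lemma bounded_extension:
  assumes hilbert: "hilbert_space V" and c: "\<And>k. c k \<in> carr V" and s: "\<And>k. s k \<in> carr V"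
    and q: "dense_seq q" and dense: "vclosure V c = carr V" and C: "0 \<le> C"
    and le: "\<And>n j k l. vnorm V (vdiff V (s l) (vadd V (vscale V (q n) (s j)) (s k)))
      \<le> C * vnorm V (vdiff V (c l) (vadd V (vscale V (q n) (c j)) (c k)))"
  shows "\<exists>t\<in>bounded_ops V. \<forall>x\<in>carr V. \<forall>k. vnorm V (vdiff V (t x) (s k)) \<le> C * vnorm V (vdiff V x (c k))"
proof -
  \<comment> \<open>\<open>le\<close> survives passage to the limit in the coefficient q_n and in
    c_j and c_k, while c_l stays fixed.\<close>
  have lim_le: "vnorm V (vdiff V (s l) (vadd V (vscale V a y) y'))
      \<le> C * vnorm V (vdiff V (c l) (vadd V (vscale V a x) x'))"
    if "x \<in> carr V" "x' \<in> carr V" "y \<in> carr V" "y' \<in> carr V"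
      "vlim V (\<lambda>n. c (f n)) x" "vlim V (\<lambda>n. c (g n)) x'"
      "vlim V (\<lambda>n. s (f n)) y" "vlim V (\<lambda>n. s (g n)) y'" for a x x' y y' f g l
  proof -
    obtain h where h: "(\<lambda>n. q (h n)) \<longlonglongrightarrow> a"
      using dense_seq_limit[OF q] by blast
    have "vlim V (\<lambda>n. vdiff V (s l) (vadd V (vscale V (q (h n)) (s (f n))) (s (g n))))
        (vdiff V (s l) (vadd V (vscale V a y) y'))"
      using s that h by (intro vlim_diff vlim_add vlim_scale vlim_const) auto
    then have "(\<lambda>n. vnorm V (vdiff V (s l) (vadd V (vscale V (q (h n)) (s (f n))) (s (g n)))))
        \<longlonglongrightarrow> vnorm V (vdiff V (s l) (vadd V (vscale V a y) y'))"
      using s that by (intro vlim_norm) auto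
    moreover have "vlim V (\<lambda>n. vdiff V (c l) (vadd V (vscale V (q (h n)) (c (f n))) (c (g n))))
        (vdiff V (c l) (vadd V (vscale V a x) x'))"
      using c that h by (intro vlim_diff vlim_add vlim_scale vlim_const) auto
    then have "(\<lambda>n. C * vnorm V (vdiff V (c l) (vadd V (vscale V (q (h n)) (c (f n))) (c (g n)))))
        \<longlonglongrightarrow> C * vnorm V (vdiff V (c l) (vadd V (vscale V a x) x'))"
      using c that by (intro tendsto_intros vlim_norm) auto
    ultimately show ?thesis
      using le by (intro LIMSEQ_le) auto
  qed
  \<comment> \<open>The case a = 0 of \<open>lim_le\<close> with constant sequences.\<close>
  have s_le: "vnorm V (vdiff V (s l) (s k)) \<le> C * vnorm V (vdiff V (c l) (c k))" for l k
  proof -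
    have *: "vadd V (vscale V 0 x) y = y" if "x \<in> carr V" "y \<in> carr V" for x y
      by (rule vec_eqI) (use that in auto)
    show ?thesis
      using lim_le[where a=0 and f="\<lambda>_. k" and g="\<lambda>_. k" and x="c k" and x'="c k" and y="s k" and y'="s k" and l=l]
      by (simp add: c s vlim_const *)
  qed
  have ex: "\<exists>y\<in>carr V. \<forall>k. vnorm V (vdiff V y (s k)) \<le> C * vnorm V (vdiff V x (c k))"
    if x: "x \<in> carr V" for x
  proof -
    obtain f where f: "vlim V (\<lambda>n. c (f n)) x"
      using vclosure_limit[where c=c, OF c] x dense by blast
    have "vCauchy V (\<lambda>n. s (f n))"
      unfolding vCauchy_def
    proof (intro allI impI)
      fix e :: real assume e: "e > 0"
      \<comment> \<open>C + 1 rather than C in the denominator, since C may be 0.\<close>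
      define e' where "e' = e / (2 * (C + 1))"
      have e': "e' > 0" "C * (2 * e') < e"
        using e C by (auto simp: e'_def field_simps)
      obtain N where N: "\<And>n. n \<ge> N \<Longrightarrow> vnorm V (vdiff V (c (f n)) x) < e'"
        using order_tendstoD(2)[OF f[unfolded vlim_def] e'(1)] by (auto simp: eventually_sequentially)
      have "vnorm V (vdiff V (s (f m)) (s (f n))) < e" if "m \<ge> N" "n \<ge> N" for m n
      proof -
        have "vnorm V (vdiff V (c (f m)) (c (f n))) \<le> 2 * e'"
          using vnorm_diff_triangle[OF c[of "f m"] x c[of "f n"]] N[OF that(1)] N[OF that(2)]
            vnorm_diff_commute[OF x c[of "f n"]] by linarith
        then have "C * vnorm V (vdiff V (c (f m)) (c (f n))) \<le> C * (2 * e')"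
          using C by (rule mult_left_mono)
        then show ?thesis
          using s_le[of "f m" "f n"] e'(2) by linarith
      qed
      then show "\<exists>N. \<forall>m\<ge>N. \<forall>n\<ge>N. vnorm V (vdiff V (s (f m)) (s (f n))) < e"
        by blast
    qed
    then obtain y where y: "y \<in> carr V" "vlim V (\<lambda>n. s (f n)) y"
      using hilbert_vCauchy[OF hilbert, of "\<lambda>n. s (f n)"] s by blast
    have "vnorm V (vdiff V y (s k)) \<le> C * vnorm V (vdiff V x (c k))" for k
    proof (rule LIMSEQ_le)
      show "(\<lambda>n. vnorm V (vdiff V (s (f n)) (s k))) \<longlonglongrightarrow> vnorm V (vdiff V y (s k))"
        using y s by (intro vlim_norm vlim_diff vlim_const) auto
      show "(\<lambda>n. C * vnorm V (vdiff V (c (f n)) (c k))) \<longlonglongrightarrow> C * vnorm V (vdiff V x (c k))"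
        using f x c by (intro tendsto_intros vlim_norm vlim_diff vlim_const) auto
    qed (use s_le in auto)
    then show ?thesis
      using y by blast
  qed
  define t where "t = (\<lambda>x\<in>carr V. SOME y. y \<in> carr V
    \<and> (\<forall>k. vnorm V (vdiff V y (s k)) \<le> C * vnorm V (vdiff V x (c k))))"
  have t: "t x \<in> carr V" "\<And>k. vnorm V (vdiff V (t x) (s k)) \<le> C * vnorm V (vdiff V x (c k))"
    if "x \<in> carr V" for x
    using someI_ex[of "\<lambda>y. y \<in> carr V \<and> (\<forall>k. vnorm V (vdiff V y (s k)) \<le> C * vnorm V (vdiff V x (c k)))"]
      ex[OF that] that by (auto simp: t_def Bex_def)
  have t_lim: "vlim V (\<lambda>n. s (f n)) (t x)" if x: "x \<in> carr V" and f: "vlim V (\<lambda>n. c (f n)) x" for x f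
  proof -
    have "(\<lambda>n. C * vnorm V (vdiff V (c (f n)) x)) \<longlonglongrightarrow> C * 0"
      using f unfolding vlim_def by (intro tendsto_intros)
    then have *: "(\<lambda>n. C * vnorm V (vdiff V (c (f n)) x)) \<longlonglongrightarrow> 0"
      by simp
    show ?thesis
      unfolding vlim_def
    proof (rule Lim_null_comparison[OF always_eventually *], intro allI)
      fix n
      show "norm (vnorm V (vdiff V (s (f n)) (t x))) \<le> C * vnorm V (vdiff V (c (f n)) x)"
        using t(2)[OF x, of "f n"] vnorm_diff_commute[OF t(1)[OF x] s] vnorm_diff_commute[OF x c] t(1)[OF x] s
        by simp
    qed
  qed
  \<comment> \<open>By \<open>lim_le\<close>, the vector a t x + t y satisfies the inequalities that
    characterise the value of t at a x + y; uniqueness gives linearity.\<close>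
  have t_lin: "t (vadd V (vscale V a x) y) = vadd V (vscale V a (t x)) (t y)"
    if x: "x \<in> carr V" and y: "y \<in> carr V" for a x y
  proof (rule extension_unique[where c=c and s=s, OF c s])
    obtain f g where f: "vlim V (\<lambda>n. c (f n)) x" and g: "vlim V (\<lambda>n. c (g n)) y"
      using vclosure_limit[where c=c, OF c] x y dense by metis
    show "vnorm V (vdiff V (vadd V (vscale V a (t x)) (t y)) (s l))
        \<le> C * vnorm V (vdiff V (vadd V (vscale V a x) y) (c l))" for l
      using lim_le[OF x y t(1)[OF x] t(1)[OF y] f g t_lim[OF x f] t_lim[OF y g], of l a]
        vnorm_diff_commute[of "s l"] vnorm_diff_commute[of "c l"] t(1) x y c s by simp
  qed (use x y t dense in auto)
  have add: "t (vadd V x y) = vadd V (t x) (t y)" if "x \<in> carr V" "y \<in> carr V" for x y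
    using t_lin[OF that, of 1] t(1) that by (simp add: scale_one)
  have t0: "t (vzero V) = vzero V"
  proof -
    have "vadd V (vscale V (-1) x) x = vzero V" if "x \<in> carr V" for x
      by (rule vec_eqI) (use that in auto)
    then show ?thesis
      using t_lin[of "vzero V" "vzero V" "-1"] t(1) by simp
  qed
  have scale: "t (vscale V a x) = vscale V a (t x)" if "x \<in> carr V" for a x
    using t_lin[OF that, of "vzero V" a] t(1) that t0 by (simp add: add_zero)
  have bound: "vnorm V (t x) \<le> C * vnorm V x" if x: "x \<in> carr V" for x
  proof -
    \<comment> \<open>No c_k need be zero, so 0 is only approached by some c_{f n}. Then s_{f n}
      tends to t 0 = 0, and the distance inequalities become the norm bound.\<close>
    obtain f where f: "vlim V (\<lambda>n. c (f n)) (vzero V)"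
      using vclosure_limit[where c=c, OF c, of "vzero V"] dense by auto
    have "vnorm V (vdiff V (t x) (t (vzero V))) \<le> C * vnorm V (vdiff V x (vzero V))"
    proof (rule LIMSEQ_le)
      show "(\<lambda>n. vnorm V (vdiff V (t x) (s (f n)))) \<longlonglongrightarrow> vnorm V (vdiff V (t x) (t (vzero V)))"
        using t_lim[OF _ f] t(1) x s by (intro vlim_norm vlim_diff vlim_const) auto
      show "(\<lambda>n. C * vnorm V (vdiff V x (c (f n)))) \<longlonglongrightarrow> C * vnorm V (vdiff V x (vzero V))"
        using f x c by (intro tendsto_intros vlim_norm vlim_diff vlim_const) auto
    qed (use t x in auto)
    moreover have "vdiff V z (vzero V) = z" if "z \<in> carr V" for z
      by (rule vec_eqI) (use that in auto)
    ultimately show ?thesis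
      using t(1) x t0 by simp
  qed
  have "t \<in> carr V \<rightarrow>\<^sub>E carr V"
    using t(1) by (auto simp: t_def)
  then have "t \<in> bounded_ops V"
    using add scale bound by (rule bounded_opsI)
  then show ?thesis
    using t by blast
qed

end

section \<open>Compressions\<close>

lemma hilbert_spaceD: "hilbert_space V \<Longrightarrow> complex_inner_space V"
  by (simp add: hilbert_space_def)

lemma fibre_simps [simp]:
  "carr (fibre D H \<alpha> p) = H \<alpha> p" "vzero (fibre D H \<alpha> p) = vzero (D p)"
  "vadd (fibre D H \<alpha> p) = vadd (D p)" "vscale (fibre D H \<alpha> p) = vscale (D p)"
  "vinner (fibre D H \<alpha> p) = vinner (D p)" "vnorm (fibre D H \<alpha> p) = vnorm (D p)"
  "vdiff (fibre D H \<alpha> p) = vdiff (D p)" "vlim (fibre D H \<alpha> p) = vlim (D p)"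
  "vCauchy (fibre D H \<alpha> p) = vCauchy (D p)"
  by (simp_all add: fibre_def)

lemma locally_hilbert_fibre: "locally_hilbert (D p) (\<lambda>\<alpha>. H \<alpha> p) \<Longrightarrow> hilbert_space (fibre D H \<alpha> p)"
  by (simp add: locally_hilbert_def fibre_def)

text \<open>The adjoint of an inclusion is the orthogonal projection. Since
  \<open>adjoint_map\<close> is a definite description, its value is accessible only after
  existence, by completeness of \<open>H \<alpha> p\<close>, and uniqueness have been shown.\<close>

lemma adjoint_inclusion:
  assumes lh: "locally_hilbert (D p) (\<lambda>\<alpha>. H \<alpha> p)" and le: "\<alpha> \<le> \<beta>" and y: "y \<in> H \<beta> p"
  defines "P \<equiv> adjoint_map (fibre D H \<alpha> p) (fibre D H \<beta> p) (\<lambda>x\<in>H \<alpha> p. x)"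
  shows "P y \<in> H \<alpha> p" "\<And>z. z \<in> H \<alpha> p \<Longrightarrow> vinner (D p) z (P y) = vinner (D p) z y"
    and "y \<in> H \<alpha> p \<Longrightarrow> P y = y"
proof -
  interpret A: complex_inner_space "fibre D H \<alpha> p"
    using lh locally_hilbert_fibre hilbert_spaceD by metis
  interpret B: complex_inner_space "fibre D H \<beta> p"
    using lh locally_hilbert_fibre hilbert_spaceD by metis
  have sub: "H \<alpha> p \<subseteq> H \<beta> p"
    using lh le by (auto simp: locally_hilbert_def)
  have "\<exists>x\<in>H \<alpha> p. \<forall>z\<in>H \<alpha> p. vinner (fibre D H \<beta> p) z x = vinner (fibre D H \<beta> p) z y"
  proof (rule B.projection_exists)
    show "\<exists>y\<in>H \<alpha> p. vlim (fibre D H \<beta> p) f y" if "\<And>n. f n \<in> H \<alpha> p" "vCauchy (fibre D H \<beta> p) f" for f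
      using A.hilbert_vCauchy[OF locally_hilbert_fibre[of D p H, OF lh], of f] that by simp
  qed (use sub y A.closed in auto)
  then obtain x where x: "x \<in> H \<alpha> p" "\<And>z. z \<in> H \<alpha> p \<Longrightarrow> vinner (D p) z x = vinner (D p) z y"
    by auto
  have uniq: "x' = x" if "x' \<in> H \<alpha> p" "\<And>z. z \<in> H \<alpha> p \<Longrightarrow> vinner (D p) z x' = vinner (D p) z y" for x'
    by (rule A.vec_eqI_right) (use that x in auto)
  have "P y = (THE x. x \<in> H \<alpha> p \<and> (\<forall>z\<in>H \<alpha> p. vinner (D p) z x = vinner (D p) z y))"
    using y unfolding P_def adjoint_map_def by (simp cong: conj_cong ball_cong)
  also have "\<dots> = x"
    using x uniq by (intro the_equality) blast+
  finally have Px: "P y = x" .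
  show "P y \<in> H \<alpha> p" "\<And>z. z \<in> H \<alpha> p \<Longrightarrow> vinner (D p) z (P y) = vinner (D p) z y"
    using x Px by auto
  show "P y = y" if "y \<in> H \<alpha> p"
    using uniq[OF that refl] Px by simp
qed

lemma fibre_compression_bounded:
  assumes lh: "locally_hilbert (D p) (\<lambda>\<alpha>. H \<alpha> p)" and le: "\<alpha> \<le> \<beta>"
    and t: "t \<in> bounded_ops (fibre D H \<beta> p)"
  shows "fibre_compression D H \<alpha> \<beta> p t \<in> bounded_ops (fibre D H \<alpha> p)"
proof -
  interpret A: complex_inner_space "fibre D H \<alpha> p"
    using lh locally_hilbert_fibre hilbert_spaceD by metis
  interpret B: complex_inner_space "fibre D H \<beta> p"
    using lh locally_hilbert_fibre hilbert_spaceD by metis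
  note Bs = B.closed[simplified] B.inner_simps[simplified]
  have sub: "x \<in> H \<beta> p" if "x \<in> H \<alpha> p" for x
    using lh le that by (auto simp: locally_hilbert_def)
  define P where "P = adjoint_map (fibre D H \<alpha> p) (fibre D H \<beta> p) (\<lambda>x\<in>H \<alpha> p. x)"
  define r where "r = fibre_compression D H \<alpha> \<beta> p t"
  have P: "P y \<in> H \<alpha> p" "\<And>z. z \<in> H \<alpha> p \<Longrightarrow> vinner (D p) z (P y) = vinner (D p) z y" if "y \<in> H \<beta> p" for y
    using adjoint_inclusion[of D p H, OF lh le that] P_def by auto
  have r: "r x = P (t x)" if "x \<in> H \<alpha> p" for x
    using that by (simp add: r_def fibre_compression_def P_def)
  have t_closed: "t x \<in> H \<beta> p" if "x \<in> H \<alpha> p" for x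
    using t that sub by (auto simp: bounded_ops_def linear_map_def)
  have t_add: "t (vadd (D p) x y) = vadd (D p) (t x) (t y)" if "x \<in> H \<alpha> p" "y \<in> H \<alpha> p" for x y
    using t that sub by (auto simp: bounded_ops_def linear_map_def)
  have t_scale: "t (vscale (D p) c x) = vscale (D p) c (t x)" if "x \<in> H \<alpha> p" for x c
    using t that sub by (auto simp: bounded_ops_def linear_map_def)
  obtain C where C: "\<And>x. x \<in> H \<beta> p \<Longrightarrow> vnorm (D p) (t x) \<le> C * vnorm (D p) x"
    using t by (auto simp: bounded_ops_def bounded_on_def)
  have rc: "r x \<in> H \<alpha> p" if "x \<in> H \<alpha> p" for x
    using r P t_closed that by simp
  have "r (vadd (D p) x y) = vadd (D p) (r x) (r y)" if "x \<in> H \<alpha> p" "y \<in> H \<alpha> p" for x y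
  proof -
    have xy: "vadd (D p) x y \<in> H \<alpha> p"
      using A.add_closed that by simp
    show ?thesis
    proof (rule A.vec_eqI_right)
      fix z assume z: "z \<in> carr (fibre D H \<alpha> p)"
      have "vinner (D p) z (r (vadd (D p) x y)) = vinner (D p) z (vadd (D p) (t x) (t y))"
        using P z r xy t_closed that t_add Bs by simp
      also have "\<dots> = vinner (D p) z (r x) + vinner (D p) z (r y)"
        using P z r t_closed that B.inner_add_right[of z] sub by simp
      also have "\<dots> = vinner (D p) z (vadd (D p) (r x) (r y))"
        using z rc that A.inner_add_right[of z] by simp
      finally show "vinner (fibre D H \<alpha> p) z (r (vadd (D p) x y))
          = vinner (fibre D H \<alpha> p) z (vadd (D p) (r x) (r y))" by simp
    qed (use rc xy that A.add_closed in auto)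
  qed
  moreover have "r (vscale (D p) c x) = vscale (D p) c (r x)" if "x \<in> H \<alpha> p" for c x
  proof -
    have cx: "vscale (D p) c x \<in> H \<alpha> p"
      using A.scale_closed that by simp
    show ?thesis
    proof (rule A.vec_eqI_right)
      fix z assume z: "z \<in> carr (fibre D H \<alpha> p)"
      have "vinner (D p) z (r (vscale (D p) c x)) = vinner (D p) z (vscale (D p) c (t x))"
        using P z r cx t_closed that t_scale Bs by simp
      also have "\<dots> = cnj c * vinner (D p) z (r x)"
        using P z r t_closed that B.inner_scale_right[of z] sub by simp
      also have "\<dots> = vinner (D p) z (vscale (D p) c (r x))"
        using z rc that A.inner_scale_right[of z] by simp
      finally show "vinner (fibre D H \<alpha> p) z (r (vscale (D p) c x))
          = vinner (fibre D H \<alpha> p) z (vscale (D p) c (r x))" by simp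
    qed (use rc cx that A.scale_closed in auto)
  qed
  moreover have "vnorm (D p) (r x) \<le> C * vnorm (D p) x" if x: "x \<in> H \<alpha> p" for x
  proof -
    \<comment> \<open>As \<open>r x\<close> is the projection of \<open>t x\<close>, its squared
      norm is its inner product with \<open>t x\<close>; Cauchy-Schwarz then allows one factor to be
      cancelled.\<close>
    have "(vnorm (D p) (r x))\<^sup>2 = cmod (vinner (D p) (r x) (r x))"
      using A.inner_self[of "r x"] rc[OF x] by (simp flip: of_real_power)
    also have "vinner (D p) (r x) (r x) = vinner (D p) (r x) (t x)"
      using P(2)[OF t_closed[OF x] rc[OF x]] r x by simp
    also have "cmod \<dots> \<le> vnorm (D p) (r x) * vnorm (D p) (t x)"
      using B.Cauchy_Schwarz[of "r x" "t x"] sub rc t_closed x by simp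
    finally have "vnorm (D p) (r x) \<le> vnorm (D p) (t x)"
      using A.vnorm_nonneg[of "r x"] B.vnorm_nonneg[of "t x"] rc[OF x] t_closed[OF x]
      by (cases "vnorm (D p) (r x) = 0") (auto simp: power2_eq_square)
    then show ?thesis
      using C[OF sub[OF x]] by simp
  qed
  moreover have "r \<in> H \<alpha> p \<rightarrow>\<^sub>E H \<alpha> p"
    using rc by (auto simp: r_def fibre_compression_def)
  ultimately show ?thesis
    unfolding r_def[symmetric] by (intro bounded_opsI[where C=C]) simp_all
qed

lemma fibre_compression_eq:
  assumes "locally_hilbert (D p) (\<lambda>\<alpha>. H \<alpha> p)" "\<alpha> \<le> \<beta>" "x \<in> H \<alpha> p" "t x \<in> H \<alpha> p"
  shows "fibre_compression D H \<alpha> \<beta> p t x = t x"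
proof -
  have "t x \<in> H \<beta> p"
    using assms by (auto simp: locally_hilbert_def)
  then show ?thesis
    using adjoint_inclusion(3)[of D p H, OF assms(1,2) _ assms(4)] assms(3) by (simp add: fibre_compression_def)
qed

section \<open>The operator norm\<close>

context complex_inner_space
begin

lemma op_diff_bounded:
  assumes "T \<in> bounded_ops V" "S \<in> bounded_ops V"
  shows "\<exists>C. \<forall>x\<in>carr V. vnorm V (op_diff V T S x) \<le> C * vnorm V x"
proof -
  obtain B C where BC: "\<And>x. x \<in> carr V \<Longrightarrow> vnorm V (T x) \<le> B * vnorm V x"
    "\<And>x. x \<in> carr V \<Longrightarrow> vnorm V (S x) \<le> C * vnorm V x"
    using assms unfolding bounded_ops_def bounded_on_def by blast
  have "vnorm V (op_diff V T S x) \<le> (B + C) * vnorm V x" if x: "x \<in> carr V" for x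
  proof -
    have c: "T x \<in> carr V" "S x \<in> carr V"
      using assms x by (auto simp: bounded_ops_def)
    have "vnorm V (vdiff V (T x) (S x)) \<le> vnorm V (T x) + vnorm V (S x)"
      unfolding vdiff_def using vnorm_triangle[of "T x" "vscale V (-1) (S x)"] c by (simp add: vnorm_scale)
    then show ?thesis
      using BC[OF x] x by (simp add: op_diff_def distrib_right)
  qed
  then show ?thesis by blast
qed

lemma bdd_above_op_diff:
  assumes "T \<in> bounded_ops V" "S \<in> bounded_ops V"
  shows "bdd_above ((\<lambda>x. vnorm V (op_diff V T S x)) ` {x \<in> carr V. vnorm V x \<le> 1})"
proof -
  obtain C where C: "\<And>x. x \<in> carr V \<Longrightarrow> vnorm V (op_diff V T S x) \<le> C * vnorm V x"
    using op_diff_bounded[OF assms] by blast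
  have "vnorm V (op_diff V T S x) \<le> \<bar>C\<bar>" if "x \<in> carr V" "vnorm V x \<le> 1" for x
  proof -
    have "C * vnorm V x \<le> \<bar>C\<bar> * 1"
      using that by (intro mult_mono) auto
    then show ?thesis
      using C[OF that(1)] by simp
  qed
  then show ?thesis
    by (intro bdd_aboveI[where M="\<bar>C\<bar>"]) auto
qed

lemma op_norm_upper:
  assumes "T \<in> bounded_ops V" "S \<in> bounded_ops V" "x \<in> carr V" "vnorm V x \<le> 1"
  shows "vnorm V (op_diff V T S x) \<le> op_norm_on V (carr V) (op_diff V T S)"
  unfolding op_norm_on_def using bdd_above_op_diff[OF assms(1,2)] assms(3,4)
  by (intro cSUP_upper) auto

lemma op_norm_least:
  assumes "\<And>x. \<lbrakk>x \<in> carr V; vnorm V x \<le> 1\<rbrakk> \<Longrightarrow> vnorm V (F x) \<le> B"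
  shows "op_norm_on V (carr V) F \<le> B"
  unfolding op_norm_on_def using assms zero_closed by (intro cSUP_least) (auto intro!: exI[of _ "vzero V"])

lemma op_diff_closed:
  "\<lbrakk>T \<in> bounded_ops V; S \<in> bounded_ops V; x \<in> carr V\<rbrakk> \<Longrightarrow> op_diff V T S x \<in> carr V"
  by (simp add: op_diff_def bounded_ops_closed)

lemma op_norm_nonneg:
  assumes "T \<in> bounded_ops V" "S \<in> bounded_ops V"
  shows "0 \<le> op_norm_on V (carr V) (op_diff V T S)"
  using op_norm_upper[OF assms zero_closed] op_diff_closed[OF assms zero_closed] vnorm_nonneg
  by (metis order_trans vnorm_zero zero_le_one)

lemma op_norm_eq_0:
  assumes T: "T \<in> bounded_ops V" and S: "S \<in> bounded_ops V"
  shows "op_norm_on V (carr V) (op_diff V T S) = 0 \<longleftrightarrow> T = S"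
proof
  assume 0: "op_norm_on V (carr V) (op_diff V T S) = 0"
  have "T x = S x" if x: "x \<in> carr V" for x
  proof (cases "x = vzero V")
    case True
    have "F (vscale V 0 x) = vscale V 0 (F x) \<and> F x \<in> carr V" if "F \<in> bounded_ops V" for F
      using that x by (auto simp: bounded_ops_def linear_map_def)
    then show ?thesis
      using T S x True scale_zero by metis
  next
    case False
    define a where "a = vnorm V x"
    have a: "a > 0"
      using False x vnorm_eq_0_iff vnorm_nonneg a_def by (metis order_less_le)
    define y where "y = vscale V (1 / a) x"
    have y: "y \<in> carr V" "vnorm V y \<le> 1" "vscale V a y = x"
      using x a by (auto simp: y_def vnorm_scale a_def[symmetric] scale_scale scale_one norm_divide)
    have c: "T y \<in> carr V" "S y \<in> carr V"
      using T S y by (auto simp: bounded_ops_def)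
    have "vnorm V (op_diff V T S y) = 0"
      using op_norm_upper[OF T S y(1,2)] 0 op_diff_closed[OF T S y(1)] vnorm_nonneg by fastforce
    then have "T y = S y"
      using y c by (simp add: op_diff_def vnorm_diff_eq_0_iff)
    moreover have "F x = vscale V a (F y)" if "F \<in> bounded_ops V" for F
      using that y by (auto simp: bounded_ops_def linear_map_def)
    ultimately show ?thesis
      using T S by metis
  qed
  then show "T = S"
    using T S by (auto simp: bounded_ops_def intro: PiE_ext)
next
  assume "T = S"
  then have "vnorm V (op_diff V T S x) = 0" if "x \<in> carr V" for x
    using that T by (simp add: op_diff_def bounded_ops_closed vnorm_diff_eq_0_iff[THEN iffD2])
  then have "op_norm_on V (carr V) (op_diff V T S) \<le> 0"
    by (intro op_norm_least) auto
  then show "op_norm_on V (carr V) (op_diff V T S) = 0"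
    using op_norm_nonneg[OF T S] by simp
qed

text \<open>\<open>norm_topology\<close> is built with \<open>Metric_space.mtopology\<close>, whose
  theory applies only once the metric axioms hold. Boundedness of the operators makes the suprema in
  \<open>op_norm_on\<close> genuine upper bounds.\<close>

lemma Metric_space_op_norm:
  assumes A: "A \<subseteq> bounded_ops V"
  shows "Metric_space A (\<lambda>T S. if T \<in> A \<and> S \<in> A then op_norm_on V (carr V) (op_diff V T S) else 0)"
proof -
  let ?n = "\<lambda>T S. op_norm_on V (carr V) (op_diff V T S)"
  have c: "T x \<in> carr V" if "T \<in> A" "x \<in> carr V" for T x
    using that A by (auto simp: bounded_ops_def)
  have le: "?n S T \<le> ?n T S" if "T \<in> A" "S \<in> A" for T S
  proof (rule op_norm_least)
    fix x assume x: "x \<in> carr V" "vnorm V x \<le> 1"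
    then show "vnorm V (op_diff V S T x) \<le> ?n T S"
      using op_norm_upper[of T S x] that A vnorm_diff_commute[of "T x" "S x"] c by (auto simp: op_diff_def)
  qed
  have tri: "?n T R \<le> ?n T S + ?n S R" if "T \<in> A" "S \<in> A" "R \<in> A" for T S R
  proof (rule op_norm_least)
    fix x assume x: "x \<in> carr V" "vnorm V x \<le> 1"
    then show "vnorm V (op_diff V T R x) \<le> ?n T S + ?n S R"
      using op_norm_upper[of T S x] op_norm_upper[of S R x] that A c
        vnorm_diff_triangle[of "T x" "S x" "R x"] by (simp add: op_diff_def subset_iff)
  qed
  show ?thesis
  proof
    show "0 \<le> (if T \<in> A \<and> S \<in> A then ?n T S else 0)" for T S
      using op_norm_nonneg A by auto
    show "(if T \<in> A \<and> S \<in> A then ?n T S else 0) = (if S \<in> A \<and> T \<in> A then ?n S T else 0)" for T S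
      using le by (auto intro: antisym)
    show "((if T \<in> A \<and> S \<in> A then ?n T S else 0) = 0) = (T = S)" if "T \<in> A" "S \<in> A" for T S
      using op_norm_eq_0 that A by auto
    show "(if T \<in> A \<and> R \<in> A then ?n T R else 0)
        \<le> (if T \<in> A \<and> S \<in> A then ?n T S else 0) + (if S \<in> A \<and> R \<in> A then ?n S R else 0)"
      if "T \<in> A" "S \<in> A" "R \<in> A" for T S R
      using tri that by auto
  qed
qed

end

section \<open>Spaces of sections\<close>

lemma mem_ae_class: "w \<in> ae_class N K u \<longleftrightarrow> w \<in> K \<and> (AE p in N. w p = u p)"
  by (simp add: ae_class_def)

lemma ae_class_self: "u \<in> K \<Longrightarrow> u \<in> ae_class N K u"
  by (simp add: ae_class_def)

lemma ae_class_eqI: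
  assumes "AE p in N. u p = v p"
  shows "ae_class N K u = ae_class N K v"
proof -
  have "(AE p in N. w p = u p) \<longleftrightarrow> (AE p in N. w p = v p)" for w
    using assms by (intro iffI; elim AE_mp) (auto intro!: AE_I2)
  then show ?thesis
    by (simp add: ae_class_def)
qed

lemma carr_section_space: "carr (section_space N F K) = ae_class N K ` K"
  by (simp add: section_space_def)

lemma carr_rep:
  assumes "A \<in> ae_class N K ` K" "u \<in> A"
  shows "u \<in> K" "A = ae_class N K u"
proof -
  obtain v where "v \<in> K" "A = ae_class N K v"
    using assms by auto
  then have "u \<in> K" "AE p in N. u p = v p"
    using assms(2) by (auto simp: mem_ae_class)
  then show "u \<in> K" "A = ae_class N K u"
    using ae_class_eqI[OF \<open>AE p in N. u p = v p\<close>] \<open>A = _\<close> by simp_all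
qed

lemma carr_ex_rep: "A \<in> ae_class N K ` K \<Longrightarrow> \<exists>u\<in>K. u \<in> A \<and> A = ae_class N K u"
  by (metis ae_class_self imageE)

text \<open>No measurability of f is assumed: every preimage either lies inside a null set or
  contains the complement of one, and the completion contains all such sets.\<close>

lemma borel_measurable_completion_AE_0:
  fixes f :: "'a \<Rightarrow> 'b::{real_normed_vector}"
  assumes "AE x in M. f x = 0"
  shows "f \<in> borel_measurable (completion M)"
proof (rule borel_measurableI)
  fix S :: "'b set" assume "open S"
  show "f -` S \<inter> space (completion M) \<in> sets (completion M)"
  proof (cases "0 \<in> S")
    case False
    have "Measurable.pred (completion M) (\<lambda>x. f x \<in> S)"
      using assms by (intro sets_completion_AE) (elim AE_mp, use False in \<open>auto intro!: AE_I2\<close>)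
    then show ?thesis
      by (simp add: pred_def vimage_def Int_def conj_commute)
  next
    case True
    have "Measurable.pred (completion M) (\<lambda>x. f x \<notin> S)"
      using assms by (intro sets_completion_AE) (elim AE_mp, use True in \<open>auto intro!: AE_I2\<close>)
    then have "{x \<in> space (completion M). f x \<notin> S} \<in> sets (completion M)"
      by (simp add: pred_def)
    then have "space (completion M) - {x \<in> space (completion M). f x \<notin> S} \<in> sets (completion M)"
      by (rule sets.compl_sets)
    moreover have "f -` S \<inter> space (completion M)
        = space (completion M) - {x \<in> space (completion M). f x \<notin> S}"
      by auto
    ultimately show ?thesis
      by simp
  qed
qed

lemma integrable_completion_AE_0:
  fixes f :: "'a \<Rightarrow> complex"
  assumes "AE x in M. f x = 0"
  shows "integrable (completion M) f"
proof -
  have "integrable (completion M) (\<lambda>x. 0 :: complex)"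
    by simp
  then show ?thesis
    using borel_measurable_completion_AE_0[OF assms] AE_completion[OF assms]
    by (subst integrable_cong_AE[of _ _ "\<lambda>x. 0"]) auto
qed

definition cut :: "('x \<Rightarrow> 'h ipspace) \<Rightarrow> 'x set \<Rightarrow> ('x \<Rightarrow> 'h) \<Rightarrow> 'x \<Rightarrow> 'h" where
  "cut F E u p = (if p \<in> E then u p else vzero (F p))"

text \<open>What the classical and the local direct integral share: fibrewise inner products and
  closure under the operations up to null sets, with neither completeness nor maximality. Both
  become instances, so the calculus of classes is developed once.\<close>

locale section_family =
  fixes N :: "'x measure" and F :: "'x \<Rightarrow> 'h ipspace" and K :: "('x \<Rightarrow> 'h) set"
  assumes fibre_inner: "p \<in> space N \<Longrightarrow> complex_inner_space (F p)"
    and section_mem: "\<lbrakk>u \<in> K; p \<in> space N\<rbrakk> \<Longrightarrow> u p \<in> carr (F p)"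
    and inner_integrable:
      "\<lbrakk>u \<in> K; v \<in> K\<rbrakk> \<Longrightarrow> integrable (completion N) (\<lambda>p. vinner (F p) (u p) (v p))"
    and ex_add: "\<lbrakk>u \<in> K; v \<in> K\<rbrakk> \<Longrightarrow> \<exists>w\<in>K. AE p in N. w p = vadd (F p) (u p) (v p)"
    and ex_scale: "u \<in> K \<Longrightarrow> \<exists>w\<in>K. AE p in N. w p = vscale (F p) c (u p)"
begin

abbreviation "cl \<equiv> ae_class N K"
abbreviation "E \<equiv> section_space N F K"

lemma cl_carr: "u \<in> K \<Longrightarrow> cl u \<in> carr E"
  by (simp add: section_space_def)

lemma add_cl:
  assumes "u \<in> K" "v \<in> K" "w \<in> K" "AE p in N. w p = vadd (F p) (u p) (v p)"
  shows "vadd E (cl u) (cl v) = cl w"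
proof (intro set_eqI iffI)
  fix x assume "x \<in> vadd E (cl u) (cl v)"
  then obtain u' v' where x: "x \<in> K" "AE p in N. u' p = u p" "AE p in N. v' p = v p"
    "AE p in N. x p = vadd (F p) (u' p) (v' p)"
    by (auto simp: section_space_def mem_ae_class)
  have "AE p in N. x p = w p"
    using x(2,3,4) assms(4) by eventually_elim simp
  then show "x \<in> cl w"
    using x by (simp add: mem_ae_class)
next
  fix x assume x: "x \<in> cl w"
  then have "AE p in N. x p = w p"
    by (simp add: mem_ae_class)
  then have "AE p in N. x p = vadd (F p) (u p) (v p)"
    using assms(4) by eventually_elim simp
  then show "x \<in> vadd E (cl u) (cl v)"
    using x ae_class_self[OF assms(1), of N] ae_class_self[OF assms(2), of N]
    unfolding section_space_def by (auto simp: ae_class_def[of _ _ w])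
qed

lemma scale_cl:
  assumes "u \<in> K" "w \<in> K" "AE p in N. w p = vscale (F p) c (u p)"
  shows "vscale E c (cl u) = cl w"
proof (intro set_eqI iffI)
  fix x assume "x \<in> vscale E c (cl u)"
  then obtain u' where x: "x \<in> K" "AE p in N. u' p = u p" "AE p in N. x p = vscale (F p) c (u' p)"
    by (auto simp: section_space_def mem_ae_class)
  have "AE p in N. x p = w p"
    using x(2,3) assms(3) by eventually_elim simp
  then show "x \<in> cl w"
    using x by (simp add: mem_ae_class)
next
  fix x assume x: "x \<in> cl w"
  then have "AE p in N. x p = w p"
    by (simp add: mem_ae_class)
  then have "AE p in N. x p = vscale (F p) c (u p)"
    using assms(3) by eventually_elim simp
  then show "x \<in> vscale E c (cl u)"
    using x ae_class_self[OF assms(1), of N] by (auto simp: section_space_def mem_ae_class)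
qed

text \<open>u - (a x + y) is the combination whose norms \<open>bounded_extension\<close> compares.
  It is produced both as a section and as a class.\<close>

lemma ex_comb:
  assumes "u \<in> K" "x \<in> K" "y \<in> K"
  obtains w where "w \<in> K" "AE p in N. w p = vdiff (F p) (u p) (vadd (F p) (vscale (F p) a (x p)) (y p))"
    "cl w = vdiff E (cl u) (vadd E (vscale E a (cl x)) (cl y))"
proof -
  obtain ax where ax: "ax \<in> K" "AE p in N. ax p = vscale (F p) a (x p)"
    using ex_scale assms by blast
  obtain b where b: "b \<in> K" "AE p in N. b p = vadd (F p) (ax p) (y p)"
    using ex_add[OF ax(1) assms(3)] by blast
  obtain mb where mb: "mb \<in> K" "AE p in N. mb p = vscale (F p) (-1) (b p)"
    using ex_scale[OF b(1)] by blast
  obtain w where w: "w \<in> K" "AE p in N. w p = vadd (F p) (u p) (mb p)"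
    using ex_add[OF assms(1) mb(1)] by blast
  have "AE p in N. w p = vdiff (F p) (u p) (vadd (F p) (vscale (F p) a (x p)) (y p))"
    using ax(2) b(2) mb(2) w(2) by eventually_elim (simp add: vdiff_def)
  moreover have "cl w = vdiff E (cl u) (vadd E (vscale E a (cl x)) (cl y))"
    unfolding vdiff_def
    using scale_cl[OF assms(2) ax] add_cl[OF ax(1) assms(3) b] scale_cl[OF b(1) mb]
      add_cl[OF assms(1) mb(1) w] by simp
  ultimately show ?thesis
    using that w(1) by blast
qed

lemma ex_diff:
  assumes "u \<in> K" "y \<in> K"
  obtains w where "w \<in> K" "AE p in N. w p = vdiff (F p) (u p) (y p)" "cl w = vdiff E (cl u) (cl y)"
proof -
  obtain mb where mb: "mb \<in> K" "AE p in N. mb p = vscale (F p) (-1) (y p)"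
    using ex_scale[OF assms(2)] by blast
  obtain w where w: "w \<in> K" "AE p in N. w p = vadd (F p) (u p) (mb p)"
    using ex_add[OF assms(1) mb(1)] by blast
  have "AE p in N. w p = vdiff (F p) (u p) (y p)"
    using mb(2) w(2) by eventually_elim (simp add: vdiff_def)
  moreover have "cl w = vdiff E (cl u) (cl y)"
    unfolding vdiff_def
    using scale_cl[OF assms(2) mb] add_cl[OF assms(1) mb(1) w] by simp
  ultimately show ?thesis
    using that w(1) by blast
qed

lemma inner_cl:
  assumes "u \<in> K" "v \<in> K"
  shows "vinner E (cl u) (cl v) = (LINT p|completion N. vinner (F p) (u p) (v p))"
proof -
  define u' where "u' = (SOME x. x \<in> cl u)"
  define v' where "v' = (SOME x. x \<in> cl v)"
  have "u' \<in> cl u" "v' \<in> cl v"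
    unfolding u'_def v'_def using assms ae_class_self by (metis someI)+
  then have uv: "u' \<in> K" "AE p in N. u' p = u p" "v' \<in> K" "AE p in N. v' p = v p"
    by (auto simp: mem_ae_class)
  have "AE p in N. vinner (F p) (u' p) (v' p) = vinner (F p) (u p) (v p)"
    using uv(2,4) by eventually_elim simp
  then have "(LINT p|completion N. vinner (F p) (u' p) (v' p)) = (LINT p|completion N. vinner (F p) (u p) (v p))"
    using inner_integrable assms uv by (intro integral_cong_AE) (auto intro: AE_completion)
  then show ?thesis
    by (simp add: section_space_def u'_def v'_def)
qed

lemma norm_integrable: "u \<in> K \<Longrightarrow> integrable (completion N) (\<lambda>p. (vnorm (F p) (u p))\<^sup>2)"
  and norm_cl: "u \<in> K \<Longrightarrow> (vnorm E (cl u))\<^sup>2 = (LINT p|completion N. (vnorm (F p) (u p))\<^sup>2)"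
  and norm_cl_nonneg: "u \<in> K \<Longrightarrow> 0 \<le> vnorm E (cl u)"
proof -
  assume u: "u \<in> K"
  have eq: "(vnorm (F p) (u p))\<^sup>2 = Re (vinner (F p) (u p) (u p))" if "p \<in> space (completion N)" for p
    using complex_inner_space.vnorm_power2[OF fibre_inner section_mem[OF u]] that by simp
  show int: "integrable (completion N) (\<lambda>p. (vnorm (F p) (u p))\<^sup>2)"
    using integrable_Re[OF inner_integrable[OF u u]] by (subst Bochner_Integration.integrable_cong[OF refl eq])
  have "Re (vinner E (cl u) (cl u)) = (LINT p|completion N. (vnorm (F p) (u p))\<^sup>2)"
    unfolding inner_cl[OF u u] integral_Re[OF inner_integrable[OF u u], symmetric]
    by (intro Bochner_Integration.integral_cong refl eq[symmetric])
  then show "(vnorm E (cl u))\<^sup>2 = (LINT p|completion N. (vnorm (F p) (u p))\<^sup>2)" "0 \<le> vnorm E (cl u)"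
    by (simp_all add: vnorm_def)
qed

text \<open>S is linear on classes only; here its linearity becomes an almost everywhere identity
  between arbitrarily chosen representatives of its values.\<close>

lemma linear_comb_rep:
  assumes S: "linear_map E E S" and K: "u \<in> K" "x \<in> K" "y \<in> K" "w \<in> K"
    and w: "AE p in N. w p = vdiff (F p) (u p) (vadd (F p) (vscale (F p) a (x p)) (y p))"
    and s: "su \<in> S (cl u)" "sx \<in> S (cl x)" "sy \<in> S (cl y)" "sw \<in> S (cl w)"
  shows "AE p in N. sw p = vdiff (F p) (su p) (vadd (F p) (vscale (F p) a (sx p)) (sy p))"
proof -
  have S_rep: "z' \<in> K" "S (cl z) = cl z'" if "z \<in> K" "z' \<in> S (cl z)" for z z'
  proof -
    have "S (cl z) \<in> cl ` K"
      using S that(1) by (auto simp: linear_map_def section_space_def)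
    then show "z' \<in> K" "S (cl z) = cl z'"
      using carr_rep that(2) by metis+
  qed
  obtain w' where w': "w' \<in> K" "AE p in N. w' p = vdiff (F p) (u p) (vadd (F p) (vscale (F p) a (x p)) (y p))"
    "cl w' = vdiff E (cl u) (vadd E (vscale E a (cl x)) (cl y))"
    by (rule ex_comb[OF K(1-3)])
  obtain z where z: "z \<in> K" "AE p in N. z p = vdiff (F p) (su p) (vadd (F p) (vscale (F p) a (sx p)) (sy p))"
    "cl z = vdiff E (cl su) (vadd E (vscale E a (cl sx)) (cl sy))"
    by (rule ex_comb[OF S_rep(1)[OF K(1) s(1)] S_rep(1)[OF K(2) s(2)] S_rep(1)[OF K(3) s(3)]])
  have "AE p in N. w p = w' p"
    using w w'(2) by eventually_elim simp
  then have "cl w = cl w'"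
    by (rule ae_class_eqI)
  obtain ax where ax: "ax \<in> K" "AE p in N. ax p = vscale (F p) a (x p)"
    using ex_scale K by blast
  obtain b where b: "b \<in> K" "AE p in N. b p = vadd (F p) (ax p) (y p)"
    using ex_add[OF ax(1) K(3)] by blast
  obtain mb where mb: "mb \<in> K" "AE p in N. mb p = vscale (F p) (-1) (b p)"
    using ex_scale[OF b(1)] by blast
  have S_add: "S (vadd E A B) = vadd E (S A) (S B)" if "A \<in> carr E" "B \<in> carr E" for A B
    using S that by (simp add: linear_map_def)
  have S_scale: "S (vscale E c A) = vscale E c (S A)" if "A \<in> carr E" for c A
    using S that by (simp add: linear_map_def)
  have "S (cl b) = vadd E (vscale E a (S (cl x))) (S (cl y))"
    using S_add[OF cl_carr[OF ax(1)] cl_carr[OF K(3)]] S_scale[OF cl_carr[OF K(2)], of a]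
    unfolding scale_cl[OF K(2) ax] add_cl[OF ax(1) K(3) b] by simp
  moreover have "S (cl mb) = vscale E (-1) (S (cl b))"
    using S_scale[OF cl_carr[OF b(1)], of "-1"] unfolding scale_cl[OF b(1) mb] .
  moreover have "cl w = vadd E (cl u) (cl mb)"
    unfolding \<open>cl w = cl w'\<close> w'(3) vdiff_def scale_cl[OF K(2) ax] add_cl[OF ax(1) K(3) b]
      scale_cl[OF b(1) mb] ..
  ultimately have "S (cl w) = vdiff E (S (cl u)) (vadd E (vscale E a (S (cl x))) (S (cl y)))"
    using S_add[OF cl_carr[OF K(1)] cl_carr[OF mb(1)]] by (simp add: vdiff_def)
  also have "\<dots> = cl z"
    unfolding z(3) S_rep(2)[OF K(1) s(1)] S_rep(2)[OF K(2) s(2)] S_rep(2)[OF K(3) s(3)] ..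
  finally have "sw \<in> cl z"
    using s by simp
  then have "AE p in N. sw p = z p"
    by (simp add: mem_ae_class)
  then show ?thesis
    using z(2) by eventually_elim simp
qed

end

section \<open>Operators commuting with indicator functions are decomposable\<close>

lemma (in complex_inner_space) orthogonal_vclosure:
  assumes c: "\<And>k. c k \<in> carr V" and u: "u \<in> vclosure V c" and v: "v \<in> carr V"
    and orth: "\<And>k. vinner V (c k) v = 0"
  shows "vinner V u v = 0"
proof -
  obtain f where f: "vlim V (\<lambda>n. c (f n)) u"
    using vclosure_limit[where c=c, OF c u] by blast
  have uc: "u \<in> carr V"
    using u vclosure_closed by blast
  have bound: "cmod (vinner V u v) \<le> vnorm V (vdiff V (c (f n)) u) * vnorm V v" for n
    using Cauchy_Schwarz[of "vdiff V (c (f n)) u" v] c uc v orth by simp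
  have "(\<lambda>n. vnorm V (vdiff V (c (f n)) u) * vnorm V v) \<longlonglongrightarrow> 0 * vnorm V v"
    using f unfolding vlim_def by (intro tendsto_intros)
  then have "cmod (vinner V u v) \<le> 0 * vnorm V v"
    by (rule LIMSEQ_le_const) (use bound in blast)
  then show ?thesis by simp
qed

locale direct_integral =
  fixes N :: "'x measure" and F :: "'x \<Rightarrow> 'h ipspace" and K :: "('x \<Rightarrow> 'h) set"
  assumes fibre_hilbert: "p \<in> space N \<Longrightarrow> hilbert_space (F p)"
    and classical: "classical_direct_integral N F K"

text \<open>The closure of \<open>K\<close> under sums and multiples is contained in the Hilbert
  space property of the quotient: the sum of two classes is again the class of some member of
  \<open>K\<close>, and by the definition of \<open>vadd\<close> that member agrees almost
  everywhere with the pointwise sum.\<close>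

sublocale direct_integral \<subseteq> section_family
proof (rule section_family.intro)
  have E: "complex_inner_space (section_space N F K)"
    using classical hilbert_spaceD by (auto simp: classical_direct_integral_def)
  interpret E: complex_inner_space "section_space N F K"
    by (rule E)
  fix u v :: "'x \<Rightarrow> 'h" and p :: 'x and c :: complex
  show "complex_inner_space (F p)" if "p \<in> space N"
    using fibre_hilbert that hilbert_spaceD by blast
  show "u p \<in> carr (F p)" if "u \<in> K" "p \<in> space N"
    using classical that by (auto simp: classical_direct_integral_def)
  show "integrable (completion N) (\<lambda>p. vinner (F p) (u p) (v p))" if "u \<in> K" "v \<in> K"
    using classical that by (auto simp: classical_direct_integral_def)
  have cl: "ae_class N K u \<in> carr (section_space N F K)" if "u \<in> K" for u
    using that by (simp add: section_space_def)
  show "\<exists>w\<in>K. AE p in N. w p = vadd (F p) (u p) (v p)" if "u \<in> K" "v \<in> K"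
  proof -
    have "vadd (section_space N F K) (ae_class N K u) (ae_class N K v) \<in> ae_class N K ` K"
      using E.add_closed[OF cl[OF that(1)] cl[OF that(2)]] by (simp add: carr_section_space)
    then obtain w where w: "w \<in> K" "w \<in> vadd (section_space N F K) (ae_class N K u) (ae_class N K v)"
      using carr_ex_rep by blast
    then obtain u' v' where "AE p in N. u' p = u p" "AE p in N. v' p = v p"
      "AE p in N. w p = vadd (F p) (u' p) (v' p)"
      by (auto simp: section_space_def mem_ae_class)
    then have "AE p in N. w p = vadd (F p) (u p) (v p)"
      by eventually_elim simp
    then show ?thesis
      using w by blast
  qed
  show "\<exists>w\<in>K. AE p in N. w p = vscale (F p) c (u p)" if "u \<in> K"
  proof -
    have "vscale (section_space N F K) c (ae_class N K u) \<in> ae_class N K ` K"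
      using E.scale_closed[OF cl[OF that(1)]] by (simp add: carr_section_space)
    then obtain w where w: "w \<in> K" "w \<in> vscale (section_space N F K) c (ae_class N K u)"
      using carr_ex_rep by blast
    then obtain u' where "AE p in N. u' p = u p" "AE p in N. w p = vscale (F p) c (u' p)"
      by (auto simp: section_space_def mem_ae_class)
    then have "AE p in N. w p = vscale (F p) c (u p)"
      by eventually_elim simp
    then show ?thesis
      using w by blast
  qed
qed

context direct_integral
begin

lemma E_hilbert: "hilbert_space E"
  using classical by (simp add: classical_direct_integral_def)

lemma E_inner: "complex_inner_space E"
  using E_hilbert by (rule hilbert_spaceD)

text \<open>Maximality for functions with arbitrary values off the base: restriction to
  \<open>space N\<close> changes neither the inner products over the base nor the values
  there.\<close>

lemma ex_section:
  assumes "\<And>p. p \<in> space N \<Longrightarrow> v p \<in> carr (F p)"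
    and "\<And>u. u \<in> K \<Longrightarrow> integrable (completion N) (\<lambda>p. vinner (F p) (u p) (v p))"
  shows "\<exists>w\<in>K. AE p in N. w p = v p"
proof -
  define v' where "v' = restrict v (space N)"
  have v': "v' \<in> (\<Pi>\<^sub>E p\<in>space N. carr (F p))"
    using assms(1) by (auto simp: v'_def)
  have "integrable (completion N) (\<lambda>p. vinner (F p) (u p) (v' p))" if "u \<in> K" for u
    using assms(2)[OF that] by (rule Bochner_Integration.integrable_cong[THEN iffD1, rotated -1]) (auto simp: v'_def)
  then obtain w where w: "w \<in> K" "AE p in N. w p = v' p"
    using classical v' unfolding classical_direct_integral_def by blast
  have "AE p in N. w p = v p"
    using w(2) AE_space by eventually_elim (simp add: v'_def)
  then show ?thesis
    using w by blast
qed

text \<open>Maximality supplies the section, because pairing with a cut section only multiplies an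
  integrable function by an indicator.\<close>

lemma ex_cut:
  assumes u: "u \<in> K" and B: "B \<in> sets N"
  shows "\<exists>w\<in>K. AE p in N. w p = cut F B u p"
proof (rule ex_section)
  show "cut F B u p \<in> carr (F p)" if "p \<in> space N" for p
    using that u section_mem complex_inner_space.zero_closed[OF fibre_inner] by (simp add: cut_def)
next
  fix v assume v: "v \<in> K"
  have "vinner (F p) (v p) (cut F B u p) = indicator B p *\<^sub>R vinner (F p) (v p) (u p)"
    if "p \<in> space (completion N)" for p
    using that v section_mem complex_inner_space.inner_zero_right[OF fibre_inner]
    by (simp add: cut_def indicator_def)
  then show "integrable (completion N) (\<lambda>p. vinner (F p) (v p) (cut F B u p))"
    using integrable_mult_indicator[OF _ inner_integrable[OF v u], of B] B
    by (subst Bochner_Integration.integrable_cong[OF refl]) auto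
qed

section \<open>Pointwise density of a dense sequence of sections\<close>

definition dense_sections :: "(nat \<Rightarrow> 'x \<Rightarrow> 'h) \<Rightarrow> bool" where
  "dense_sections c \<longleftrightarrow> range c \<subseteq> K \<and>
     (\<forall>u\<in>K. \<forall>e>0. \<exists>k. vnorm E (vdiff E (cl u) (cl (c k))) < e)"

lemma dense_sections_exists: "\<exists>c. dense_sections c"
proof -
  interpret E: complex_inner_space E
    by (rule E_inner)
  interpret Metric_space "carr E" "vdist E"
    by (rule E.Metric_space_vdist)
  obtain C where C: "countable C" "C \<subseteq> carr E" "mtopology closure_of C = carr E"
    using classical by (auto simp: classical_direct_integral_def separable_def separable_space_def)
  have "C \<noteq> {}"
    using C(3) E.zero_closed by force
  define A where "A = from_nat_into C"
  have A: "A k \<in> C" for k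
    unfolding A_def using \<open>C \<noteq> {}\<close> by (rule from_nat_into)
  have "\<exists>c\<in>K. A k = cl c" for k
    using A[of k] C(2) by (auto simp: carr_section_space)
  then obtain c where c: "\<And>k. c k \<in> K" "\<And>k. A k = cl (c k)"
    by metis
  have "\<exists>k. vnorm E (vdiff E (cl u) (cl (c k))) < e" if u: "u \<in> K" and e: "e > 0" for u e
  proof -
    have "cl u \<in> mtopology closure_of C"
      using C(3) cl_carr[OF u] by simp
    then obtain B where B: "B \<in> C" "vdist E (cl u) B < e"
      using e by (auto simp: metric_closure_of)
    obtain k where "B = A k"
      using from_nat_into_surj[OF C(1) B(1)] A_def by metis
    then show ?thesis
      using B(2) c cl_carr[OF u] cl_carr[OF c(1)] by (auto simp: vdist_def)
  qed
  then show ?thesis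
    using c(1) unfolding dense_sections_def by blast
qed

text \<open>The infimum over k of |u(p) - c_k(p)|^2 is measurable for the completion, and its
  integral is at most the squared norm of u - c_k for every k, hence 0. So it vanishes at almost
  every p, with no passage to subsequences.\<close>

lemma AE_in_vclosure:
  assumes dense: "dense_sections c" and u: "u \<in> K"
  shows "AE p in N. u p \<in> vclosure (F p) (\<lambda>k. c k p)"
proof -
  have c: "c k \<in> K" for k
    using dense by (auto simp: dense_sections_def)
  define g where "g k p = (vnorm (F p) (vdiff (F p) (u p) (c k p)))\<^sup>2" for k p
  have g_eq: "g k p = Re (vinner (F p) (u p) (u p) - vinner (F p) (c k p) (u p)
      - (vinner (F p) (u p) (c k p) - vinner (F p) (c k p) (c k p)))" if "p \<in> space (completion N)" for k p
  proof -
    interpret complex_inner_space "F p"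
      using that fibre_inner by simp
    show ?thesis
      unfolding g_def using section_mem[OF u, of p] section_mem[OF c, of p] that
      by (simp add: vnorm_power2)
  qed
  have g_int: "integrable (completion N) (g k)" for k
    by (subst Bochner_Integration.integrable_cong[OF refl g_eq])
       (use inner_integrable u c in \<open>auto intro!: integrable_Re Bochner_Integration.integrable_diff\<close>)
  have g_integral: "integral\<^sup>L (completion N) (g k) = (vnorm E (vdiff E (cl u) (cl (c k))))\<^sup>2" for k
  proof -
    obtain w where w: "w \<in> K" "AE p in N. w p = vdiff (F p) (u p) (c k p)"
      "cl w = vdiff E (cl u) (cl (c k))"
      by (rule ex_diff[OF u c])
    have "AE p in N. (vnorm (F p) (w p))\<^sup>2 = g k p"
      using w(2) by eventually_elim (simp add: g_def)
    then have "(LINT p|completion N. (vnorm (F p) (w p))\<^sup>2) = integral\<^sup>L (completion N) (g k)"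
      using g_int norm_integrable[OF w(1)] by (intro integral_cong_AE) (auto intro: AE_completion)
    then show ?thesis
      using norm_cl[OF w(1)] w(3) by simp
  qed
  define h where "h p = (INF k. g k p)" for p
  have bdd: "bdd_below (range (\<lambda>k. g k p))" for p
    by (rule bdd_belowI[of _ 0]) (auto simp: g_def)
  have h_le: "h p \<le> g k p" for p k
    unfolding h_def using bdd by (intro cINF_lower) auto
  have h_nonneg: "0 \<le> h p" for p
    unfolding h_def by (intro cINF_greatest) (auto simp: g_def)
  have h_meas: "h \<in> borel_measurable (completion N)"
    unfolding h_def using g_int by (intro borel_measurable_cINF_real) auto
  have h_int: "integrable (completion N) h"
    using g_int[of 0] h_meas by (rule Bochner_Integration.integrable_bound) (use h_le h_nonneg in \<open>auto simp: g_def\<close>)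
  have "integral\<^sup>L (completion N) h \<le> e" if e: "e > 0" for e
  proof -
    obtain k where k: "vnorm E (vdiff E (cl u) (cl (c k))) < sqrt e"
      using dense u e unfolding dense_sections_def by (metis real_sqrt_gt_0_iff)
    have "integral\<^sup>L (completion N) h \<le> integral\<^sup>L (completion N) (g k)"
      using h_int g_int h_le by (intro integral_mono) auto
    also have "\<dots> \<le> (sqrt e)\<^sup>2"
      unfolding g_integral
    proof (rule power_mono)
      show "0 \<le> vnorm E (vdiff E (cl u) (cl (c k)))"
        using ex_diff[OF u c] norm_cl_nonneg by metis
    qed (use k in simp)
    finally show ?thesis
      using e by simp
  qed
  then have "integral\<^sup>L (completion N) h \<le> 0"
    by (rule field_le_epsilon[where y=0, unfolded add_0])
  then have "integral\<^sup>L (completion N) h = 0"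
    using h_nonneg by (intro antisym Bochner_Integration.integral_nonneg) auto
  then have "AE p in completion N. h p = 0"
    using integral_nonneg_eq_0_iff_AE[OF h_int] h_nonneg by simp
  then have "AE p in N. h p = 0"
    by (simp add: AE_completion_iff)
  then show ?thesis
    using AE_space
  proof eventually_elim
    case (elim p)
    interpret complex_inner_space "F p"
      using elim fibre_inner by simp
    have "\<exists>k. vnorm (F p) (vdiff (F p) (u p) (c k p)) < e" if e: "e > 0" for e
    proof -
      have "\<exists>k\<in>UNIV. g k p < e\<^sup>2"
        using elim(1) e bdd unfolding h_def by (subst cINF_less_iff[symmetric]) auto
      then show ?thesis
        unfolding g_def using e power_less_imp_less_base[of _ 2 e] by auto
    qed
    then show ?case
      using section_mem[OF u] elim(2) by (simp add: vclosure_def)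
  qed
qed

lemma AE_dense:
  assumes dense: "dense_sections c"
  shows "AE p in N. vclosure (F p) (\<lambda>k. c k p) = carr (F p)"
proof -
  have c: "c k \<in> K" for k
    using dense by (auto simp: dense_sections_def)
  obtain q where q: "dense_seq q"
    using dense_seq_exists by blast
  \<comment> \<open>This makes the closure at p a subspace. Only countably many combinations occur,
    so they can be treated outside a single null set.\<close>
  define G where "G p \<longleftrightarrow> (\<forall>n j k. vadd (F p) (vscale (F p) (q n) (c j p)) (c k p)
      \<in> vclosure (F p) (\<lambda>k. c k p))" for p
  have "AE p in N. vadd (F p) (vscale (F p) (q n) (c j p)) (c k p) \<in> vclosure (F p) (\<lambda>k. c k p)" for n j k
  proof -
    obtain a where a: "a \<in> K" "AE p in N. a p = vscale (F p) (q n) (c j p)"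
      using ex_scale[OF c] by blast
    obtain w where w: "w \<in> K" "AE p in N. w p = vadd (F p) (a p) (c k p)"
      using ex_add[OF a(1) c] by blast
    show ?thesis
      using AE_in_vclosure[OF dense w(1)] a(2) w(2) by eventually_elim simp
  qed
  then have G: "AE p in N. G p"
    unfolding G_def by (simp add: AE_all_countable)
  define bad where "bad p \<longleftrightarrow> (\<exists>x\<in>carr (F p). x \<noteq> vzero (F p) \<and> (\<forall>k. vinner (F p) (c k p) x = 0))" for p
  \<comment> \<open>Zero at the good points, where pairing with any section then vanishes
    trivially.\<close>
  define v where "v p = (if bad p then SOME x. x \<in> carr (F p) \<and> x \<noteq> vzero (F p)
      \<and> (\<forall>k. vinner (F p) (c k p) x = 0) else vzero (F p))" for p
  have v_bad: "v p \<in> carr (F p)" "v p \<noteq> vzero (F p)" "vinner (F p) (c k p) (v p) = 0" if "bad p" for p k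
    using someI_ex[of "\<lambda>x. x \<in> carr (F p) \<and> x \<noteq> vzero (F p) \<and> (\<forall>k. vinner (F p) (c k p) x = 0)"] that
    by (auto simp: v_def bad_def Bex_def)
  have v: "v p \<in> carr (F p)" if "p \<in> space N" for p
    using v_bad complex_inner_space.zero_closed[OF fibre_inner[OF that]] by (cases "bad p") (auto simp: v_def)
  \<comment> \<open>Orthogonality to the c_k(p) extends to u(p), which lies in their closure at
    almost every p. The exceptional set depends on u, which does no harm: each pairing with v is
    zero almost everywhere, hence integrable for the completion.\<close>
  have orth: "AE p in N. vinner (F p) (u p) (v p) = 0" if u: "u \<in> K" for u
    using AE_in_vclosure[OF dense u] AE_space
  proof eventually_elim
    case (elim p)
    interpret complex_inner_space "F p"
      using elim fibre_inner by simp
    show ?case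
    proof (cases "bad p")
      case True
      then show ?thesis
        by (intro orthogonal_vclosure[OF section_mem[OF c elim(2)] elim(1) v[OF elim(2)]] v_bad(3))
    next
      case False
      then show ?thesis
        using section_mem[OF u elim(2)] by (simp add: v_def)
    qed
  qed
  have "integrable (completion N) (\<lambda>p. vinner (F p) (u p) (v p))" if "u \<in> K" for u
    using orth[OF that] by (rule integrable_completion_AE_0)
  then obtain w where w: "w \<in> K" "AE p in N. w p = v p"
    using ex_section[of v] v by blast
  show ?thesis
    using w(2) orth[OF w(1)] G AE_space
  proof eventually_elim
    case (elim p)
    interpret complex_inner_space "F p"
      using elim fibre_inner by simp
    have "v p = vzero (F p)"
      using elim(1,2) v[OF elim(4)] inner_definite by simp
    then have "\<not> bad p"
      using v_bad(2) by blast
    show ?case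
    proof (rule ccontr)
      assume nondense: "vclosure (F p) (\<lambda>k. c k p) \<noteq> carr (F p)"
      have "bad p"
        unfolding bad_def
        by (rule orthogonal_vector_exists[OF fibre_hilbert[OF elim(4)] _ q _ nondense])
           (use section_mem[OF c elim(4)] elim(3) G_def in auto)
      then show False
        using \<open>\<not> bad p\<close> by blast
    qed
  qed
qed

text \<open>Phrased on representatives, so that no multiplication operator has to be constructed on
  the classical direct integral.\<close>

definition commutes_with_cuts :: "(('x \<Rightarrow> 'h) set \<Rightarrow> ('x \<Rightarrow> 'h) set) \<Rightarrow> bool" where
  "commutes_with_cuts S \<longleftrightarrow> (\<forall>B\<in>sets N. \<forall>u\<in>K. \<forall>v\<in>K. (AE p in N. v p = cut F B u p) \<longrightarrow>
     (\<forall>su\<in>S (cl u). \<forall>sv\<in>S (cl v). AE p in N. sv p = cut F B su p))"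

lemma op_rep:
  assumes "S \<in> bounded_ops E" "u \<in> K" "su \<in> S (cl u)"
  shows "su \<in> K" "S (cl u) = cl su"
  using carr_rep[of "S (cl u)" N K su] bounded_ops_closed[OF assms(1) cl_carr[OF assms(2)]] assms(3)
  by (simp_all add: carr_section_space)

lemma op_ex_rep:
  assumes "S \<in> bounded_ops E" "u \<in> K"
  shows "\<exists>su. su \<in> S (cl u)"
  using carr_ex_rep[of "S (cl u)" N K] bounded_ops_closed[OF assms(1) cl_carr[OF assms(2)]]
  by (auto simp: carr_section_space)

text \<open>Otherwise cut \<^term>\<open>u\<close> down to the set where the inequality fails; that set is measurable only
  for the completion, so it is replaced by its main part.\<close>

lemma AE_pointwise_bound:
  assumes S: "S \<in> bounded_ops E" and comm: "commutes_with_cuts S"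
    and C: "0 \<le> C" "\<forall>A\<in>carr E. vnorm E (S A) \<le> C * vnorm E A"
    and u: "u \<in> K" and su: "su \<in> S (cl u)"
  shows "AE p in N. vnorm (F p) (su p) \<le> C * vnorm (F p) (u p)"
proof -
  \<comment> \<open>Negative exactly where the claimed inequality fails, since C and the norms over
    the base are nonnegative.\<close>
  define d where "d p = C\<^sup>2 * (vnorm (F p) (u p))\<^sup>2 - (vnorm (F p) (su p))\<^sup>2" for p
  have suK: "su \<in> K"
    using op_rep S u su by blast
  have d_int: "integrable (completion N) d"
    unfolding d_def using norm_integrable u suK by auto
  define B where "B = {p \<in> space (completion N). d p < 0}"
  have "B \<in> sets (completion N)"
    unfolding B_def using d_int by measurable
  then obtain A n n' where An: "B = A \<union> n" "n \<subseteq> n'" "n' \<in> null_sets N" "A \<in> sets N"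
    by (rule sets_completionE)
  obtain v where v: "v \<in> K" "AE p in N. v p = cut F A u p"
    using ex_cut[OF u An(4)] by blast
  obtain sv where sv: "sv \<in> S (cl v)"
    using op_ex_rep[OF S v(1)] by blast
  have svK: "sv \<in> K" "S (cl v) = cl sv"
    using op_rep S v(1) sv by blast+
  have sv_cut: "AE p in N. sv p = cut F A su p"
    using comm An(4) u v su sv unfolding commutes_with_cuts_def by blast
  have norm_cut: "(LINT p|completion N. (vnorm (F p) (y p))\<^sup>2)
      = (LINT p|completion N. indicator A p *\<^sub>R (vnorm (F p) (x p))\<^sup>2)"
    if "x \<in> K" "y \<in> K" "AE p in N. y p = cut F A x p" for x y
  proof (rule integral_cong_AE)
    have "AE p in N. (vnorm (F p) (y p))\<^sup>2 = indicator A p *\<^sub>R (vnorm (F p) (x p))\<^sup>2"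
      using that(3) AE_space
      by eventually_elim (simp add: cut_def indicator_def complex_inner_space.vnorm_zero[OF fibre_inner])
    then show "AE p in completion N. (vnorm (F p) (y p))\<^sup>2 = indicator A p *\<^sub>R (vnorm (F p) (x p))\<^sup>2"
      by (rule AE_completion)
    show "(\<lambda>p. indicator A p *\<^sub>R (vnorm (F p) (x p))\<^sup>2) \<in> borel_measurable (completion N)"
      using integrable_mult_indicator[OF _ norm_integrable[OF that(1)], of A] An(4) by auto
  qed (use norm_integrable that in auto)
  have A_int: "integrable (completion N) (\<lambda>p. indicator A p *\<^sub>R (vnorm (F p) (x p))\<^sup>2)" if "x \<in> K" for x
    using integrable_mult_indicator[OF _ norm_integrable[OF that], of A] An(4) by auto
  have "(vnorm E (cl sv))\<^sup>2 \<le> (C * vnorm E (cl v))\<^sup>2"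
    using bspec[OF C(2) cl_carr[OF v(1)]] svK norm_cl_nonneg by (intro power_mono) auto
  then have "(LINT p|completion N. indicator A p *\<^sub>R (vnorm (F p) (su p))\<^sup>2)
      \<le> C\<^sup>2 * (LINT p|completion N. indicator A p *\<^sub>R (vnorm (F p) (u p))\<^sup>2)"
    using norm_cl[OF svK(1)] norm_cl[OF v(1)] norm_cut[OF u v] norm_cut[OF suK svK(1) sv_cut]
    by (simp add: power_mult_distrib)
  also have "\<dots> = (LINT p|completion N. C\<^sup>2 * (indicator A p *\<^sub>R (vnorm (F p) (u p))\<^sup>2))"
    by simp
  finally have "(LINT p|completion N. indicator A p *\<^sub>R (vnorm (F p) (su p))\<^sup>2)
      - (LINT p|completion N. C\<^sup>2 * (indicator A p *\<^sub>R (vnorm (F p) (u p))\<^sup>2)) \<le> 0"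
    by linarith
  then have "(LINT p|completion N. indicator A p *\<^sub>R (vnorm (F p) (su p))\<^sup>2
      - C\<^sup>2 * (indicator A p *\<^sub>R (vnorm (F p) (u p))\<^sup>2)) \<le> 0"
    using A_int[OF u] A_int[OF suK] by (subst Bochner_Integration.integral_diff) auto
  \<comment> \<open>The norm bound for S on the cut section says that -d has integral at most 0 over
    A, although -d is positive there. This forces the integrand to vanish almost everywhere.\<close>
  then have le0: "(LINT p|completion N. - (indicator A p *\<^sub>R d p)) \<le> 0"
    by (simp add: d_def algebra_simps)
  have "d p \<le> 0" if "p \<in> A" for p
    using that An(1) unfolding B_def by (metis (mono_tags, lifting) UnI1 less_imp_le mem_Collect_eq)
  then have nonneg: "0 \<le> - (indicator A p *\<^sub>R d p)" for p
    by (auto simp: indicator_def)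
  have int: "integrable (completion N) (\<lambda>p. - (indicator A p *\<^sub>R d p))"
    using integrable_mult_indicator[OF _ d_int, of A] An(4) by auto
  have "(LINT p|completion N. - (indicator A p *\<^sub>R d p)) = 0"
    using le0 nonneg by (intro antisym Bochner_Integration.integral_nonneg) auto
  then have "AE p in completion N. - (indicator A p *\<^sub>R d p) = 0"
    using integral_nonneg_eq_0_iff_AE[OF int] nonneg by simp
  then have "AE p in N. - (indicator A p *\<^sub>R d p) = 0"
    by (simp only: AE_completion_iff)
  then show ?thesis
    using AE_not_in[OF An(3)] AE_space
  proof eventually_elim
    case (elim p)
    interpret complex_inner_space "F p"
      using elim fibre_inner by simp
    have "\<not> d p < 0"
    proof
      assume neg: "d p < 0"
      then have "p \<in> A"
        using elim An(1,2) by (auto simp: B_def)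
      then show False
        using elim(1) neg by simp
    qed
    then have "(vnorm (F p) (su p))\<^sup>2 \<le> (C * vnorm (F p) (u p))\<^sup>2"
      by (simp add: d_def power_mult_distrib)
    then show ?case
      using C(1) section_mem[OF u elim(3)] power2_le_imp_le by (metis mult_nonneg_nonneg vnorm_nonneg)
  qed
qed

theorem commutes_with_cuts_decomposable:
  assumes S: "S \<in> bounded_ops E" and comm: "commutes_with_cuts S"
  shows "S \<in> decomposable_ops N F K"
proof -
  obtain C' where C': "\<And>A. A \<in> carr E \<Longrightarrow> vnorm E (S A) \<le> C' * vnorm E A"
    using S by (auto simp: bounded_ops_def bounded_on_def)
  \<comment> \<open>\<open>bounded_on\<close> does not make its constant nonnegative, as the
    pointwise bound requires.\<close>
  define C where "C = \<bar>C'\<bar>"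
  have C0: "0 \<le> C"
    by (simp add: C_def)
  have C: "\<forall>A\<in>carr E. vnorm E (S A) \<le> C * vnorm E A"
  proof
    fix A assume A: "A \<in> carr E"
    have "C' * vnorm E A \<le> C * vnorm E A"
      using complex_inner_space.vnorm_nonneg[OF E_inner A] by (intro mult_right_mono) (auto simp: C_def)
    then show "vnorm E (S A) \<le> C * vnorm E A"
      using C'[OF A] by simp
  qed
  have lin: "linear_map E E S"
    using S by (simp add: bounded_ops_def)
  obtain c where dense: "dense_sections c"
    using dense_sections_exists by blast
  have c: "c k \<in> K" for k
    using dense by (auto simp: dense_sections_def)
  have "\<exists>s. s \<in> S (cl (c k))" for k
    using op_ex_rep[OF S c] .
  then obtain s where s: "\<And>k. s k \<in> S (cl (c k))"
    by metis
  have sK: "s k \<in> K" for k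
    using op_rep[OF S c s] by blast
  obtain q where q: "dense_seq q"
    using dense_seq_exists by blast
  \<comment> \<open>Stated for an arbitrary section u: the case u = c_l feeds the construction of
    the fibre operators, the general case identifies their values at u(p).\<close>
  have bound: "AE p in N. vnorm (F p) (vdiff (F p) (su p) (vadd (F p) (vscale (F p) a (s j p)) (s k p)))
      \<le> C * vnorm (F p) (vdiff (F p) (u p) (vadd (F p) (vscale (F p) a (c j p)) (c k p)))"
    if u: "u \<in> K" and su: "su \<in> S (cl u)" for u su a j k
  proof -
    obtain w where w: "w \<in> K"
      "AE p in N. w p = vdiff (F p) (u p) (vadd (F p) (vscale (F p) a (c j p)) (c k p))"
      by (rule ex_comb[OF u c[of j] c[of k]])
    obtain sw where sw: "sw \<in> S (cl w)"
      using op_ex_rep[OF S w(1)] by blast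
    have "AE p in N. sw p = vdiff (F p) (su p) (vadd (F p) (vscale (F p) a (s j p)) (s k p))"
      by (rule linear_comb_rep[OF lin u c c w su s s sw])
    with AE_pointwise_bound[OF S comm C0 C w(1) sw] w(2) show ?thesis
      by eventually_elim simp
  qed
  have "AE p in N. \<forall>n j k l. vnorm (F p) (vdiff (F p) (s l p) (vadd (F p) (vscale (F p) (q n) (s j p)) (s k p)))
      \<le> C * vnorm (F p) (vdiff (F p) (c l p) (vadd (F p) (vscale (F p) (q n) (c j p)) (c k p)))"
    using bound[OF c s] by (simp add: AE_all_countable)
  then have ext: "AE p in N. \<exists>t\<in>bounded_ops (F p). \<forall>x\<in>carr (F p). \<forall>k.
      vnorm (F p) (vdiff (F p) (t x) (s k p)) \<le> C * vnorm (F p) (vdiff (F p) x (c k p))"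
    using AE_dense[OF dense] AE_space
  proof eventually_elim
    case (elim p)
    interpret complex_inner_space "F p"
      using elim fibre_inner by simp
    show ?case
      by (rule bounded_extension[OF fibre_hilbert[OF elim(3)] _ _ q elim(2) C0])
         (use elim section_mem c sK in auto)
  qed
  define P where "P p t \<longleftrightarrow> t \<in> bounded_ops (F p) \<and> (\<forall>x\<in>carr (F p). \<forall>k.
      vnorm (F p) (vdiff (F p) (t x) (s k p)) \<le> C * vnorm (F p) (vdiff (F p) x (c k p)))" for p t
  \<comment> \<open>The zero operator serves at the exceptional points: \<open>decomposed_by\<close>
    asks for a bounded operator at every point of the base, not only at almost every one.\<close>
  define t where "t p = (if \<exists>t. P p t then SOME t. P p t else (\<lambda>x\<in>carr (F p). vzero (F p)))" for p
  have t: "P p (t p)" if "\<exists>t. P p t" for p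
    using someI_ex[OF that] that by (simp add: t_def)
  have "t p \<in> bounded_ops (F p)" if p: "p \<in> space N" for p
  proof (cases "\<exists>t. P p t")
    case False
    interpret complex_inner_space "F p"
      using p fibre_inner by simp
    show ?thesis
      using False by (intro bounded_opsI[where C=0]) (auto simp: t_def add_zero scale_vzero)
  qed (use t P_def in blast)
  moreover have "AE p in N. w p = t p (u p)" if A: "A \<in> carr E" "u \<in> A" "w \<in> S A" for A u w
  proof -
    have u: "u \<in> K" "A = cl u"
      using carr_rep[of A N K u] A by (simp_all add: carr_section_space)
    have w: "w \<in> S (cl u)" "w \<in> K"
      using A u op_rep[OF S u(1)] by auto
    \<comment> \<open>With coefficient 0 and j = k the combination is c_k(p) itself, so these are
      the inequalities that determine \<open>t p (u p)\<close>.\<close>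
    have "AE p in N. \<forall>k. vnorm (F p) (vdiff (F p) (w p) (vadd (F p) (vscale (F p) 0 (s k p)) (s k p)))
        \<le> C * vnorm (F p) (vdiff (F p) (u p) (vadd (F p) (vscale (F p) 0 (c k p)) (c k p)))"
      using bound[OF u(1) w(1)] by (simp add: AE_all_countable)
    then show ?thesis
      using ext AE_dense[OF dense] AE_space
    proof eventually_elim
      case (elim p)
      interpret complex_inner_space "F p"
        using elim fibre_inner by simp
      have *: "vadd (F p) (vscale (F p) 0 x) x = x" if "x \<in> carr (F p)" for x
        by (rule vec_eqI) (use that in auto)
      have mem: "u p \<in> carr (F p)" "w p \<in> carr (F p)" "\<And>k. c k p \<in> carr (F p)" "\<And>k. s k p \<in> carr (F p)"
        using section_mem elim(4) u w c sK by auto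
      have P: "P p (t p)"
        using t elim(2) P_def by blast
      show ?case
      proof (rule extension_unique[where c="\<lambda>k. c k p" and s="\<lambda>k. s k p" and x="u p" and C=C])
        show "t p (u p) \<in> carr (F p)"
          using bounded_ops_closed[of "t p" "F p" "u p"] P mem(1) by (simp add: P_def)
        show "vnorm (F p) (vdiff (F p) (w p) (s k p)) \<le> C * vnorm (F p) (vdiff (F p) (u p) (c k p))" for k
          using elim(1) mem * by simp
        show "vnorm (F p) (vdiff (F p) (t p (u p)) (s k p)) \<le> C * vnorm (F p) (vdiff (F p) (u p) (c k p))" for k
          using P mem(1) unfolding P_def by simp
      qed (use mem elim(3) in simp_all)
    qed
  qed
  ultimately show ?thesis
    using S unfolding decomposable_ops_def decomposed_by_def acts_fibrewise_def by blast
qed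

end

section \<open>Null sets of the projective limit measure\<close>

locale locally_standard =
  fixes M :: "'i::order \<Rightarrow> 'x measure" and \<mu> :: "'x measure"
  assumes directed: "\<exists>\<gamma>::'i. \<alpha> \<le> \<gamma> \<and> \<beta> \<le> \<gamma>"
    and base: "locally_standard_measure_space M \<mu>"
begin

text \<open>On a mere order \<open>at_top\<close> is an infimum of principal filters; directedness
  makes the up-sets a base, so that it is the filter of tails of a net. It also shows that the
  filter is proper, so limits inherit eventual lower bounds.\<close>

lemma eventually_at_top_directed: "eventually P (at_top :: 'i filter) \<longleftrightarrow> (\<exists>k. \<forall>n\<ge>k. P n)"
  unfolding at_top_def
proof (subst eventually_INF_base)
  fix a b :: 'i
  obtain c where "a \<le> c" "b \<le> c"
    using directed by blast
  then show "\<exists>x\<in>UNIV. principal {x..} \<le> inf (principal {a..}) (principal {b..})"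
    by (auto intro!: exI[of _ c])
qed (auto simp: eventually_principal)

lemma finite_M: "finite_measure (M \<alpha>)"
  using base by (simp add: locally_standard_measure_space_def standard_measure_space_def)

lemma space_mono: "\<alpha> \<le> \<beta> \<Longrightarrow> space (M \<alpha>) \<subseteq> space (M \<beta>)"
  and sets_mono: "\<alpha> \<le> \<beta> \<Longrightarrow> sets (M \<alpha>) \<subseteq> sets (M \<beta>)"
  and sets_trace: "\<alpha> \<le> \<beta> \<Longrightarrow> sets (M \<alpha>) = {B \<inter> space (M \<alpha>) | B. B \<in> sets (M \<beta>)}"
  using base unfolding locally_standard_measure_space_def inductive_measurable_system_def by blast+

lemma measure_M_eq: "\<lbrakk>\<alpha> \<le> \<beta>; B \<in> sets (M \<alpha>)\<rbrakk> \<Longrightarrow> measure (M \<alpha>) B = measure (M \<beta>) B"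
  using base by (simp add: locally_standard_measure_space_def projective_measure_system_def measure_def)

lemma space_limit: "space \<mu> = (\<Union>\<alpha>. space (M \<alpha>))"
  using base by (simp add: locally_standard_measure_space_def limit_measure_def)

lemma space_sub: "space (M \<alpha>) \<subseteq> space \<mu>"
  using space_limit by auto

lemma sets_limit: "B \<in> sets \<mu> \<longleftrightarrow> B \<subseteq> space \<mu> \<and> (\<forall>\<alpha>. B \<inter> space (M \<alpha>) \<in> sets (M \<alpha>))"
  using base unfolding locally_standard_measure_space_def limit_measure_def by simp

lemma emeasure_limit:
  assumes "B \<in> sets \<mu>"
  shows "((\<lambda>\<alpha>. measure (M \<alpha>) (B \<inter> space (M \<alpha>))) \<longlongrightarrow> l) at_top \<Longrightarrow> emeasure \<mu> B = ennreal l"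
    and "(\<nexists>l. ((\<lambda>\<alpha>. measure (M \<alpha>) (B \<inter> space (M \<alpha>))) \<longlongrightarrow> l) at_top) \<Longrightarrow> emeasure \<mu> B = \<infinity>"
  using base assms unfolding locally_standard_measure_space_def limit_measure_def Let_def by blast+

lemma sets_M_trace:
  assumes "B \<in> sets (M \<alpha>)"
  shows "B \<inter> space (M \<beta>) \<in> sets (M \<beta>)"
proof -
  obtain \<delta> where "\<alpha> \<le> \<delta>" "\<beta> \<le> \<delta>"
    using directed by blast
  then show ?thesis
    using assms sets_mono sets_trace by blast
qed

lemma sets_sub: "sets (M \<alpha>) \<subseteq> sets \<mu>"
  using sets_M_trace sets.sets_into_space space_sub by (fastforce simp: sets_limit)

lemma measure_trace_mono:
  assumes B: "B \<in> sets \<mu>" and le: "\<alpha> \<le> \<beta>"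
  shows "measure (M \<alpha>) (B \<inter> space (M \<alpha>)) \<le> measure (M \<beta>) (B \<inter> space (M \<beta>))"
proof -
  have "measure (M \<alpha>) (B \<inter> space (M \<alpha>)) = measure (M \<beta>) (B \<inter> space (M \<alpha>))"
    using measure_M_eq[OF le] B sets_limit by blast
  also have "\<dots> \<le> measure (M \<beta>) (B \<inter> space (M \<beta>))"
    using B sets_limit space_mono[OF le] by (intro finite_measure.finite_measure_mono finite_M) auto
  finally show ?thesis .
qed

text \<open>The measures of the traces increase along the net, so each is at most the limit.
  Divergence is excluded because it would give infinite measure.\<close>

lemma null_sets_trace:
  assumes "B \<in> null_sets \<mu>"
  shows "B \<inter> space (M \<alpha>) \<in> null_sets (M \<alpha>)"
proof -
  have B: "B \<in> sets \<mu>" "emeasure \<mu> B = 0"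
    using assms by auto
  let ?m = "\<lambda>\<alpha>. measure (M \<alpha>) (B \<inter> space (M \<alpha>))"
  obtain l where l: "(?m \<longlongrightarrow> l) at_top"
    using emeasure_limit(2)[OF B(1)] B(2) by fastforce
  then have "ennreal l = 0"
    using emeasure_limit(1)[OF B(1)] B(2) by simp
  then have "l \<le> 0"
    by (simp add: ennreal_eq_0_iff)
  have "(at_top :: 'i filter) \<noteq> bot"
    using eventually_at_top_directed[of "\<lambda>_. False"] by (auto simp: trivial_limit_def)
  moreover have "eventually (\<lambda>\<beta>. ?m \<alpha> \<le> ?m \<beta>) at_top"
    using measure_trace_mono[OF B(1)] by (auto simp: eventually_at_top_directed)
  ultimately have "?m \<alpha> \<le> l"
    using l tendsto_lowerbound by blast
  then have "?m \<alpha> = 0"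
    using \<open>l \<le> 0\<close> by (metis measure_nonneg order_antisym order_trans)
  then show ?thesis
    using B(1) sets_limit finite_measure.emeasure_eq_measure[OF finite_M] by (auto simp: null_sets_def)
qed

text \<open>Comparison at a common upper index shows that all traces of B are null, so the net
  defining its limit measure is constantly 0.\<close>

lemma null_sets_limit:
  assumes "B \<in> null_sets (M \<alpha>)"
  shows "B \<in> null_sets \<mu>"
proof -
  have B: "B \<in> sets (M \<alpha>)" "measure (M \<alpha>) B = 0"
    using assms by (auto simp: measure_def)
  have "measure (M \<beta>) (B \<inter> space (M \<beta>)) = 0" for \<beta>
  proof -
    obtain \<delta> where \<delta>: "\<alpha> \<le> \<delta>" "\<beta> \<le> \<delta>"
      using directed by blast
    have "measure (M \<beta>) (B \<inter> space (M \<beta>)) = measure (M \<delta>) (B \<inter> space (M \<beta>))"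
      using measure_M_eq[OF \<delta>(2)] sets_M_trace[OF B(1)] by blast
    also have "\<dots> \<le> measure (M \<delta>) B"
      using sets_mono[OF \<delta>(1)] B(1) by (intro finite_measure.finite_measure_mono finite_M) auto
    also have "\<dots> = 0"
      using measure_M_eq[OF \<delta>(1) B(1)] B(2) by simp
    finally show ?thesis
      by (metis measure_nonneg order_antisym)
  qed
  then have "emeasure \<mu> B = ennreal 0"
    using sets_sub B(1) by (intro emeasure_limit) auto
  then show ?thesis
    using sets_sub B(1) by auto
qed

lemma AE_M: "AE p in \<mu>. P p \<Longrightarrow> AE p in M \<alpha>. P p"
proof -
  assume "AE p in \<mu>. P p"
  then obtain B where B: "{p \<in> space \<mu>. \<not> P p} \<subseteq> B" "B \<in> null_sets \<mu>"
    by (auto simp: eventually_ae_filter)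
  then have "{p \<in> space (M \<alpha>). \<not> P p} \<subseteq> B \<inter> space (M \<alpha>)"
    using space_sub by auto
  then show ?thesis
    using null_sets_trace[OF B(2), of \<alpha>] unfolding eventually_ae_filter by blast
qed

text \<open>Almost everywhere for \<open>M \<alpha>\<close> says nothing outside its space, hence
  the second premise. Sections of level \<alpha> typically meet it because they vanish
  there.\<close>

lemma AE_limit:
  assumes "AE p in M \<alpha>. P p" "\<And>p. \<lbrakk>p \<in> space \<mu>; p \<notin> space (M \<alpha>)\<rbrakk> \<Longrightarrow> P p"
  shows "AE p in \<mu>. P p"
proof -
  obtain B where B: "{p \<in> space (M \<alpha>). \<not> P p} \<subseteq> B" "B \<in> null_sets (M \<alpha>)"
    using assms(1) by (auto simp: eventually_ae_filter)
  then have "{p \<in> space \<mu>. \<not> P p} \<subseteq> B"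
    using assms(2) by auto
  then show ?thesis
    using null_sets_limit[OF B(2)] by (auto simp: eventually_ae_filter)
qed

end

section \<open>The levels of the direct integral\<close>

locale loc_direct_integral_setting = locally_standard M \<mu>
  for M :: "'i::order \<Rightarrow> 'x measure" and \<mu> :: "'x measure" +
  fixes D :: "'x \<Rightarrow> 'h ipspace"
    and H :: "'i \<Rightarrow> 'x \<Rightarrow> 'h set"
    and U :: "('x \<Rightarrow> 'h) set"
    and K :: "'i \<Rightarrow> ('x \<Rightarrow> 'h) set"
  assumes fibres: "p \<in> space \<mu> \<Longrightarrow> locally_hilbert (D p) (\<lambda>\<alpha>. H \<alpha> p)"
    and integral: "loc_direct_integral M \<mu> D H U"
    and classical: "classical_direct_integral (M \<alpha>) (fibre D H \<alpha>) (K \<alpha>)"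
    and V_unitary: "unitary_map (level_space M \<mu> D H U \<alpha>) (level_classical M D H K \<alpha>) (V_map M K \<alpha>)"
begin

abbreviation "EU \<equiv> section_space \<mu> D U"
abbreviation "clU \<equiv> ae_class \<mu> U"
abbreviation "EK \<equiv> level_classical M D H K"
abbreviation "clK \<alpha> \<equiv> ae_class (M \<alpha>) (K \<alpha>)"
abbreviation "level \<equiv> integral_level M \<mu> D H U"
abbreviation "V \<equiv> V_map M K"

text \<open>Sections rather than classes, in contrast to \<open>integral_level\<close>; pointwise
  arguments are carried out on these.\<close>

definition lev :: "'i \<Rightarrow> ('x \<Rightarrow> 'h) set" where
  "lev \<alpha> = {u \<in> U. supported_at M \<mu> D H \<alpha> u}"

lemma level_eq: "level \<alpha> = clU ` lev \<alpha>"
  by (simp add: integral_level_def lev_def)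

lemma lev_U: "u \<in> lev \<alpha> \<Longrightarrow> u \<in> U"
  by (simp add: lev_def)

lemma fibre_inner: "p \<in> space \<mu> \<Longrightarrow> complex_inner_space (D p)"
  using fibres by (simp add: locally_hilbert_def)

lemma U_mem: "\<lbrakk>u \<in> U; p \<in> space \<mu>\<rbrakk> \<Longrightarrow> u p \<in> carr (D p)"
  using integral by (auto simp: loc_direct_integral_def)

lemma H_mono: "\<lbrakk>p \<in> space \<mu>; \<alpha> \<le> \<beta>; x \<in> H \<alpha> p\<rbrakk> \<Longrightarrow> x \<in> H \<beta> p"
  using fibres[of p] by (auto simp: locally_hilbert_def)

lemma H_sub: "\<lbrakk>p \<in> space \<mu>; x \<in> H \<alpha> p\<rbrakk> \<Longrightarrow> x \<in> carr (D p)"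
  using fibres[of p] by (auto simp: locally_hilbert_def)

lemma fibre_hilbert: "p \<in> space \<mu> \<Longrightarrow> hilbert_space (fibre D H \<alpha> p)"
  by (rule locally_hilbert_fibre[of D p H, OF fibres])

lemma H_zero: "p \<in> space \<mu> \<Longrightarrow> vzero (D p) \<in> H \<alpha> p"
  using complex_inner_space.zero_closed[OF hilbert_spaceD[OF fibre_hilbert]] by simp

lemma H_scale: "\<lbrakk>p \<in> space \<mu>; x \<in> H \<alpha> p\<rbrakk> \<Longrightarrow> vscale (D p) c x \<in> H \<alpha> p"
  using complex_inner_space.scale_closed[OF hilbert_spaceD[OF fibre_hilbert]] by simp

lemma direct_integral_K: "direct_integral (M \<alpha>) (fibre D H \<alpha>) (K \<alpha>)"
  using fibre_hilbert classical space_sub[of \<alpha>] by (intro direct_integral.intro) auto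

lemma lev_mono:
  assumes "\<alpha> \<le> \<beta>" "u \<in> lev \<alpha>"
  shows "u \<in> lev \<beta>"
proof -
  have u: "u \<in> U" "{p \<in> space \<mu>. u p \<noteq> vzero (D p)} \<subseteq> space (M \<alpha>)"
    "AE p in \<mu>. p \<in> space (M \<alpha>) \<longrightarrow> u p \<in> H \<alpha> p"
    using assms(2) by (auto simp: lev_def supported_at_def)
  \<comment> \<open>At points of the larger space outside \<open>space (M \<alpha>)\<close> the
    value is zero, which lies in every \<open>H \<beta> p\<close>.\<close>
  have "AE p in \<mu>. p \<in> space (M \<beta>) \<longrightarrow> u p \<in> H \<beta> p"
    using u(3) AE_space
  proof eventually_elim
    case (elim p)
    then show ?case
      using u(2) H_zero H_mono[OF _ assms(1)] by (cases "u p = vzero (D p)") auto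
  qed
  then show ?thesis
    using u space_mono[OF assms(1)] by (auto simp: lev_def supported_at_def)
qed

lemma level_mono: "\<alpha> \<le> \<beta> \<Longrightarrow> level \<alpha> \<subseteq> level \<beta>"
  using lev_mono by (auto simp: level_eq)

lemma common_lev:
  assumes "u \<in> U" "v \<in> U"
  obtains \<alpha> where "u \<in> lev \<alpha>" "v \<in> lev \<alpha>"
proof -
  have "\<exists>\<alpha>. u \<in> lev \<alpha>" if "u \<in> U" for u
    using integral that by (simp add: loc_direct_integral_def lev_def)
  then obtain \<alpha> \<beta> where "u \<in> lev \<alpha>" "v \<in> lev \<beta>"
    using assms by metis
  then show ?thesis
    using that directed[of \<alpha> \<beta>] lev_mono by blast
qed

lemma lev_outside: "\<lbrakk>u \<in> lev \<alpha>; p \<in> space \<mu>; p \<notin> space (M \<alpha>)\<rbrakk> \<Longrightarrow> u p = vzero (D p)"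
  by (auto simp: lev_def supported_at_def)

lemma level_space_simps [simp]:
  "carr (level_space M \<mu> D H U \<alpha>) = level \<alpha>"
  "vadd (level_space M \<mu> D H U \<alpha>) = vadd EU"
  "vscale (level_space M \<mu> D H U \<alpha>) = vscale EU"
  "vinner (level_space M \<mu> D H U \<alpha>) = vinner EU"
  by (simp_all add: level_space_def)

lemma carr_EK: "carr (EK \<alpha>) = clK \<alpha> ` K \<alpha>"
  by (simp add: level_classical_def carr_section_space)

lemma V_linear:
  "A \<in> level \<alpha> \<Longrightarrow> V \<alpha> A \<in> carr (EK \<alpha>)"
  "\<lbrakk>A \<in> level \<alpha>; B \<in> level \<alpha>\<rbrakk> \<Longrightarrow> V \<alpha> (vadd EU A B) = vadd (EK \<alpha>) (V \<alpha> A) (V \<alpha> B)"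
  "A \<in> level \<alpha> \<Longrightarrow> V \<alpha> (vscale EU c A) = vscale (EK \<alpha>) c (V \<alpha> A)"
  using V_unitary[of \<alpha>] by (auto simp: unitary_map_def linear_map_def)

lemma V_surj: "V \<alpha> ` level \<alpha> = carr (EK \<alpha>)"
  using V_unitary[of \<alpha>] by (simp add: unitary_map_def)

lemma V_inner: "\<lbrakk>A \<in> level \<alpha>; B \<in> level \<alpha>\<rbrakk> \<Longrightarrow> vinner (EK \<alpha>) (V \<alpha> A) (V \<alpha> B) = vinner EU A B"
  using V_unitary[of \<alpha>] by (simp add: unitary_map_def)

lemma V_norm: "A \<in> level \<alpha> \<Longrightarrow> vnorm (EK \<alpha>) (V \<alpha> A) = vnorm EU A"
  by (simp add: vnorm_def V_inner)

lemma V_clU_rep: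
  assumes "u \<in> lev \<alpha>" "v \<in> V \<alpha> (clU u)"
  shows "v \<in> K \<alpha>" "AE p in M \<alpha>. v p = u p"
proof -
  obtain u' where u': "AE p in \<mu>. u' p = u p" "AE p in M \<alpha>. v p = u' p" and v: "v \<in> K \<alpha>"
    using assms(2) by (auto simp: V_map_def mem_ae_class)
  show "AE p in M \<alpha>. v p = u p"
    using u'(2) AE_M[OF u'(1)] by eventually_elim simp
  show "v \<in> K \<alpha>"
    by (rule v)
qed

lemma restrict_lev:
  assumes u: "u \<in> lev \<alpha>"
  obtains v where "v \<in> K \<alpha>" "AE p in M \<alpha>. v p = u p" "V \<alpha> (clU u) = clK \<alpha> v"
proof -
  have "V \<alpha> (clU u) \<in> clK \<alpha> ` K \<alpha>"
    using V_linear(1)[of "clU u" \<alpha>] u by (simp add: carr_EK level_eq)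
  then obtain v where v: "v \<in> V \<alpha> (clU u)" "V \<alpha> (clU u) = clK \<alpha> v"
    using carr_ex_rep by metis
  show ?thesis
    by (rule that[OF V_clU_rep[OF u v(1)] v(2)])
qed

text \<open>Surjectivity of \<open>V \<alpha>\<close> takes the place of extension by zero, since
  the zero extension of v need not itself belong to \<open>U\<close>.\<close>

lemma lift_K:
  assumes v: "v \<in> K \<alpha>"
  obtains u where "u \<in> lev \<alpha>" "AE p in M \<alpha>. v p = u p" "V \<alpha> (clU u) = clK \<alpha> v"
proof -
  have "clK \<alpha> v \<in> V \<alpha> ` level \<alpha>"
    using V_surj v by (auto simp: carr_EK)
  then obtain u where u: "u \<in> lev \<alpha>" "V \<alpha> (clU u) = clK \<alpha> v"
    by (auto simp: level_eq)
  then have "v \<in> V \<alpha> (clU u)"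
    using ae_class_self[OF v] by simp
  then show ?thesis
    by (intro that[OF u(1) V_clU_rep(2)[OF u(1)] u(2)])
qed

lemma lev_eqI:
  assumes "u \<in> lev \<alpha>" "v \<in> lev \<alpha>" "AE p in M \<alpha>. u p = v p"
  shows "AE p in \<mu>. u p = v p"
  using assms(3) by (rule AE_limit) (simp add: lev_outside[OF assms(1)] lev_outside[OF assms(2)])

lemma V_clU:
  assumes u: "u \<in> lev \<alpha>" and v: "v \<in> K \<alpha>" "AE p in M \<alpha>. v p = u p"
  shows "V \<alpha> (clU u) = clK \<alpha> v"
proof -
  obtain v' where v': "v' \<in> K \<alpha>" "AE p in M \<alpha>. v' p = u p" "V \<alpha> (clU u) = clK \<alpha> v'"
    by (rule restrict_lev[OF u])
  have "AE p in M \<alpha>. v' p = v p"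
    using v'(2) v(2) by eventually_elim simp
  then show ?thesis
    using v'(3) ae_class_eqI by metis
qed

text \<open>Restrict to the classical direct integral, add there and lift the result back; off
  \<open>space (M \<alpha>)\<close> all sections involved vanish. Multiples and cuts are obtained in
  the same way.\<close>

lemma lev_add:
  assumes u: "u \<in> lev \<alpha>" and v: "v \<in> lev \<alpha>"
  shows "\<exists>w\<in>lev \<alpha>. AE p in \<mu>. w p = vadd (D p) (u p) (v p)"
proof -
  interpret A: direct_integral "M \<alpha>" "fibre D H \<alpha>" "K \<alpha>"
    by (rule direct_integral_K)
  obtain u' where u': "u' \<in> K \<alpha>" "AE p in M \<alpha>. u' p = u p"
    by (rule restrict_lev[OF u])
  obtain v' where v': "v' \<in> K \<alpha>" "AE p in M \<alpha>. v' p = v p"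
    by (rule restrict_lev[OF v])
  obtain w' where w': "w' \<in> K \<alpha>" "AE p in M \<alpha>. w' p = vadd (D p) (u' p) (v' p)"
    using A.ex_add[OF u'(1) v'(1)] by auto
  obtain w where w: "w \<in> lev \<alpha>" "AE p in M \<alpha>. w' p = w p"
    by (rule lift_K[OF w'(1)])
  have "AE p in M \<alpha>. w p = vadd (D p) (u p) (v p)"
    using u'(2) v'(2) w'(2) w(2) by eventually_elim simp
  then have "AE p in \<mu>. w p = vadd (D p) (u p) (v p)"
  proof (rule AE_limit)
    fix p assume p: "p \<in> space \<mu>" "p \<notin> space (M \<alpha>)"
    interpret complex_inner_space "D p"
      using fibre_inner p by blast
    show "w p = vadd (D p) (u p) (v p)"
      using lev_outside[OF u p] lev_outside[OF v p] lev_outside[OF w(1) p] by (simp add: add_zero)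
  qed
  then show ?thesis
    using w(1) by blast
qed

lemma lev_scale:
  assumes u: "u \<in> lev \<alpha>"
  shows "\<exists>w\<in>lev \<alpha>. AE p in \<mu>. w p = vscale (D p) c (u p)"
proof -
  interpret A: direct_integral "M \<alpha>" "fibre D H \<alpha>" "K \<alpha>"
    by (rule direct_integral_K)
  obtain u' where u': "u' \<in> K \<alpha>" "AE p in M \<alpha>. u' p = u p"
    by (rule restrict_lev[OF u])
  obtain w' where w': "w' \<in> K \<alpha>" "AE p in M \<alpha>. w' p = vscale (D p) c (u' p)"
    using A.ex_scale[OF u'(1)] by auto
  obtain w where w: "w \<in> lev \<alpha>" "AE p in M \<alpha>. w' p = w p"
    by (rule lift_K[OF w'(1)])
  have "AE p in M \<alpha>. w p = vscale (D p) c (u p)"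
    using u'(2) w'(2) w(2) by eventually_elim simp
  then have "AE p in \<mu>. w p = vscale (D p) c (u p)"
  proof (rule AE_limit)
    fix p assume p: "p \<in> space \<mu>" "p \<notin> space (M \<alpha>)"
    interpret complex_inner_space "D p"
      using fibre_inner p by blast
    show "w p = vscale (D p) c (u p)"
      using lev_outside[OF u p] lev_outside[OF w(1) p] by (simp add: scale_vzero)
  qed
  then show ?thesis
    using w(1) by blast
qed

lemma lev_cut:
  assumes u: "u \<in> lev \<alpha>" and B: "B \<in> sets \<mu>"
  shows "\<exists>w\<in>lev \<alpha>. AE p in \<mu>. w p = cut D B u p"
proof -
  interpret A: direct_integral "M \<alpha>" "fibre D H \<alpha>" "K \<alpha>"
    by (rule direct_integral_K)
  have B': "B \<inter> space (M \<alpha>) \<in> sets (M \<alpha>)"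
    using B sets_limit by blast
  obtain u' where u': "u' \<in> K \<alpha>" "AE p in M \<alpha>. u' p = u p"
    by (rule restrict_lev[OF u])
  obtain w' where w': "w' \<in> K \<alpha>" "AE p in M \<alpha>. w' p = cut (fibre D H \<alpha>) (B \<inter> space (M \<alpha>)) u' p"
    using A.ex_cut[OF u'(1) B'] by auto
  obtain w where w: "w \<in> lev \<alpha>" "AE p in M \<alpha>. w' p = w p"
    by (rule lift_K[OF w'(1)])
  have "AE p in M \<alpha>. w p = cut D B u p"
    using u'(2) w'(2) w(2) AE_space by eventually_elim (auto simp: cut_def)
  then have "AE p in \<mu>. w p = cut D B u p"
    by (rule AE_limit) (simp add: cut_def lev_outside[OF u] lev_outside[OF w(1)])
  then show ?thesis
    using w(1) by blast
qed

end

text \<open>By directedness two sections lie in a common level, where closure under the operations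
  is already known.\<close>

sublocale loc_direct_integral_setting \<subseteq> L: section_family \<mu> D U
proof (rule section_family.intro)
  fix u v :: "'x \<Rightarrow> 'h" and p :: 'x and c :: complex
  show "complex_inner_space (D p)" if "p \<in> space \<mu>"
    using fibre_inner that by blast
  show "u p \<in> carr (D p)" if "u \<in> U" "p \<in> space \<mu>"
    using U_mem that by blast
  show "integrable (completion \<mu>) (\<lambda>p. vinner (D p) (u p) (v p))" if "u \<in> U" "v \<in> U"
    using integral that by (auto simp: loc_direct_integral_def)
  show "\<exists>w\<in>U. AE p in \<mu>. w p = vadd (D p) (u p) (v p)" if uv: "u \<in> U" "v \<in> U"
    by (rule common_lev[OF uv]) (use lev_add lev_U in blast)
  show "\<exists>w\<in>U. AE p in \<mu>. w p = vscale (D p) c (u p)" if u: "u \<in> U"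
    by (rule common_lev[OF u u]) (use lev_scale lev_U in blast)
qed

context loc_direct_integral_setting
begin

section \<open>The maps gamma\<close>

lemma EK_eq: "EK \<alpha> = section_space (M \<alpha>) (fibre D H \<alpha>) (K \<alpha>)"
  by (simp add: level_classical_def)

lemma EK_inner: "complex_inner_space (EK \<alpha>)"
  using direct_integral.E_inner[OF direct_integral_K] by (simp add: EK_eq)

lemma carr_EU: "carr EU = clU ` U"
  by (rule carr_section_space)

lemma level_sub: "level \<alpha> \<subseteq> carr EU"
  using lev_U by (auto simp: level_eq carr_EU)

lemma level_rep:
  assumes "A \<in> level \<alpha>"
  obtains u where "u \<in> lev \<alpha>" "A = clU u"
  using assms by (auto simp: level_eq)

lemma level_add:
  assumes "A \<in> level \<alpha>" "B \<in> level \<alpha>"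
  shows "vadd EU A B \<in> level \<alpha>"
proof -
  obtain u v where uv: "u \<in> lev \<alpha>" "A = clU u" "v \<in> lev \<alpha>" "B = clU v"
    using assms by (auto simp: level_eq)
  obtain w where w: "w \<in> lev \<alpha>" "AE p in \<mu>. w p = vadd (D p) (u p) (v p)"
    using lev_add[OF uv(1,3)] by blast
  have "vadd EU A B = clU w"
    unfolding uv(2,4) using uv w lev_U by (intro L.add_cl) auto
  then show ?thesis
    using w(1) by (simp add: level_eq)
qed

lemma level_scale:
  assumes "A \<in> level \<alpha>"
  shows "vscale EU c A \<in> level \<alpha>"
proof -
  obtain u where u: "u \<in> lev \<alpha>" "A = clU u"
    using assms by (auto simp: level_eq)
  obtain w where w: "w \<in> lev \<alpha>" "AE p in \<mu>. w p = vscale (D p) c (u p)"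
    using lev_scale[OF u(1)] by blast
  have "vscale EU c A = clU w"
    unfolding u(2) using u w lev_U by (intro L.scale_cl) auto
  then show ?thesis
    using w(1) by (simp add: level_eq)
qed

lemma V_diff:
  assumes "A \<in> level \<alpha>" "B \<in> level \<alpha>"
  shows "V \<alpha> (vdiff EU A B) = vdiff (EK \<alpha>) (V \<alpha> A) (V \<alpha> B)"
  using V_linear(2)[OF assms(1) level_scale[OF assms(2), of "-1"]] V_linear(3)[OF assms(2), of "-1"]
  by (simp add: vdiff_def)

lemma level_diff: "\<lbrakk>A \<in> level \<alpha>; B \<in> level \<alpha>\<rbrakk> \<Longrightarrow> vdiff EU A B \<in> level \<alpha>"
  by (simp add: vdiff_def level_add level_scale)

text \<open>Isometry does not give this yet: definiteness of the inner product on \<open>EU\<close>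
  is itself derived from injectivity in \<open>EU_inner\<close>. Representatives are compared
  instead.\<close>

lemma V_inj:
  assumes A: "A \<in> level \<alpha>" and B: "B \<in> level \<alpha>" and eq: "V \<alpha> A = V \<alpha> B"
  shows "A = B"
proof -
  obtain u where u: "u \<in> lev \<alpha>" "A = clU u"
    by (rule level_rep[OF A])
  obtain v where v: "v \<in> lev \<alpha>" "B = clU v"
    by (rule level_rep[OF B])
  obtain x where x: "x \<in> K \<alpha>" "AE p in M \<alpha>. x p = u p" "V \<alpha> (clU u) = clK \<alpha> x"
    by (rule restrict_lev[OF u(1)])
  have "x \<in> V \<alpha> (clU v)"
    using ae_class_self[OF x(1), of "M \<alpha>"] x(3) eq u(2) v(2) by simp
  then have "AE p in M \<alpha>. x p = v p"
    by (rule V_clU_rep(2)[OF v(1)])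
  then have "AE p in M \<alpha>. u p = v p"
    using x(2) by eventually_elim simp
  then have "AE p in \<mu>. u p = v p"
    by (rule lev_eqI[OF u(1) v(1)])
  then show ?thesis
    unfolding u(2) v(2) by (rule ae_class_eqI)
qed

definition W :: "'i \<Rightarrow> ('x \<Rightarrow> 'h) set \<Rightarrow> ('x \<Rightarrow> 'h) set" where
  "W \<alpha> = adjoint_map (level_space M \<mu> D H U \<alpha>) (EK \<alpha>) (V \<alpha>)"

text \<open>For a surjective isometry the adjoint is the inverse. By surjectivity, any x satisfying
  the description has an image with the same inner products as \<open>V \<alpha> A\<close> against
  all of \<open>EK \<alpha>\<close>; injectivity then identifies x with A.\<close>

lemma W_V:
  assumes A: "A \<in> level \<alpha>"
  shows "W \<alpha> (V \<alpha> A) = A"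
proof -
  interpret EK: complex_inner_space "EK \<alpha>"
    by (rule EK_inner)
  have "W \<alpha> (V \<alpha> A) = (THE x. x \<in> level \<alpha> \<and> (\<forall>z\<in>level \<alpha>. vinner EU z x = vinner (EK \<alpha>) (V \<alpha> z) (V \<alpha> A)))"
    using V_linear(1)[OF A] by (simp add: W_def adjoint_map_def)
  also have "\<dots> = A"
  proof (rule the_equality)
    show "A \<in> level \<alpha> \<and> (\<forall>z\<in>level \<alpha>. vinner EU z A = vinner (EK \<alpha>) (V \<alpha> z) (V \<alpha> A))"
      using A V_inner by simp
  next
    fix x assume x: "x \<in> level \<alpha> \<and> (\<forall>z\<in>level \<alpha>. vinner EU z x = vinner (EK \<alpha>) (V \<alpha> z) (V \<alpha> A))"
    have "V \<alpha> x = V \<alpha> A"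
    proof (rule EK.vec_eqI_right)
      fix Z assume "Z \<in> carr (EK \<alpha>)"
      then obtain z where "z \<in> level \<alpha>" "Z = V \<alpha> z"
        using V_surj by blast
      then show "vinner (EK \<alpha>) Z (V \<alpha> x) = vinner (EK \<alpha>) Z (V \<alpha> A)"
        using x V_inner by simp
    qed (use x A V_linear(1) in auto)
    then show "x = A"
      using V_inj x A by blast
  qed
  finally show ?thesis .
qed

lemma W_level:
  assumes "A \<in> carr (EK \<alpha>)"
  shows "W \<alpha> A \<in> level \<alpha>" "V \<alpha> (W \<alpha> A) = A"
proof -
  obtain B where "B \<in> level \<alpha>" "A = V \<alpha> B"
    using V_surj assms by blast
  then show "W \<alpha> A \<in> level \<alpha>" "V \<alpha> (W \<alpha> A) = A"
    by (simp_all add: W_V)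
qed

lemma W_add: "\<lbrakk>A \<in> carr (EK \<alpha>); B \<in> carr (EK \<alpha>)\<rbrakk> \<Longrightarrow> W \<alpha> (vadd (EK \<alpha>) A B) = vadd EU (W \<alpha> A) (W \<alpha> B)"
  using W_V[OF level_add[OF W_level(1) W_level(1)]] V_linear(2)[OF W_level(1) W_level(1)]
  by (simp add: W_level(2))

lemma W_scale: "A \<in> carr (EK \<alpha>) \<Longrightarrow> W \<alpha> (vscale (EK \<alpha>) c A) = vscale EU c (W \<alpha> A)"
  using W_V[OF level_scale[OF W_level(1)]] V_linear(3)[OF W_level(1)]
  by (simp add: W_level(2))

lemma W_norm: "A \<in> carr (EK \<alpha>) \<Longrightarrow> vnorm EU (W \<alpha> A) = vnorm (EK \<alpha>) A"
  using V_norm[OF W_level(1)] by (simp add: W_level(2))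

abbreviation "LBO \<equiv> locally_bounded_ops EU level"
abbreviation "\<gamma> \<equiv> gamma_map M \<mu> D H U K"
abbreviation "diag' \<equiv> diag_commutant M \<mu> D H U"

lemma gamma_apply: "A \<in> carr (EK \<alpha>) \<Longrightarrow> \<gamma> \<alpha> T A = V \<alpha> (T (W \<alpha> A))"
  by (simp add: gamma_map_def W_def)

lemma LBO_linear:
  assumes "T \<in> LBO"
  shows "\<lbrakk>A \<in> carr EU; B \<in> carr EU\<rbrakk> \<Longrightarrow> T (vadd EU A B) = vadd EU (T A) (T B)"
    and "A \<in> carr EU \<Longrightarrow> T (vscale EU c A) = vscale EU c (T A)"
  using assms by (auto simp: locally_bounded_ops_def linear_map_def)

lemma LBO_level: "\<lbrakk>T \<in> LBO; A \<in> level \<alpha>\<rbrakk> \<Longrightarrow> T A \<in> level \<alpha>"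
  unfolding locally_bounded_ops_def by blast

lemma gamma_bounded:
  assumes T: "T \<in> LBO"
  shows "\<gamma> \<alpha> T \<in> bounded_ops (EK \<alpha>)"
proof -
  interpret EK: complex_inner_space "EK \<alpha>"
    by (rule EK_inner)
  have TW: "T (W \<alpha> A) \<in> level \<alpha>" if "A \<in> carr (EK \<alpha>)" for A
    using LBO_level[OF T W_level(1)[OF that]] .
  have WU: "W \<alpha> A \<in> carr EU" if "A \<in> carr (EK \<alpha>)" for A
    using W_level(1)[OF that] level_sub by blast
  have "bounded_on EU (level \<alpha>) T"
    using T by (simp add: locally_bounded_ops_def)
  then obtain C where C: "\<And>A. A \<in> level \<alpha> \<Longrightarrow> vnorm EU (T A) \<le> C * vnorm EU A"
    by (auto simp: bounded_on_def)
  show ?thesis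
  proof (rule bounded_opsI)
    show "\<gamma> \<alpha> T \<in> carr (EK \<alpha>) \<rightarrow>\<^sub>E carr (EK \<alpha>)"
    proof (rule PiE_I)
      show "\<gamma> \<alpha> T A \<in> carr (EK \<alpha>)" if "A \<in> carr (EK \<alpha>)" for A
        using V_linear(1)[OF TW[OF that]] gamma_apply[OF that] by simp
    qed (simp add: gamma_map_def)
    show "\<gamma> \<alpha> T (vadd (EK \<alpha>) A B) = vadd (EK \<alpha>) (\<gamma> \<alpha> T A) (\<gamma> \<alpha> T B)"
      if "A \<in> carr (EK \<alpha>)" "B \<in> carr (EK \<alpha>)" for A B
      using that by (simp add: gamma_apply W_add LBO_linear[OF T] WU V_linear(2)[OF TW TW])
    show "\<gamma> \<alpha> T (vscale (EK \<alpha>) c A) = vscale (EK \<alpha>) c (\<gamma> \<alpha> T A)" if "A \<in> carr (EK \<alpha>)" for c A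
      using that by (simp add: gamma_apply W_scale LBO_linear[OF T] WU V_linear(3)[OF TW])
    show "vnorm (EK \<alpha>) (\<gamma> \<alpha> T A) \<le> C * vnorm (EK \<alpha>) A" if "A \<in> carr (EK \<alpha>)" for A
      using C[OF W_level(1)[OF that]] that by (simp add: gamma_apply V_norm[OF TW] W_norm)
  qed
qed

text \<open>On representatives \<open>\<gamma> \<alpha> T\<close> acts as T does: \<open>V\<close>
  and its inverse only restrict and lift. Transfers between T and its compressions go through this
  fact.\<close>

lemma gamma_rep:
  assumes T: "T \<in> LBO" and u: "u \<in> lev \<alpha>" and v: "v \<in> K \<alpha>" "AE p in M \<alpha>. v p = u p"
    and tu: "tu \<in> T (clU u)" and tv: "tv \<in> \<gamma> \<alpha> T (clK \<alpha> v)"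
  shows "AE p in M \<alpha>. tv p = tu p"
proof -
  have "\<gamma> \<alpha> T (clK \<alpha> v) = V \<alpha> (T (clU u))"
    using V_clU[OF u v] W_V[of "clU u" \<alpha>] u v by (subst gamma_apply) (auto simp: carr_EK level_eq)
  moreover obtain x where x: "x \<in> lev \<alpha>" "T (clU u) = clU x"
    using LBO_level[OF T, of "clU u" \<alpha>] u by (auto simp: level_eq)
  ultimately have "AE p in M \<alpha>. tv p = x p"
    using V_clU_rep(2)[OF x(1)] tv by simp
  moreover have "AE p in \<mu>. tu p = x p"
    using tu x(2) by (simp add: mem_ae_class)
  then have "AE p in M \<alpha>. tu p = x p"
    by (rule AE_M)
  ultimately show ?thesis
    by eventually_elim simp
qed

section \<open>Multiplication by indicator functions\<close>

definition cut_op :: "'x set \<Rightarrow> ('x \<Rightarrow> 'h) set \<Rightarrow> ('x \<Rightarrow> 'h) set" where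
  "cut_op B = (\<lambda>A\<in>carr EU. {w \<in> U. \<exists>u\<in>A. AE p in \<mu>. w p = cut D B u p})"

lemma cut_op_cl:
  assumes u: "u \<in> U" and w: "w \<in> U" "AE p in \<mu>. w p = cut D B u p"
  shows "cut_op B (clU u) = clU w"
proof -
  have "x \<in> {w \<in> U. \<exists>u\<in>clU u. AE p in \<mu>. w p = cut D B u p} \<longleftrightarrow> x \<in> clU w" for x
  proof
    assume "x \<in> {w \<in> U. \<exists>u\<in>clU u. AE p in \<mu>. w p = cut D B u p}"
    then obtain u' where x: "x \<in> U" "AE p in \<mu>. u' p = u p" "AE p in \<mu>. x p = cut D B u' p"
      by (auto simp: mem_ae_class)
    have "AE p in \<mu>. x p = w p"
      using x(2,3) w(2) by eventually_elim (simp add: cut_def)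
    then show "x \<in> clU w"
      using x(1) by (simp add: mem_ae_class)
  next
    assume x: "x \<in> clU w"
    then have "AE p in \<mu>. x p = w p"
      by (simp add: mem_ae_class)
    then have "AE p in \<mu>. x p = cut D B u p"
      using w(2) by eventually_elim simp
    then show "x \<in> {w \<in> U. \<exists>u\<in>clU u. AE p in \<mu>. w p = cut D B u p}"
      using x ae_class_self[OF u, of \<mu>] unfolding mem_ae_class[of x] by blast
  qed
  then show ?thesis
    using u by (auto simp: cut_op_def carr_EU)
qed

lemma ex_cutU:
  assumes "u \<in> U" "B \<in> sets \<mu>"
  shows "\<exists>w\<in>U. AE p in \<mu>. w p = cut D B u p"
proof -
  obtain \<alpha> where "u \<in> lev \<alpha>"
    using common_lev[OF assms(1,1)] by blast
  then show ?thesis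
    using lev_cut assms(2) lev_U by blast
qed

lemma cut_op_level:
  assumes A: "A \<in> level \<alpha>" and B: "B \<in> sets \<mu>"
  shows "cut_op B A \<in> level \<alpha>"
proof -
  obtain u where u: "u \<in> lev \<alpha>" "A = clU u"
    by (rule level_rep[OF A])
  obtain w where w: "w \<in> lev \<alpha>" "AE p in \<mu>. w p = cut D B u p"
    using lev_cut[OF u(1) B] by blast
  show ?thesis
    unfolding u(2) cut_op_cl[OF lev_U[OF u(1)] lev_U[OF w(1)] w(2)] using w(1) by (simp add: level_eq)
qed

lemma cut_op_carr:
  assumes "A \<in> carr EU" "B \<in> sets \<mu>"
  shows "cut_op B A \<in> carr EU"
proof -
  obtain u where u: "u \<in> U" "A = clU u"
    using assms by (auto simp: carr_EU)
  obtain w where w: "w \<in> U" "AE p in \<mu>. w p = cut D B u p"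
    using ex_cutU[OF u(1) assms(2)] by blast
  show ?thesis
    unfolding u(2) cut_op_cl[OF u(1) w] using w(1) by (simp add: carr_EU)
qed

lemma cut_op_linear:
  assumes B: "B \<in> sets \<mu>"
  shows "linear_map EU EU (cut_op B)"
  unfolding linear_map_def
proof (intro conjI ballI allI)
  show "cut_op B \<in> carr EU \<rightarrow> carr EU"
    using cut_op_carr B by blast
next
  fix X Y assume "X \<in> carr EU" "Y \<in> carr EU"
  then obtain u v where u: "u \<in> U" "X = clU u" and v: "v \<in> U" "Y = clU v"
    by (auto simp: carr_EU)
  obtain w where w: "w \<in> U" "AE p in \<mu>. w p = vadd (D p) (u p) (v p)"
    using L.ex_add[OF u(1) v(1)] by blast
  obtain u' where u': "u' \<in> U" "AE p in \<mu>. u' p = cut D B u p"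
    using ex_cutU[OF u(1) B] by blast
  obtain v' where v': "v' \<in> U" "AE p in \<mu>. v' p = cut D B v p"
    using ex_cutU[OF v(1) B] by blast
  obtain w' where w': "w' \<in> U" "AE p in \<mu>. w' p = cut D B w p"
    using ex_cutU[OF w(1) B] by blast
  have "AE p in \<mu>. w' p = vadd (D p) (u' p) (v' p)"
    using u'(2) v'(2) w'(2) w(2) AE_space
  proof eventually_elim
    case (elim p)
    interpret complex_inner_space "D p"
      using elim fibre_inner by blast
    show ?case
      using elim by (simp add: cut_def add_zero)
  qed
  then show "cut_op B (vadd EU X Y) = vadd EU (cut_op B X) (cut_op B Y)"
    unfolding u(2) v(2) cut_op_cl[OF u(1) u'] cut_op_cl[OF v(1) v'] L.add_cl[OF u(1) v(1) w]
      cut_op_cl[OF w(1) w'] using L.add_cl[OF u'(1) v'(1) w'(1)] by simp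
next
  fix c X assume "X \<in> carr EU"
  then obtain u where u: "u \<in> U" "X = clU u"
    by (auto simp: carr_EU)
  obtain w where w: "w \<in> U" "AE p in \<mu>. w p = vscale (D p) c (u p)"
    using L.ex_scale[OF u(1)] by blast
  obtain u' where u': "u' \<in> U" "AE p in \<mu>. u' p = cut D B u p"
    using ex_cutU[OF u(1) B] by blast
  obtain w' where w': "w' \<in> U" "AE p in \<mu>. w' p = cut D B w p"
    using ex_cutU[OF w(1) B] by blast
  have "AE p in \<mu>. w' p = vscale (D p) c (u' p)"
    using u'(2) w'(2) w(2) AE_space
  proof eventually_elim
    case (elim p)
    interpret complex_inner_space "D p"
      using elim fibre_inner by blast
    show ?case
      using elim by (simp add: cut_def scale_vzero)
  qed
  then show "cut_op B (vscale EU c X) = vscale EU c (cut_op B X)"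
    unfolding u(2) cut_op_cl[OF u(1) u'] L.scale_cl[OF u(1) w]
      cut_op_cl[OF w(1) w'] using L.scale_cl[OF u'(1) w'(1)] by simp
qed

text \<open>Indicators are real, so multiplication by them is symmetric. This turns invariance of a
  level into the invariance of its orthogonal complement that \<open>locally_bounded_ops\<close>
  demands.\<close>

lemma cut_op_adjoint:
  assumes X: "X \<in> carr EU" and Y: "Y \<in> carr EU" and B: "B \<in> sets \<mu>"
  shows "vinner EU (cut_op B X) Y = vinner EU X (cut_op B Y)"
proof -
  obtain u v where u: "u \<in> U" "X = clU u" and v: "v \<in> U" "Y = clU v"
    using X Y by (auto simp: carr_EU)
  obtain u' where u': "u' \<in> U" "AE p in \<mu>. u' p = cut D B u p"
    using ex_cutU[OF u(1) B] by blast
  obtain v' where v': "v' \<in> U" "AE p in \<mu>. v' p = cut D B v p"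
    using ex_cutU[OF v(1) B] by blast
  have "AE p in \<mu>. vinner (D p) (u' p) (v p) = vinner (D p) (u p) (v' p)"
    using u'(2) v'(2) AE_space
  proof eventually_elim
    case (elim p)
    interpret complex_inner_space "D p"
      using elim fibre_inner by blast
    show ?case
      using elim U_mem u v by (simp add: cut_def)
  qed
  then have "(LINT p|completion \<mu>. vinner (D p) (u' p) (v p)) = (LINT p|completion \<mu>. vinner (D p) (u p) (v' p))"
    using L.inner_integrable u(1) v(1) u'(1) v'(1) by (intro integral_cong_AE) (auto intro: AE_completion)
  then show ?thesis
    unfolding u(2) v(2) cut_op_cl[OF u(1) u'] cut_op_cl[OF v(1) v']
    using L.inner_cl u(1) v(1) u'(1) v'(1) by simp
qed

lemma cut_op_norm:
  assumes X: "X \<in> carr EU" and B: "B \<in> sets \<mu>"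
  shows "vnorm EU (cut_op B X) \<le> vnorm EU X"
proof -
  obtain u where u: "u \<in> U" "X = clU u"
    using X by (auto simp: carr_EU)
  obtain u' where u': "u' \<in> U" "AE p in \<mu>. u' p = cut D B u p"
    using ex_cutU[OF u(1) B] by blast
  have "AE p in \<mu>. (vnorm (D p) (u' p))\<^sup>2 \<le> (vnorm (D p) (u p))\<^sup>2"
    using u'(2) AE_space
  proof eventually_elim
    case (elim p)
    interpret complex_inner_space "D p"
      using elim fibre_inner by blast
    show ?case
      using elim by (simp add: cut_def)
  qed
  then have "(LINT p|completion \<mu>. (vnorm (D p) (u' p))\<^sup>2) \<le> (LINT p|completion \<mu>. (vnorm (D p) (u p))\<^sup>2)"
    using L.norm_integrable u(1) u'(1) by (intro integral_mono_AE) (auto intro: AE_completion)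
  then have "(vnorm EU (clU u'))\<^sup>2 \<le> (vnorm EU (clU u))\<^sup>2"
    using L.norm_cl u(1) u'(1) by simp
  then show ?thesis
    unfolding u(2) cut_op_cl[OF u(1) u'] using L.norm_cl_nonneg[OF u(1)] by (rule power2_le_imp_le)
qed

lemma cut_op_LBO:
  assumes B: "B \<in> sets \<mu>"
  shows "cut_op B \<in> LBO"
proof -
  have "cut_op B \<in> carr EU \<rightarrow>\<^sub>E carr EU"
    using cut_op_carr[OF _ B] by (auto simp: cut_op_def)
  moreover have "cut_op B ` ortho EU (level \<alpha>) \<subseteq> ortho EU (level \<alpha>)" for \<alpha>
  proof
    fix Z assume "Z \<in> cut_op B ` ortho EU (level \<alpha>)"
    then obtain X where X: "Z = cut_op B X" "X \<in> carr EU" "\<And>Y. Y \<in> level \<alpha> \<Longrightarrow> vinner EU X Y = 0"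
      by (auto simp: ortho_def)
    have "vinner EU (cut_op B X) Y = 0" if "Y \<in> level \<alpha>" for Y
      using cut_op_adjoint[OF X(2) _ B, of Y] X(3)[OF cut_op_level[OF that B]] that level_sub by auto
    then show "Z \<in> ortho EU (level \<alpha>)"
      using X(1,2) cut_op_carr[OF X(2) B] by (simp add: ortho_def)
  qed
  moreover have "bounded_on EU (level \<alpha>) (cut_op B)" for \<alpha>
    unfolding bounded_on_def using cut_op_norm[OF _ B] level_sub by (intro exI[of _ 1]) auto
  ultimately show ?thesis
    using cut_op_linear[OF B] cut_op_level[OF _ B] by (auto simp: locally_bounded_ops_def)
qed

text \<open>A diagonalizable operator must also be decomposable, so scalar multiplication has to be
  exhibited as a locally bounded fibre operator, extensional on \<open>carr (D p)\<close>.\<close>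

lemma fibre_scale_locally_bounded:
  assumes p: "p \<in> space \<mu>"
  shows "(\<lambda>x\<in>carr (D p). vscale (D p) c x) \<in> locally_bounded_ops (D p) (\<lambda>\<alpha>. H \<alpha> p)"
proof -
  interpret complex_inner_space "D p"
    using p fibre_inner by blast
  have "linear_map (D p) (D p) (\<lambda>x\<in>carr (D p). vscale (D p) c x)"
    by (auto simp: linear_map_def scale_add_right scale_scale mult.commute)
  moreover have "bounded_on (D p) (H \<alpha> p) (\<lambda>x\<in>carr (D p). vscale (D p) c x)" for \<alpha>
    unfolding bounded_on_def using H_sub[OF p] by (intro exI[of _ "cmod c"]) (auto simp: vnorm_scale)
  moreover have "(\<lambda>x\<in>carr (D p). vscale (D p) c x) ` ortho (D p) (H \<alpha> p) \<subseteq> ortho (D p) (H \<alpha> p)" for \<alpha>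
    using H_sub[OF p] by (auto simp: ortho_def)
  ultimately show ?thesis
    using H_sub[OF p] H_scale[OF p] by (auto simp: locally_bounded_ops_def)
qed

lemma cut_op_diagonalizable:
  assumes B: "B \<in> sets \<mu>"
  shows "cut_op B \<in> diagonalizable_ops M \<mu> D H U"
proof -
  define f where "f = (\<lambda>p. indicator B p :: complex)"
  have f: "f \<in> borel_measurable \<mu>"
    using B by (simp add: f_def)
  have act: "AE p in \<mu>. w p = vscale (D p) (f p) (u p)"
    if A: "A \<in> carr EU" "u \<in> A" "w \<in> cut_op B A" for A u w
  proof -
    have u: "u \<in> U" "A = clU u"
      using carr_rep[of A \<mu> U u] A by (simp_all add: carr_EU)
    obtain x where x: "x \<in> U" "AE p in \<mu>. x p = cut D B u p"
      using ex_cutU[OF u(1) B] by blast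
    have "AE p in \<mu>. w p = x p"
      using A(3) cut_op_cl[OF u(1) x] u(2) by (simp add: mem_ae_class)
    then show ?thesis
      using x(2) AE_space
    proof eventually_elim
      case (elim p)
      interpret complex_inner_space "D p"
        using elim fibre_inner by blast
      show ?case
        using elim U_mem[OF u(1)] by (simp add: cut_def f_def scale_one scale_zero)
    qed
  qed
  \<comment> \<open>The same action, now by the extensional fibre operators that
    \<open>loc_decomposable\<close> asks for; both versions agree at u(p), which lies in the
    fibre.\<close>
  have "acts_fibrewise \<mu> (carr EU) (cut_op B) (\<lambda>p. \<lambda>x\<in>carr (D p). vscale (D p) (f p) x)"
    unfolding acts_fibrewise_def
  proof (intro ballI)
    fix A u w assume A: "A \<in> carr EU" "u \<in> A" "w \<in> cut_op B A"
    have u: "u \<in> U"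
      using carr_rep[of A \<mu> U u] A by (simp add: carr_EU)
    show "AE p in \<mu>. w p = (\<lambda>x\<in>carr (D p). vscale (D p) (f p) x) (u p)"
      using act[OF A] AE_space by eventually_elim (simp add: U_mem[OF u])
  qed
  then have "loc_decomposable M \<mu> D H U (cut_op B)"
    unfolding loc_decomposable_def using cut_op_LBO[OF B] fibre_scale_locally_bounded
    by (intro conjI exI[of _ "\<lambda>p. \<lambda>x\<in>carr (D p). vscale (D p) (f p) x"]) auto
  moreover have "acts_fibrewise \<mu> (carr EU) (cut_op B) (\<lambda>p. vscale (D p) (f p))"
    unfolding acts_fibrewise_def using act by blast
  ultimately show ?thesis
    using f unfolding diagonalizable_ops_def by blast
qed

section \<open>The range of gamma\<close>

lemma diag'_LBO: "T \<in> diag' \<Longrightarrow> T \<in> LBO"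
  by (simp add: diag_commutant_def commutant_def)

lemma diag'_cut: "\<lbrakk>T \<in> diag'; B \<in> sets \<mu>; A \<in> carr EU\<rbrakk> \<Longrightarrow> T (cut_op B A) = cut_op B (T A)"
  using cut_op_diagonalizable by (auto simp: diag_commutant_def commutant_def)

lemma gamma_decomposable:
  assumes T: "T \<in> diag'"
  shows "\<gamma> \<alpha> T \<in> level_decomposable M D H K \<alpha>"
proof -
  interpret A: direct_integral "M \<alpha>" "fibre D H \<alpha>" "K \<alpha>"
    by (rule direct_integral_K)
  have "A.commutes_with_cuts (\<gamma> \<alpha> T)"
    unfolding A.commutes_with_cuts_def
  proof (intro ballI impI)
    fix B u v su sv
    assume B: "B \<in> sets (M \<alpha>)" and u: "u \<in> K \<alpha>" and v: "v \<in> K \<alpha>"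
      and v_cut: "AE p in M \<alpha>. v p = cut (fibre D H \<alpha>) B u p"
      and su: "su \<in> \<gamma> \<alpha> T (clK \<alpha> u)" and sv: "sv \<in> \<gamma> \<alpha> T (clK \<alpha> v)"
    \<comment> \<open>Measurability at one level implies measurability in the limit, so
      \<open>cut_op B\<close> is a diagonalizable operator and T commutes with it.\<close>
    have B': "B \<in> sets \<mu>"
      using B sets_sub by blast
    obtain x where x: "x \<in> lev \<alpha>" "AE p in M \<alpha>. u p = x p"
      by (rule lift_K[OF u])
    obtain y where y: "y \<in> lev \<alpha>" "AE p in M \<alpha>. v p = y p"
      by (rule lift_K[OF v])
    have "AE p in M \<alpha>. y p = cut D B x p"
      using x(2) y(2) v_cut by eventually_elim (auto simp: cut_def)
    then have "AE p in \<mu>. y p = cut D B x p"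
      by (rule AE_limit) (simp add: cut_def lev_outside[OF x(1)] lev_outside[OF y(1)])
    then have cut_x: "cut_op B (clU x) = clU y"
      using cut_op_cl x(1) y(1) lev_U by blast
    have xU: "clU x \<in> level \<alpha>"
      using x(1) by (simp add: level_eq)
    obtain tx where tx: "tx \<in> lev \<alpha>" "T (clU x) = clU tx"
      by (rule level_rep[OF LBO_level[OF diag'_LBO[OF T] xU]])
    obtain z where z: "z \<in> lev \<alpha>" "AE p in \<mu>. z p = cut D B tx p"
      using lev_cut[OF tx(1) B'] by blast
    have "T (clU y) = clU z"
      using diag'_cut[OF T B', of "clU x"] xU level_sub cut_x tx(2)
        cut_op_cl[OF lev_U[OF tx(1)] lev_U[OF z(1)] z(2)] by auto
    then have "AE p in M \<alpha>. sv p = z p"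
      using gamma_rep[OF diag'_LBO[OF T] y(1) v y(2) _ sv] ae_class_self[OF lev_U[OF z(1)]] by simp
    moreover have "AE p in M \<alpha>. su p = tx p"
      using gamma_rep[OF diag'_LBO[OF T] x(1) u x(2) _ su] ae_class_self[OF lev_U[OF tx(1)]] tx(2) by simp
    ultimately show "AE p in M \<alpha>. sv p = cut (fibre D H \<alpha>) B su p"
      using AE_M[OF z(2), of \<alpha>] by eventually_elim (simp add: cut_def)
  qed
  then show ?thesis
    using A.commutes_with_cuts_decomposable gamma_bounded[OF diag'_LBO[OF T], of \<alpha>]
    by (simp add: level_decomposable_def EK_eq)
qed

section \<open>Continuity of gamma\<close>

text \<open>\<open>V \<alpha>\<close> preserves norms and maps the unit ball of the level onto that
  of the classical direct integral. Thus \<open>\<gamma> \<alpha>\<close> is isometric from the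
  seminorm p_\<alpha> to the operator norm, which is all that continuity needs.\<close>

lemma gamma_seminorm:
  assumes T: "T \<in> LBO" and S: "S \<in> LBO"
  shows "op_norm_on (EK \<alpha>) (carr (EK \<alpha>)) (op_diff (EK \<alpha>) (\<gamma> \<alpha> T) (\<gamma> \<alpha> S))
    = op_norm_on EU (level \<alpha>) (op_diff EU T S)"
proof -
  have ball: "{A \<in> carr (EK \<alpha>). vnorm (EK \<alpha>) A \<le> 1} = V \<alpha> ` {A \<in> level \<alpha>. vnorm EU A \<le> 1}"
    using V_surj[of \<alpha>, symmetric] by (auto simp: V_norm)
  have "vnorm (EK \<alpha>) (op_diff (EK \<alpha>) (\<gamma> \<alpha> T) (\<gamma> \<alpha> S) (V \<alpha> A)) = vnorm EU (op_diff EU T S A)"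
    if A: "A \<in> level \<alpha>" for A
  proof -
    have "op_diff (EK \<alpha>) (\<gamma> \<alpha> T) (\<gamma> \<alpha> S) (V \<alpha> A) = V \<alpha> (vdiff EU (T A) (S A))"
      using V_linear(1)[OF A] V_diff[OF LBO_level[OF T A] LBO_level[OF S A]]
      by (simp add: op_diff_def gamma_apply W_V[OF A])
    then show ?thesis
      using V_norm[OF level_diff[OF LBO_level[OF T A] LBO_level[OF S A]]] A level_sub
      by (auto simp: op_diff_def)
  qed
  then show ?thesis
    unfolding op_norm_on_def ball image_image by (intro arg_cong[where f=Sup] image_cong) auto
qed

lemma gamma_continuous:
  "continuous_map (diag_commutant_topology M \<mu> D H U) (level_topology M D H K \<alpha>) (\<gamma> \<alpha>)"
proof -
  interpret EK: complex_inner_space "EK \<alpha>"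
    by (rule EK_inner)
  let ?A = "level_decomposable M D H K \<alpha>"
  let ?n = "\<lambda>T S. op_norm_on (EK \<alpha>) (carr (EK \<alpha>)) (op_diff (EK \<alpha>) T S)"
  let ?X = "diag_commutant_topology M \<mu> D H U"
  have A_sub: "?A \<subseteq> bounded_ops (EK \<alpha>)"
    by (auto simp: level_decomposable_def decomposable_ops_def decomposed_by_def EK_eq)
  interpret Metric_space ?A "\<lambda>T S. if T \<in> ?A \<and> S \<in> ?A then ?n T S else 0"
    by (rule EK.Metric_space_op_norm[OF A_sub])
  have top: "level_topology M D H K \<alpha> = mtopology"
    by (simp add: level_topology_def norm_topology_def)
  have X_sub: "topspace ?X \<subseteq> diag'"
    by (simp add: diag_commutant_topology_def)
  have "openin ?X {T \<in> topspace ?X. \<gamma> \<alpha> T \<in> Q}" if Q: "openin mtopology Q" for Q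
  proof (subst openin_subopen, intro ballI)
    fix T assume T: "T \<in> {T \<in> topspace ?X. \<gamma> \<alpha> T \<in> Q}"
    then have T': "T \<in> diag'" "T \<in> LBO"
      using X_sub diag'_LBO by auto
    obtain e where e: "e > 0" "mball (\<gamma> \<alpha> T) e \<subseteq> Q"
      using Q T unfolding openin_mtopology by blast
    \<comment> \<open>A subbasic neighbourhood of T for the seminorm of level \<alpha>; by
      \<open>gamma_seminorm\<close> its members in the commutant land in the e-ball around
      \<open>\<gamma> \<alpha> T\<close>.\<close>
    define G where "G = {S \<in> LBO. op_norm_on EU (level \<alpha>) (op_diff EU S T) < e}"
    have "openin (locally_bounded_topology EU level) G"
      unfolding locally_bounded_topology_def G_def using T'(2) e(1)
      by (intro topology_generated_by_Basis) blast
    then have G_open: "openin ?X (diag' \<inter> G)"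
      unfolding diag_commutant_topology_def by (rule openin_subtopology_Int2)
    \<comment> \<open>Computed on the classical side, where the inner product space laws are
      available.\<close>
    have "op_norm_on EU (level \<alpha>) (op_diff EU T T) = 0"
      using gamma_seminorm[OF T'(2) T'(2), of \<alpha>] EK.op_norm_eq_0[OF gamma_bounded gamma_bounded, OF T'(2) T'(2)]
      by simp
    then have "T \<in> diag' \<inter> G"
      using T' e(1) by (simp add: G_def)
    moreover have "diag' \<inter> G \<subseteq> {T \<in> topspace ?X. \<gamma> \<alpha> T \<in> Q}"
    proof
      fix S assume S: "S \<in> diag' \<inter> G"
      have mem: "\<gamma> \<alpha> S \<in> ?A" "\<gamma> \<alpha> T \<in> ?A"
        using S T'(1) gamma_decomposable by auto
      have "?n (\<gamma> \<alpha> S) (\<gamma> \<alpha> T) < e"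
        using S gamma_seminorm[OF _ T'(2), of S \<alpha>] by (simp add: G_def)
      then have "\<gamma> \<alpha> S \<in> mball (\<gamma> \<alpha> T) e"
        using mem commute[of "\<gamma> \<alpha> S" "\<gamma> \<alpha> T"] by (simp add: in_mball)
      then show "S \<in> {T \<in> topspace ?X. \<gamma> \<alpha> T \<in> Q}"
        using e(2) openin_subset[OF G_open] S by blast
    qed
    ultimately show "\<exists>G. openin ?X G \<and> T \<in> G \<and> G \<subseteq> {T \<in> topspace ?X. \<gamma> \<alpha> T \<in> Q}"
      using G_open by blast
  qed
  moreover have "\<gamma> \<alpha> \<in> topspace ?X \<rightarrow> topspace mtopology"
    using X_sub gamma_decomposable by auto
  ultimately show ?thesis
    unfolding top continuous_map_def by blast
qed

section \<open>Compatibility with the compressions\<close>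

text \<open>The passage goes up to \<mu> and down again. The property is first made trivial outside
  \<open>space (M \<beta>)\<close>, where the hypothesis says nothing.\<close>

lemma AE_M_mono:
  assumes "\<alpha> \<le> \<beta>" "AE p in M \<beta>. P p"
  shows "AE p in M \<alpha>. P p"
proof -
  have "AE p in M \<beta>. p \<in> space (M \<beta>) \<longrightarrow> P p"
    using assms(2) by eventually_elim simp
  then have "AE p in \<mu>. p \<in> space (M \<beta>) \<longrightarrow> P p"
    by (rule AE_limit) simp
  then have "AE p in M \<alpha>. p \<in> space (M \<beta>) \<longrightarrow> P p"
    by (rule AE_M)
  then show ?thesis
    using AE_space by eventually_elim (use space_mono[OF assms(1)] in auto)
qed

text \<open>T preserves level \<alpha>, so every decomposition t of
  \<open>\<gamma> \<beta> T\<close> sends u(p) back into \<open>H \<alpha> p\<close> for almost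
  every p in \<open>space (M \<alpha>)\<close>, and there the projection changes nothing. As t is
  arbitrary, this yields both existence and uniqueness for the description in
  \<open>phi_map\<close>.\<close>

lemma gamma_compression:
  assumes le: "\<alpha> \<le> \<beta>" and T: "T \<in> LBO"
    and t: "decomposed_by (M \<beta>) (fibre D H \<beta>) (K \<beta>) (\<gamma> \<beta> T) t"
    and u: "u \<in> K \<alpha>" and w: "w \<in> \<gamma> \<alpha> T (clK \<alpha> u)"
  shows "AE p in M \<alpha>. w p = fibre_compression D H \<alpha> \<beta> p (t p) (u p)"
proof -
  interpret A: direct_integral "M \<alpha>" "fibre D H \<alpha>" "K \<alpha>"
    by (rule direct_integral_K)
  interpret B: direct_integral "M \<beta>" "fibre D H \<beta>" "K \<beta>"
    by (rule direct_integral_K)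
  have wK: "w \<in> K \<alpha>"
    by (rule A.op_rep(1)[OF gamma_bounded[OF T, of \<alpha>, unfolded EK_eq] u w])
  obtain x where x: "x \<in> lev \<alpha>" "AE p in M \<alpha>. u p = x p"
    by (rule lift_K[OF u])
  obtain v where v: "v \<in> K \<beta>" "AE p in M \<beta>. v p = x p"
    by (rule restrict_lev[OF lev_mono[OF le x(1)]])
  have "clU x \<in> level \<alpha>"
    using x(1) by (simp add: level_eq)
  then obtain tx where tx: "tx \<in> lev \<alpha>" "T (clU x) = clU tx"
    by (rule level_rep[OF LBO_level[OF T]])
  then have tx_mem: "tx \<in> T (clU x)"
    using ae_class_self lev_U by blast
  obtain sv where sv: "sv \<in> \<gamma> \<beta> T (clK \<beta> v)"
    using B.op_ex_rep[OF gamma_bounded[OF T, of \<beta>, unfolded EK_eq] v(1)] by blast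
  have "AE p in M \<beta>. sv p = tx p"
    by (rule gamma_rep[OF T lev_mono[OF le x(1)] v tx_mem sv])
  moreover have "AE p in M \<beta>. sv p = t p (v p)"
    using t B.cl_carr[OF v(1)] ae_class_self[OF v(1), of "M \<beta>"] sv
    unfolding decomposed_by_def acts_fibrewise_def by blast
  ultimately have "AE p in M \<beta>. tx p = t p (x p)"
    using v(2) by eventually_elim simp
  then have "AE p in M \<alpha>. tx p = t p (x p)"
    by (rule AE_M_mono[OF le])
  moreover have "AE p in M \<alpha>. w p = tx p"
    by (rule gamma_rep[OF T x(1) u x(2) tx_mem w])
  ultimately show ?thesis
    using x(2) AE_space
  proof eventually_elim
    case (elim p)
    have "w p = t p (u p)"
      using elim by simp
    moreover have "u p \<in> H \<alpha> p" "w p \<in> H \<alpha> p"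
      using A.section_mem[OF u elim(4)] A.section_mem[OF wK elim(4)] by simp_all
    moreover have "locally_hilbert (D p) (\<lambda>\<alpha>. H \<alpha> p)"
      using fibres space_sub elim(4) by blast
    ultimately show ?case
      using fibre_compression_eq[of D p H \<alpha> \<beta> "u p" "t p"] le by simp
  qed
qed

lemma phi_gamma:
  assumes le: "\<alpha> \<le> \<beta>" and T: "T \<in> diag'"
  shows "phi_map M D H K \<alpha> \<beta> (\<gamma> \<beta> T) = \<gamma> \<alpha> T"
proof -
  interpret A: direct_integral "M \<alpha>" "fibre D H \<alpha>" "K \<alpha>"
    by (rule direct_integral_K)
  have T': "T \<in> LBO"
    using T diag'_LBO by blast
  have bounded: "\<gamma> \<alpha> T \<in> bounded_ops A.E"
    using gamma_bounded[OF T', of \<alpha>] by (simp add: EK_eq)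
  show ?thesis
    unfolding phi_map_def
  proof (rule the_equality)
    obtain t where t: "decomposed_by (M \<beta>) (fibre D H \<beta>) (K \<beta>) (\<gamma> \<beta> T) t"
      using gamma_decomposable[OF T, of \<beta>] by (auto simp: level_decomposable_def decomposable_ops_def)
    have "fibre_compression D H \<alpha> \<beta> p (t p) \<in> bounded_ops (fibre D H \<alpha> p)" if "p \<in> space (M \<alpha>)" for p
      using that t space_sub space_mono[OF le] fibres le
      by (intro fibre_compression_bounded) (auto simp: decomposed_by_def)
    moreover have "acts_fibrewise (M \<alpha>) (carr A.E) (\<gamma> \<alpha> T) (\<lambda>p. fibre_compression D H \<alpha> \<beta> p (t p))"
      unfolding acts_fibrewise_def
    proof (intro ballI)
      fix X u w assume X: "X \<in> carr A.E" "u \<in> X" "w \<in> \<gamma> \<alpha> T X"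
      then have "u \<in> K \<alpha>" "X = clK \<alpha> u"
        using carr_rep[of X "M \<alpha>" "K \<alpha>" u] by (simp_all add: carr_section_space)
      then show "AE p in M \<alpha>. w p = fibre_compression D H \<alpha> \<beta> p (t p) (u p)"
        using gamma_compression[OF le T' t] X(3) by simp
    qed
    ultimately show "\<exists>t. decomposed_by (M \<beta>) (fibre D H \<beta>) (K \<beta>) (\<gamma> \<beta> T) t \<and>
        decomposed_by (M \<alpha>) (fibre D H \<alpha>) (K \<alpha>) (\<gamma> \<alpha> T) (\<lambda>p. fibre_compression D H \<alpha> \<beta> p (t p))"
      using t bounded by (auto simp: decomposed_by_def)
  next
    \<comment> \<open>R may come with another decomposition t, but \<open>gamma_compression\<close>
      holds for that one too, so R and \<open>\<gamma> \<alpha> T\<close> act through the same fibre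
      maps.\<close>
    fix R assume "\<exists>t. decomposed_by (M \<beta>) (fibre D H \<beta>) (K \<beta>) (\<gamma> \<beta> T) t \<and>
        decomposed_by (M \<alpha>) (fibre D H \<alpha>) (K \<alpha>) R (\<lambda>p. fibre_compression D H \<alpha> \<beta> p (t p))"
    then obtain t where t: "decomposed_by (M \<beta>) (fibre D H \<beta>) (K \<beta>) (\<gamma> \<beta> T) t"
      and R: "decomposed_by (M \<alpha>) (fibre D H \<alpha>) (K \<alpha>) R (\<lambda>p. fibre_compression D H \<alpha> \<beta> p (t p))"
      by blast
    have R_bounded: "R \<in> bounded_ops A.E"
      using R by (simp add: decomposed_by_def)
    have "R X = \<gamma> \<alpha> T X" if X: "X \<in> carr A.E" for X
    proof -
      obtain u where u: "u \<in> K \<alpha>" "X = clK \<alpha> u"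
        using X by (auto simp: carr_section_space)
      obtain r where r: "r \<in> R (clK \<alpha> u)"
        using A.op_ex_rep[OF R_bounded u(1)] by blast
      obtain w where w: "w \<in> \<gamma> \<alpha> T (clK \<alpha> u)"
        using A.op_ex_rep[OF bounded u(1)] by blast
      have "AE p in M \<alpha>. r p = fibre_compression D H \<alpha> \<beta> p (t p) (u p)"
        using R A.cl_carr[OF u(1)] ae_class_self[OF u(1), of "M \<alpha>"] r
        unfolding decomposed_by_def acts_fibrewise_def by blast
      then have "AE p in M \<alpha>. r p = w p"
        using gamma_compression[OF le T' t u(1) w] by eventually_elim simp
      then show ?thesis
        unfolding u(2) A.op_rep(2)[OF R_bounded u(1) r] A.op_rep(2)[OF bounded u(1) w]
        by (rule ae_class_eqI)
    qed
    then show "R = \<gamma> \<alpha> T"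
      using R_bounded bounded by (auto simp: bounded_ops_def intro: PiE_ext)
  qed
qed

section \<open>Linearity\<close>

lemma common_level:
  assumes "A \<in> carr EU" "B \<in> carr EU" "C \<in> carr EU"
  obtains \<alpha> where "A \<in> level \<alpha>" "B \<in> level \<alpha>" "C \<in> level \<alpha>"
proof -
  have "\<exists>\<alpha>. X \<in> level \<alpha>" if "X \<in> carr EU" for X
  proof -
    obtain u where u: "u \<in> U" "X = clU u"
      using \<open>X \<in> carr EU\<close> by (auto simp: carr_EU)
    obtain \<alpha> where "u \<in> lev \<alpha>"
      using common_lev[OF u(1) u(1)] by blast
    then show ?thesis
      using u(2) level_eq by blast
  qed
  then obtain \<alpha> \<beta> \<delta> where "A \<in> level \<alpha>" "B \<in> level \<beta>" "C \<in> level \<delta>"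
    using assms by metis
  moreover obtain \<epsilon> where "\<alpha> \<le> \<epsilon>" "\<beta> \<le> \<epsilon>"
    using directed by blast
  moreover obtain \<zeta> where "\<epsilon> \<le> \<zeta>" "\<delta> \<le> \<zeta>"
    using directed by blast
  ultimately have "A \<in> level \<zeta>" "B \<in> level \<zeta>" "C \<in> level \<zeta>"
    using level_mono order_trans by blast+
  then show ?thesis
    by (rule that)
qed

text \<open>The zero is defined as the class of the zero section. As a multiple of a member of a
  level it is seen to lie in that level, and \<open>V\<close> sends it to zero by
  homogeneity.\<close>

lemma vzero_EU:
  assumes A: "A \<in> carr EU"
  shows "vzero EU = vscale EU 0 A"
proof -
  obtain u where u: "u \<in> U" "A = clU u"
    using A by (auto simp: carr_EU)
  obtain w where w: "w \<in> U" "AE p in \<mu>. w p = vscale (D p) 0 (u p)"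
    using L.ex_scale[OF u(1)] by blast
  have "AE p in \<mu>. w p = vzero (D p)"
    using w(2) AE_space
    by eventually_elim (simp add: complex_inner_space.scale_zero[OF fibre_inner U_mem[OF u(1)]])
  then have "clU w = vzero EU"
    using ae_class_eqI[of w "\<lambda>p. vzero (D p)" \<mu> U] by (simp add: section_space_def)
  then show ?thesis
    using L.scale_cl[OF u(1) w] u(2) by simp
qed

lemma V_zero:
  assumes A: "A \<in> level \<alpha>"
  shows "vzero EU \<in> level \<alpha>" "V \<alpha> (vzero EU) = vzero (EK \<alpha>)"
proof -
  have eq: "vzero EU = vscale EU 0 A"
    using vzero_EU A level_sub by blast
  show "vzero EU \<in> level \<alpha>"
    unfolding eq by (rule level_scale[OF A])
  show "V \<alpha> (vzero EU) = vzero (EK \<alpha>)"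
    unfolding eq V_linear(3)[OF A] by (rule complex_inner_space.scale_zero[OF EK_inner V_linear(1)[OF A]])
qed

text \<open>Each axiom involves at most three vectors, which lie in a common level. There
  \<open>V \<alpha>\<close> is injective and respects the operations and the inner product, so the
  axiom is pulled back from \<open>EK \<alpha>\<close>. The laws serve to show that sums and
  multiples of locally bounded operators are again locally bounded.\<close>

lemma EU_inner: "complex_inner_space EU"
proof
  note rules = V_linear level_add level_scale
  note laws = complex_inner_space.add_assoc[OF EK_inner] complex_inner_space.add_zero[OF EK_inner]
    complex_inner_space.add_neg[OF EK_inner] complex_inner_space.scale_add_right[OF EK_inner]
    complex_inner_space.scale_add_left[OF EK_inner] complex_inner_space.scale_scale[OF EK_inner]
    complex_inner_space.scale_one[OF EK_inner] complex_inner_space.inner_add_left[OF EK_inner]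
    complex_inner_space.inner_scale_left[OF EK_inner]
  \<comment> \<open>Some element of \<open>EU\<close> is needed to locate its zero in a level;
    \<open>undefined\<close> is merely an arbitrary index.\<close>
  obtain Z where Z: "Z \<in> carr EU"
  proof -
    obtain Z where "Z \<in> level undefined"
      using V_surj[of undefined] complex_inner_space.zero_closed[OF EK_inner[of undefined]] by blast
    then show ?thesis
      using that level_sub by blast
  qed
  fix x y z c d
  show "vzero EU \<in> carr EU"
    using common_level[OF Z Z Z] V_zero(1) level_sub by (metis subsetD)
  {
    assume x: "x \<in> carr EU"
    obtain \<alpha> where a: "x \<in> level \<alpha>"
      by (rule common_level[OF x x x])
    show "vscale EU c x \<in> carr EU"
      using level_scale[OF a] level_sub by blast
    show "vadd EU x (vzero EU) = x"
      by (rule V_inj[of _ \<alpha>]) (use a in \<open>simp_all add: rules laws V_zero[OF a]\<close>)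
    show "vadd EU x (vscale EU (-1) x) = vzero EU"
      by (rule V_inj[of _ \<alpha>]) (use a in \<open>simp_all add: rules laws V_zero[OF a]\<close>)
    show "vscale EU (c + d) x = vadd EU (vscale EU c x) (vscale EU d x)"
      by (rule V_inj[of _ \<alpha>]) (use a in \<open>simp_all add: rules laws\<close>)
    show "vscale EU c (vscale EU d x) = vscale EU (c * d) x"
      by (rule V_inj[of _ \<alpha>]) (use a in \<open>simp_all add: rules laws\<close>)
    show "vscale EU 1 x = x"
      by (rule V_inj[of _ \<alpha>]) (use a in \<open>simp_all add: rules laws\<close>)
    show "0 \<le> Re (vinner EU x x)"
      unfolding V_inner[OF a a, symmetric]
      by (rule complex_inner_space.inner_nonneg[OF EK_inner V_linear(1)[OF a]])
    assume "vinner EU x x = 0"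
    then have "V \<alpha> x = vzero (EK \<alpha>)"
      using complex_inner_space.inner_definite[OF EK_inner V_linear(1)[OF a]] by (simp add: V_inner a)
    then show "x = vzero EU"
      using V_inj[OF a V_zero(1)[OF a]] V_zero(2)[OF a] by simp
  }
  {
    assume xy: "x \<in> carr EU" "y \<in> carr EU"
    obtain \<alpha> where a: "x \<in> level \<alpha>" "y \<in> level \<alpha>"
      by (rule common_level[OF xy xy(2)])
    show "vadd EU x y \<in> carr EU"
      using level_add[OF a] level_sub by blast
    show "vadd EU x y = vadd EU y x"
      by (rule V_inj[of _ \<alpha>])
         (use a complex_inner_space.add_commute[OF EK_inner V_linear(1)[OF a(1)] V_linear(1)[OF a(2)]]
          in \<open>simp_all add: rules\<close>)
    show "vscale EU c (vadd EU x y) = vadd EU (vscale EU c x) (vscale EU c y)"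
      by (rule V_inj[of _ \<alpha>]) (use a in \<open>simp_all add: rules laws\<close>)
    show "vinner EU (vscale EU c x) y = c * vinner EU x y"
      using V_inner[OF level_scale[OF a(1), of c] a(2)] V_inner[OF a] a by (simp add: V_linear laws)
    show "vinner EU x y = cnj (vinner EU y x)"
      unfolding V_inner[OF a, symmetric] V_inner[OF a(2,1), symmetric]
      by (rule complex_inner_space.inner_commute[OF EK_inner V_linear(1)[OF a(1)] V_linear(1)[OF a(2)]])
    assume z: "z \<in> carr EU"
    obtain \<beta> where b: "x \<in> level \<beta>" "y \<in> level \<beta>" "z \<in> level \<beta>"
      by (rule common_level[OF xy z])
    show "vadd EU (vadd EU x y) z = vadd EU x (vadd EU y z)"
      by (rule V_inj[of _ \<beta>]) (use b in \<open>simp_all add: rules laws\<close>)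
    show "vinner EU (vadd EU x y) z = vinner EU x z + vinner EU y z"
      using V_inner[OF level_add[OF b(1,2)] b(3)] V_inner[OF b(1,3)] V_inner[OF b(2,3)] b
      by (simp add: V_linear laws)
  }
qed

section \<open>Sums and multiples of operators in the commutant\<close>

lemma LBO_carr: "\<lbrakk>T \<in> LBO; A \<in> carr EU\<rbrakk> \<Longrightarrow> T A \<in> carr EU"
  unfolding locally_bounded_ops_def by blast

lemma LBO_ortho: "\<lbrakk>T \<in> LBO; A \<in> ortho EU (level \<alpha>)\<rbrakk> \<Longrightarrow> T A \<in> ortho EU (level \<alpha>)"
  unfolding locally_bounded_ops_def by blast

lemma LBO_bounded: "T \<in> LBO \<Longrightarrow> \<exists>C. \<forall>A\<in>level \<alpha>. vnorm EU (T A) \<le> C * vnorm EU A"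
  unfolding locally_bounded_ops_def bounded_on_def by blast

text \<open>Linearity of the map into the projective limit concerns its value at
  \<open>op_add EU T S\<close>, so the commutant must be closed under this operation; local
  boundedness is the first half of that.\<close>

lemma op_add_LBO:
  assumes T: "T \<in> LBO" and S: "S \<in> LBO"
  shows "op_add EU T S \<in> LBO"
proof -
  interpret EU: complex_inner_space EU
    by (rule EU_inner)
  have "linear_map EU EU (op_add EU T S)"
    unfolding linear_map_def
  proof (intro conjI ballI allI)
    show "op_add EU T S \<in> carr EU \<rightarrow> carr EU"
      using LBO_carr T S by (simp add: op_add_def)
  next
    fix A B assume AB: "A \<in> carr EU" "B \<in> carr EU"
    have "vadd EU (vadd EU (T A) (T B)) (vadd EU (S A) (S B)) = vadd EU (vadd EU (T A) (S A)) (vadd EU (T B) (S B))"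
      by (rule EU.vec_eqI) (use AB LBO_carr T S in simp_all)
    then show "op_add EU T S (vadd EU A B) = vadd EU (op_add EU T S A) (op_add EU T S B)"
      using AB by (simp add: op_add_def LBO_linear[OF T] LBO_linear[OF S])
  next
    fix c A assume A: "A \<in> carr EU"
    then show "op_add EU T S (vscale EU c A) = vscale EU c (op_add EU T S A)"
      by (simp add: op_add_def LBO_linear[OF T] LBO_linear[OF S] LBO_carr[OF T] LBO_carr[OF S] EU.scale_add_right)
  qed
  moreover have "op_add EU T S A \<in> level \<alpha>" if "A \<in> level \<alpha>" for A \<alpha>
    using level_add[OF LBO_level[OF T that] LBO_level[OF S that]] that level_sub by (auto simp: op_add_def)
  moreover have "op_add EU T S A \<in> ortho EU (level \<alpha>)" if A: "A \<in> ortho EU (level \<alpha>)" for A \<alpha>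
  proof -
    have "T A \<in> ortho EU (level \<alpha>)" "S A \<in> ortho EU (level \<alpha>)" "A \<in> carr EU"
      using LBO_ortho T S A by (auto simp: ortho_def)
    moreover have "B \<in> carr EU" if "B \<in> level \<alpha>" for B
      using that level_sub by blast
    ultimately show ?thesis
      by (simp add: ortho_def op_add_def)
  qed
  moreover have "bounded_on EU (level \<alpha>) (op_add EU T S)" for \<alpha>
  proof -
    obtain B C where BC: "\<And>A. A \<in> level \<alpha> \<Longrightarrow> vnorm EU (T A) \<le> B * vnorm EU A"
      "\<And>A. A \<in> level \<alpha> \<Longrightarrow> vnorm EU (S A) \<le> C * vnorm EU A"
      using LBO_bounded[OF T, of \<alpha>] LBO_bounded[OF S, of \<alpha>] by auto
    have "vnorm EU (op_add EU T S A) \<le> (B + C) * vnorm EU A" if A: "A \<in> level \<alpha>" for A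
    proof -
      have "A \<in> carr EU"
        using A level_sub by blast
      then show ?thesis
        using BC[OF A] EU.vnorm_triangle[of "T A" "S A"] LBO_carr T S
        by (simp add: op_add_def distrib_right)
    qed
    then show ?thesis
      unfolding bounded_on_def by blast
  qed
  moreover have "op_add EU T S \<in> carr EU \<rightarrow>\<^sub>E carr EU"
    using LBO_carr T S by (auto simp: op_add_def)
  ultimately show ?thesis
    unfolding locally_bounded_ops_def by blast
qed

lemma op_scale_LBO:
  assumes T: "T \<in> LBO"
  shows "op_scale EU c T \<in> LBO"
proof -
  interpret EU: complex_inner_space EU
    by (rule EU_inner)
  have "linear_map EU EU (op_scale EU c T)"
    unfolding linear_map_def
  proof (intro conjI ballI allI)
    show "op_scale EU c T \<in> carr EU \<rightarrow> carr EU"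
      using LBO_carr T by (simp add: op_scale_def)
  next
    fix A B assume "A \<in> carr EU" "B \<in> carr EU"
    then show "op_scale EU c T (vadd EU A B) = vadd EU (op_scale EU c T A) (op_scale EU c T B)"
      by (simp add: op_scale_def LBO_linear[OF T] LBO_carr[OF T] EU.scale_add_right)
  next
    fix d A assume "A \<in> carr EU"
    then show "op_scale EU c T (vscale EU d A) = vscale EU d (op_scale EU c T A)"
      by (simp add: op_scale_def LBO_linear[OF T] LBO_carr[OF T] EU.scale_scale mult.commute)
  qed
  moreover have "op_scale EU c T A \<in> level \<alpha>" if "A \<in> level \<alpha>" for A \<alpha>
    using level_scale[OF LBO_level[OF T that]] that level_sub by (auto simp: op_scale_def)
  moreover have "op_scale EU c T A \<in> ortho EU (level \<alpha>)" if A: "A \<in> ortho EU (level \<alpha>)" for A \<alpha>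
  proof -
    have "T A \<in> ortho EU (level \<alpha>)" "A \<in> carr EU"
      using LBO_ortho T A by (auto simp: ortho_def)
    moreover have "B \<in> carr EU" if "B \<in> level \<alpha>" for B
      using that level_sub by blast
    ultimately show ?thesis
      by (simp add: ortho_def op_scale_def)
  qed
  moreover have "bounded_on EU (level \<alpha>) (op_scale EU c T)" for \<alpha>
  proof -
    obtain C where C: "\<And>A. A \<in> level \<alpha> \<Longrightarrow> vnorm EU (T A) \<le> C * vnorm EU A"
      using LBO_bounded[OF T, of \<alpha>] by auto
    have "vnorm EU (op_scale EU c T A) \<le> (cmod c * C) * vnorm EU A" if A: "A \<in> level \<alpha>" for A
    proof -
      have "A \<in> carr EU"
        using A level_sub by blast
      then show ?thesis
        using mult_left_mono[OF C[OF A], of "cmod c"] LBO_carr[OF T]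
        by (simp add: op_scale_def EU.vnorm_scale mult.assoc)
    qed
    then show ?thesis
      unfolding bounded_on_def by blast
  qed
  moreover have "op_scale EU c T \<in> carr EU \<rightarrow>\<^sub>E carr EU"
    using LBO_carr T by (auto simp: op_scale_def)
  ultimately show ?thesis
    unfolding locally_bounded_ops_def by blast
qed

lemma diagonalizable_LBO: "S \<in> diagonalizable_ops M \<mu> D H U \<Longrightarrow> S \<in> LBO"
  by (simp add: diagonalizable_ops_def loc_decomposable_def)

lemma diag'_commute:
  "\<lbrakk>T \<in> diag'; S \<in> diagonalizable_ops M \<mu> D H U; A \<in> carr EU\<rbrakk> \<Longrightarrow> T (S A) = S (T A)"
  by (simp add: diag_commutant_def commutant_def)

lemma diag'I:
  assumes "T \<in> LBO" "\<And>S A. \<lbrakk>S \<in> diagonalizable_ops M \<mu> D H U; A \<in> carr EU\<rbrakk> \<Longrightarrow> T (S A) = S (T A)"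
  shows "T \<in> diag'"
  using assms by (simp add: diag_commutant_def commutant_def)

lemma op_add_diag':
  assumes T: "T \<in> diag'" and S: "S \<in> diag'"
  shows "op_add EU T S \<in> diag'"
proof (rule diag'I)
  show "op_add EU T S \<in> LBO"
    by (rule op_add_LBO[OF diag'_LBO[OF T] diag'_LBO[OF S]])
next
  fix R A assume R: "R \<in> diagonalizable_ops M \<mu> D H U" and A: "A \<in> carr EU"
  show "op_add EU T S (R A) = R (op_add EU T S A)"
    using LBO_linear(1)[OF diagonalizable_LBO[OF R] LBO_carr[OF diag'_LBO[OF T] A] LBO_carr[OF diag'_LBO[OF S] A]]
      LBO_carr[OF diagonalizable_LBO[OF R] A] A diag'_commute[OF T R A] diag'_commute[OF S R A]
    by (simp add: op_add_def)
qed

lemma op_scale_diag':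
  assumes T: "T \<in> diag'"
  shows "op_scale EU c T \<in> diag'"
proof (rule diag'I)
  show "op_scale EU c T \<in> LBO"
    by (rule op_scale_LBO[OF diag'_LBO[OF T]])
next
  fix R A assume R: "R \<in> diagonalizable_ops M \<mu> D H U" and A: "A \<in> carr EU"
  show "op_scale EU c T (R A) = R (op_scale EU c T A)"
    using LBO_linear(2)[OF diagonalizable_LBO[OF R] LBO_carr[OF diag'_LBO[OF T] A]]
      LBO_carr[OF diagonalizable_LBO[OF R] A] A diag'_commute[OF T R A]
    by (simp add: op_scale_def)
qed

lemma gamma_op_add:
  assumes T: "T \<in> LBO" and S: "S \<in> LBO"
  shows "\<gamma> \<alpha> (op_add EU T S) = op_add (EK \<alpha>) (\<gamma> \<alpha> T) (\<gamma> \<alpha> S)"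
proof
  fix A
  show "\<gamma> \<alpha> (op_add EU T S) A = op_add (EK \<alpha>) (\<gamma> \<alpha> T) (\<gamma> \<alpha> S) A"
  proof (cases "A \<in> carr (EK \<alpha>)")
    case True
    have "W \<alpha> A \<in> carr EU"
      using W_level(1)[OF True] level_sub by blast
    then show ?thesis
      using True V_linear(2)[OF LBO_level[OF T W_level(1)[OF True]] LBO_level[OF S W_level(1)[OF True]]]
      by (simp add: op_add_def gamma_apply)
  qed (simp add: op_add_def gamma_map_def)
qed

lemma gamma_op_scale:
  assumes T: "T \<in> LBO"
  shows "\<gamma> \<alpha> (op_scale EU c T) = op_scale (EK \<alpha>) c (\<gamma> \<alpha> T)"
proof
  fix A
  show "\<gamma> \<alpha> (op_scale EU c T) A = op_scale (EK \<alpha>) c (\<gamma> \<alpha> T) A"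
  proof (cases "A \<in> carr (EK \<alpha>)")
    case True
    have "W \<alpha> A \<in> carr EU"
      using W_level(1)[OF True] level_sub by blast
    then show ?thesis
      using True V_linear(3)[OF LBO_level[OF T W_level(1)[OF True]]]
      by (simp add: op_scale_def gamma_apply)
  qed (simp add: op_scale_def gamma_map_def)
qed

text \<open>The coordinates force the map to send T to the family of all
  \<open>\<gamma> \<alpha> T\<close>, and extensionality fixes it outside the commutant, so
  uniqueness is literal equality. Continuity into a subspace of a product is checked
  coordinatewise.\<close>

lemma limit_map_exists_unique:
  "\<exists>!\<phi>. \<phi> \<in> diag' \<rightarrow>\<^sub>E proj_limit M D H K
     \<and> linear_into_limit M \<mu> D H U K \<phi>
     \<and> continuous_map (diag_commutant_topology M \<mu> D H U) (proj_limit_topology M D H K) \<phi>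
     \<and> (\<forall>\<alpha>. \<forall>T\<in>diag'. \<phi> T \<alpha> = \<gamma> \<alpha> T)"
proof (rule ex1I)
  let ?X = "diag_commutant_topology M \<mu> D H U"
  define \<phi> where "\<phi> = (\<lambda>T\<in>diag'. \<lambda>\<alpha>. \<gamma> \<alpha> T)"
  have lim: "(\<lambda>\<alpha>. \<gamma> \<alpha> T) \<in> proj_limit M D H K" if "T \<in> diag'" for T
    using gamma_decomposable[OF that] phi_gamma[OF _ that] by (auto simp: proj_limit_def)
  have X_sub: "topspace ?X \<subseteq> diag'"
    by (simp add: diag_commutant_topology_def)
  have "linear_into_limit M \<mu> D H U K \<phi>"
    by (simp add: linear_into_limit_def \<phi>_def op_add_diag' op_scale_diag' gamma_op_add gamma_op_scale diag'_LBO)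
  moreover have "continuous_map ?X (proj_limit_topology M D H K) \<phi>"
    unfolding proj_limit_topology_def
  proof (rule continuous_map_into_subtopology)
    show "continuous_map ?X (product_topology (level_topology M D H K) UNIV) \<phi>"
      unfolding continuous_map_componentwise_UNIV
    proof
      fix \<alpha>
      show "continuous_map ?X (level_topology M D H K \<alpha>) (\<lambda>T. \<phi> T \<alpha>)"
        by (rule continuous_map_eq[OF gamma_continuous]) (use X_sub in \<open>auto simp: \<phi>_def\<close>)
    qed
    show "\<phi> \<in> topspace ?X \<rightarrow> proj_limit M D H K"
      using X_sub lim by (auto simp: \<phi>_def)
  qed
  ultimately show "\<phi> \<in> diag' \<rightarrow>\<^sub>E proj_limit M D H K \<and> linear_into_limit M \<mu> D H U K \<phi>
      \<and> continuous_map ?X (proj_limit_topology M D H K) \<phi> \<and> (\<forall>\<alpha>. \<forall>T\<in>diag'. \<phi> T \<alpha> = \<gamma> \<alpha> T)"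
    using lim by (auto simp: \<phi>_def)
  fix \<psi> assume \<psi>: "\<psi> \<in> diag' \<rightarrow>\<^sub>E proj_limit M D H K \<and> linear_into_limit M \<mu> D H U K \<psi>
      \<and> continuous_map ?X (proj_limit_topology M D H K) \<psi> \<and> (\<forall>\<alpha>. \<forall>T\<in>diag'. \<psi> T \<alpha> = \<gamma> \<alpha> T)"
  show "\<psi> = \<phi>"
  proof
    fix T
    show "\<psi> T = \<phi> T"
    proof (cases "T \<in> diag'")
      case True
      then have "\<psi> T \<alpha> = \<gamma> \<alpha> T" for \<alpha>
        using \<psi> by blast
      then show ?thesis
        using True by (simp add: \<phi>_def fun_eq_iff)
    next
      case False
      have "\<psi> \<in> diag' \<rightarrow>\<^sub>E proj_limit M D H K"
        using \<psi> by blast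
      then have "\<psi> T = undefined"
        using False by (rule PiE_arb)
      then show ?thesis
        using False unfolding \<phi>_def by simp
    qed
  qed
qed

end

theorem theorem2p20:
  fixes M :: "'i::order \<Rightarrow> 'x measure"
    and \<mu> :: "'x measure"
    and D :: "'x \<Rightarrow> 'h ipspace"
    and H :: "'i \<Rightarrow> 'x \<Rightarrow> 'h set"
    and U :: "('x \<Rightarrow> 'h) set"
    and K :: "'i \<Rightarrow> ('x \<Rightarrow> 'h) set"
  assumes directed: "\<forall>\<alpha> \<beta> :: 'i. \<exists>\<gamma>. \<alpha> \<le> \<gamma> \<and> \<beta> \<le> \<gamma>"
    and base: "locally_standard_measure_space M \<mu>"
    and fibres: "\<forall>p\<in>space \<mu>. locally_hilbert (D p) (\<lambda>\<alpha>. H \<alpha> p)"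
    and fibres_separable: "\<forall>p\<in>space \<mu>. \<forall>\<alpha>. separable (fibre D H \<alpha> p)"
    and integral: "loc_direct_integral M \<mu> D H U"
    and classical: "\<forall>\<alpha>. classical_direct_integral (M \<alpha>) (fibre D H \<alpha>) (K \<alpha>)"
    and V_unitary: "\<forall>\<alpha>. unitary_map (level_space M \<mu> D H U \<alpha>) (level_classical M D H K \<alpha>)
                          (V_map M K \<alpha>)"
  shows
    "(\<forall>\<alpha>. gamma_map M \<mu> D H U K \<alpha> \<in> diag_commutant M \<mu> D H U \<rightarrow> level_decomposable M D H K \<alpha>
        \<and> continuous_map (diag_commutant_topology M \<mu> D H U) (level_topology M D H K \<alpha>)
             (gamma_map M \<mu> D H U K \<alpha>))
     \<and> (\<forall>\<alpha> \<beta>. \<alpha> \<le> \<beta> \<longrightarrow> (\<forall>T\<in>diag_commutant M \<mu> D H U.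
          phi_map M D H K \<alpha> \<beta> (gamma_map M \<mu> D H U K \<beta> T) = gamma_map M \<mu> D H U K \<alpha> T))
     \<and> (\<exists>!\<phi>. \<phi> \<in> diag_commutant M \<mu> D H U \<rightarrow>\<^sub>E proj_limit M D H K
          \<and> linear_into_limit M \<mu> D H U K \<phi>
          \<and> continuous_map (diag_commutant_topology M \<mu> D H U) (proj_limit_topology M D H K) \<phi>
          \<and> (\<forall>\<alpha>. \<forall>T\<in>diag_commutant M \<mu> D H U. \<phi> T \<alpha> = gamma_map M \<mu> D H U K \<alpha> T))"
proof -
  interpret loc_direct_integral_setting M \<mu> D H U K
  proof (intro loc_direct_integral_setting.intro locally_standard.intro
      loc_direct_integral_setting_axioms.intro)
    show "\<exists>\<gamma>. \<alpha> \<le> \<gamma> \<and> \<beta> \<le> \<gamma>" for \<alpha> \<beta> :: 'i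
      using directed by blast
    show "locally_hilbert (D p) (\<lambda>\<alpha>. H \<alpha> p)" if "p \<in> space \<mu>" for p
      using fibres that by (rule bspec)
    show "classical_direct_integral (M \<alpha>) (fibre D H \<alpha>) (K \<alpha>)" for \<alpha>
      using classical by (rule spec)
    show "unitary_map (level_space M \<mu> D H U \<alpha>) (level_classical M D H K \<alpha>) (V_map M K \<alpha>)" for \<alpha>
      using V_unitary by (rule spec)
  qed (rule base integral)+
  show ?thesis
    by (intro conjI allI impI ballI Pi_I gamma_decomposable gamma_continuous phi_gamma
        limit_map_exists_unique)
qed

end
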